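(* Let $(\alpha,\beta)\in(0,1)\times(0,1)$ and let $f\in\mathcal{A}^{+}_{\alpha,\beta}$ be such that $Z_f=(\{1\}\times\overline{\mathbb{D}})\cup(\overline{\mathbb{D}}\times\{1\})$. Suppose that $$\big|\log|f(z,w)|\big|=o\big(1/\inf(|1-z|,|1-w|)\big)\qquad\text{as } z\to1 \text{ or } w\to 1,$$ i.e. for every $\varepsilon>0$ there is $\eta>0$ such that $\big|\log|f(z,w)|\big|\le \varepsilon/\inf(|1-z|,|1-w|)$ for all $(z,w)\in\mathbb{D}^2$ with $\inf(|1-z|,|1-w|)<\eta$. Then $$I_{\mathcal{A}^{+}_{\alpha,\beta}}(f)=I_{\mathcal{A}^{+}_{\alpha,\beta}}\big((\{1\}\times\overline{\mathbb{D}})\cup(\overline{\mathbb{D}}\times\{1\})\big).$$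
   Context: $\mathbb{D}$ is the open unit disc of $\mathbb{C}$. $\mathcal{A}(\mathbb{D}^2)$ is the algebra of functions continuous on $\overline{\mathbb{D}}^2$ and holomorphic on $\mathbb{D}^2$, with the sup norm. For $\alpha,\beta\ge 0$, $\mathcal{A}^{+}_{\alpha,\beta}$ is the Banach algebra (pointwise product) of all $f(z,w)=\sum_{n,m\ge 0}a_{n,m}z^nw^m\in\mathcal{A}(\mathbb{D}^2)$ with $\|f\|_{\alpha,\beta}:=\sum_{n,m\ge0}|a_{n,m}|(1+n)^{\alpha}(1+m)^{\beta}<\infty$. For a Banach algebra $B\subset\mathcal{A}(\mathbb{D}^2)$, $f\in B$ and a closed set $E\subset\overline{\mathbb{D}}^2$: $I_B(f)=\overline{fB}$ (closure in the norm of $B$) is the closed ideal generated by $f$; $Z_f=\{z\in\overline{\mathbb{D}}^2: f(z)=0\}$; $I_B(E)=\{g\in B: g|_E=0\}$. *)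

theory Defs
  imports "HOL-Complex_Analysis.Complex_Analysis"
begin

abbreviation open_bidisc :: "(complex \<times> complex) set"
  where "open_bidisc \<equiv> ball 0 1 \<times> ball 0 1"

abbreviation closed_bidisc :: "(complex \<times> complex) set"
  where "closed_bidisc \<equiv> cball 0 1 \<times> cball 0 1"

text \<open>Functions on the closed bidisc are total functions whose values elsewhere are irrelevant:
  membership in the algebras, norm, zero set and the ideals below (for \<open>E \<subseteq> closed_bidisc\<close>)
  do not depend on them.  Hence two such ideals are equal iff the sets of restrictions of their
  members to the closed bidisc are equal.\<close>

text \<open>Joint complex differentiability: the derivative at each point exists and is
  \<open>\<complex>\<close>-linear.\<close>

definition holomorphic2_on :: "(complex \<times> complex \<Rightarrow> complex) \<Rightarrow> (complex \<times> complex) set \<Rightarrow> bool"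
  where "holomorphic2_on f S \<longleftrightarrow>
    (\<forall>p\<in>S. \<exists>A B. (f has_derivative (\<lambda>(h, k). A * h + B * k)) (at p))"

definition bidisc_algebra :: "(complex \<times> complex \<Rightarrow> complex) set"
  where "bidisc_algebra = {f. continuous_on closed_bidisc f \<and> holomorphic2_on f open_bidisc}"

definition expands2 :: "(complex \<times> complex \<Rightarrow> complex) \<Rightarrow> (nat \<times> nat \<Rightarrow> complex) \<Rightarrow> bool"
  where "expands2 f a \<longleftrightarrow>
    (\<forall>(z, w)\<in>open_bidisc. ((\<lambda>(n, m). a (n, m) * z ^ n * w ^ m) has_sum f (z, w)) UNIV)"

lemma powser_coeff_unique0:
  fixes c :: "nat \<Rightarrow> complex"
  assumes "\<And>z. z \<in> ball 0 1 \<Longrightarrow> ((\<lambda>n. c n * z ^ n) has_sum 0) UNIV"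
  shows "c n = 0"
proof (rule ccontr)
  assume n: "c n \<noteq> 0"
  have sums0: "(\<lambda>n. c n * (z - 0) ^ n) sums 0" if "norm (z - 0) < 1" for z
    using has_sum_imp_sums[OF assms[of z]] that by simp
  have "c 0 = 0"
    using sums0[of 0] by simp
  with n have "n > 0"
    by (cases n) auto
  obtain s where s: "0 < s" "\<And>z::complex. z \<in> cball 0 s - {0} \<Longrightarrow> (0::complex) \<noteq> 0"
    by (rule powser_0_nonzero[of 1 0 c "\<lambda>_. 0", OF _ sums0 _ n \<open>n > 0\<close>])
      (simp, assumption, simp, blast)
  have "complex_of_real s \<in> cball 0 s - {0}"
    using s(1) by simp
  from s(2)[OF this] show False
    by simp
qed

lemma expands2_unique:
  assumes "expands2 f a" "expands2 f b"
  shows "a = b"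
proof -
  define c where "c = (\<lambda>p. a p - b p)"
  have c: "((\<lambda>(n, m). c (n, m) * z ^ n * w ^ m) has_sum 0) (UNIV \<times> UNIV)"
    if "z \<in> ball 0 1" "w \<in> ball 0 1" for z w
  proof -
    have "((\<lambda>x. (case x of (n, m) \<Rightarrow> a (n, m) * z ^ n * w ^ m) +
             - (case x of (n, m) \<Rightarrow> b (n, m) * z ^ n * w ^ m)) has_sum (f (z, w) + - f (z, w))) UNIV"
      using assms that unfolding expands2_def
      by (intro has_sum_add has_sum_uminus[THEN iffD2]) auto
    moreover have "(\<lambda>x. (case x of (n, m) \<Rightarrow> a (n, m) * z ^ n * w ^ m) +
             - (case x of (n, m) \<Rightarrow> b (n, m) * z ^ n * w ^ m)) = (\<lambda>(n, m). c (n, m) * z ^ n * w ^ m)"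
      by (simp add: c_def fun_eq_iff left_diff_distrib)
    ultimately show ?thesis by simp
  qed
  have inner: "(\<lambda>m. c (n, m) * w ^ m) summable_on UNIV" if w: "w \<in> ball 0 1" for n w
  proof -
    have "(\<lambda>(n, m). c (n, m) * (1/2) ^ n * w ^ m) summable_on (UNIV \<times> UNIV)"
      using c[of "1/2" w] w unfolding summable_on_def by force
    hence "(\<lambda>m. c (n, m) * (1/2) ^ n * w ^ m) summable_on UNIV"
      using summable_on_SigmaD1[of "\<lambda>n m. c (n, m) * (1/2) ^ n * w ^ m" UNIV "\<lambda>_. UNIV" n] by simp
    hence "(\<lambda>m. 2 ^ n * (c (n, m) * (1/2) ^ n * w ^ m)) summable_on UNIV"
      by (rule summable_on_cmult_right)
    moreover have "(\<lambda>m. 2 ^ n * (c (n, m) * (1/2) ^ n * w ^ m)) = (\<lambda>m. c (n, m) * w ^ m)"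
      by (simp add: fun_eq_iff power_one_over)
    ultimately show ?thesis by simp
  qed
  have outer: "((\<lambda>n. infsum (\<lambda>m. c (n, m) * w ^ m) UNIV * z ^ n) has_sum 0) UNIV"
    if z: "z \<in> ball 0 1" and w: "w \<in> ball 0 1" for z w
  proof (rule has_sum_SigmaD[where B = "\<lambda>_. UNIV", OF c[OF z w]])
    fix n
    have "((\<lambda>m. c (n, m) * w ^ m * z ^ n) has_sum (infsum (\<lambda>m. c (n, m) * w ^ m) UNIV * z ^ n)) UNIV"
      by (intro has_sum_cmult_left has_sum_infsum inner w)
    thus "((\<lambda>m. case (n, m) of (n, m) \<Rightarrow> c (n, m) * z ^ n * w ^ m) has_sum
            (infsum (\<lambda>m. c (n, m) * w ^ m) UNIV * z ^ n)) UNIV"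
      by (simp add: mult_ac)
  qed
  have inner0: "infsum (\<lambda>m. c (n, m) * w ^ m) UNIV = 0" if "w \<in> ball 0 1" for n w
    using outer[OF _ that] by (rule powser_coeff_unique0)
  have "((\<lambda>m. c (n, m) * w ^ m) has_sum 0) UNIV" if "w \<in> ball 0 1" for n w
    using has_sum_infsum[OF inner[OF that, of n]] inner0[OF that, of n] by simp
  hence "c (n, m) = 0" for n m
    by (rule powser_coeff_unique0)
  thus ?thesis by (simp add: c_def fun_eq_iff)
qed

definition coeff2 :: "(complex \<times> complex \<Rightarrow> complex) \<Rightarrow> nat \<times> nat \<Rightarrow> complex"
  where "coeff2 f = (THE a. expands2 f a)"

lemma coeff2_eq: "expands2 f a \<Longrightarrow> coeff2 f = a"
  unfolding coeff2_def using expands2_unique by blast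

definition wiener_weight :: "real \<Rightarrow> real \<Rightarrow> nat \<times> nat \<Rightarrow> real"
  where "wiener_weight \<alpha> \<beta> = (\<lambda>(n, m). (1 + real n) powr \<alpha> * (1 + real m) powr \<beta>)"

definition wiener_algebra :: "real \<Rightarrow> real \<Rightarrow> (complex \<times> complex \<Rightarrow> complex) set"
  where "wiener_algebra \<alpha> \<beta> =
    {f \<in> bidisc_algebra. \<exists>a. expands2 f a \<and> (\<lambda>p. norm (a p) * wiener_weight \<alpha> \<beta> p) summable_on UNIV}"

definition wiener_norm :: "real \<Rightarrow> real \<Rightarrow> (complex \<times> complex \<Rightarrow> complex) \<Rightarrow> real"
  where "wiener_norm \<alpha> \<beta> f = (\<Sum>\<^sub>\<infinity>p. norm (coeff2 f p) * wiener_weight \<alpha> \<beta> p)"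

text \<open>In the following, a Banach algebra of functions is given by its carrier \<open>B\<close> and its
  norm \<open>N\<close>.\<close>

definition norm_closure ::
    "(complex \<times> complex \<Rightarrow> complex) set \<Rightarrow> ((complex \<times> complex \<Rightarrow> complex) \<Rightarrow> real)
      \<Rightarrow> (complex \<times> complex \<Rightarrow> complex) set \<Rightarrow> (complex \<times> complex \<Rightarrow> complex) set"
  where "norm_closure B N S = {g \<in> B. \<forall>\<epsilon>>0. \<exists>h\<in>S. N (\<lambda>p. g p - h p) < \<epsilon>}"

definition closed_ideal_gen ::
    "(complex \<times> complex \<Rightarrow> complex) set \<Rightarrow> ((complex \<times> complex \<Rightarrow> complex) \<Rightarrow> real)
      \<Rightarrow> (complex \<times> complex \<Rightarrow> complex) \<Rightarrow> (complex \<times> complex \<Rightarrow> complex) set"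
  where "closed_ideal_gen B N f = norm_closure B N ((\<lambda>h p. f p * h p) ` B)"

definition vanishing_ideal ::
    "(complex \<times> complex \<Rightarrow> complex) set \<Rightarrow> (complex \<times> complex) set
      \<Rightarrow> (complex \<times> complex \<Rightarrow> complex) set"
  where "vanishing_ideal B E = {g \<in> B. \<forall>p\<in>E. g p = 0}"

definition zero_set :: "(complex \<times> complex \<Rightarrow> complex) \<Rightarrow> (complex \<times> complex) set"
  where "zero_set f = {p \<in> closed_bidisc. f p = 0}"

end

(* Let x = 1 - z, y = 1 - w and let I be the closed ideal generated by f.

   If g vanishes on the zero set of f, then g is the sum of a(n,m) (z^n - 1) (w^m - 1), so it suffices
   that xy is in I; and since the exponents are smaller than 1, x^k is the limit of x^(k+1) / (x + e) as
   e -> 0, so it suffices that x^4 y^4 is in I.  This element is the limit, as kappa -> 0 and uniformly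
   in s, of E(z,w) = D(z) D(w), where D(z) = x^4 exp(- kappa / (x + s)).  On the circle of radius about s
   around 1, D is at most exp(- kappa / (50 s)), which beats any fixed power of 1/f, because
   1/|f| <= exp(8 eps / s) outside this circle and eps may be chosen after kappa.

   Fix kappa and choose N so that exp(eps / s) is a power of N.  Write f = p + g with p the
   truncation of f to degrees below N.  As f has more than an absolutely convergent series, the norm of g
   in the unweighted algebra is at most a negative power of N.  Let y_i be the double Cauchy integral of
   E / p^i over the circle of radius 1 + 1/N^2 without the arc near 1.  Moving the remaining arc inwards
   to a path near 1, where D is tiny, shows that p y_(i+1) - y_i and E - y_0 are tiny, so
   y_1 - g y_2 + g^2 y_3 - ... , stopped after a fixed number of terms, is almost the quotient E / f. *)

theory Submission
  imports Defs
begin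

section \<open>Weighted algebras of absolutely convergent double power series\<close>

text \<open>\<open>f\<close> lives only on the closed bidisc, and Cauchy integrals over the torus
  itself would give merely bounded coefficients. A polynomial can be used on a radius R > 1, where
  Cauchy coefficients decay like R^(-n). This costs a norm factor (1 - 1/R)^(-4), about N^8 for R =
  1 + 1/N^2, but there a polynomial of degree below N hardly changes, so p inherits the lower bound
  for \<open>f\<close>. Powers of g repay the cost. In the weighted norm g is merely bounded; but
  weights with exponents at most 1 are subadditive in each index, so at most two factors of g^n
  carry a weight and the others contribute the unweighted norm, of order N^(-gamma) with gamma =
  min(alpha, beta). As 1/|p| is at most 2 N^(gamma/4), each further power of g / p gains N^(-3
  gamma/4) up to a constant, and about 13/gamma powers beat N^8. The fourth power in D makes the
  convergence in kappa uniform in s: two derivatives of exp(- kappa / (x + s)) produce (x + s)^(-4),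
  and |x| <= |x + s| on the disc. They bound the coefficients by a multiple of 1/n^2, summable
  against n^alpha for alpha < 1.\<close>

definition conv2 :: "(nat \<times> nat \<Rightarrow> 'a::comm_semiring_0) \<Rightarrow> (nat \<times> nat \<Rightarrow> 'a) \<Rightarrow> nat \<times> nat \<Rightarrow> 'a"
  where "conv2 a b = (\<lambda>(n, m). \<Sum>k\<le>n. \<Sum>l\<le>m. a (k, l) * b (n - k, m - l))"

lemma has_sum_sum:
  fixes f :: "'i \<Rightarrow> 'b \<Rightarrow> 'a::topological_comm_monoid_add"
  assumes "\<And>i. i \<in> I \<Longrightarrow> (f i has_sum s i) A"
  shows "((\<lambda>x. \<Sum>i\<in>I. f i x) has_sum (\<Sum>i\<in>I. s i)) A"
  using assms by (induction I rule: infinite_finite_induct) (auto intro: has_sum_add)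

text \<open>The product of the sums is the sum of \<open>F\<close> over all pairs of indices, by
  Fubini for an absolutely summable family. Sorting the pairs by the sum of their two indices, with
  the first index kept as inner variable, turns it into the Cauchy product.\<close>

lemma has_sum_conv2:
  fixes a b :: "nat \<times> nat \<Rightarrow> 'a::{real_normed_field, banach, second_countable_topology}"
  assumes a: "(a has_sum A) UNIV" "(\<lambda>p. norm (a p)) summable_on UNIV"
    and b: "(b has_sum B) UNIV" "(\<lambda>p. norm (b p)) summable_on UNIV"
  shows "(conv2 a b has_sum (A * B)) UNIV"
proof -
  define F where "F = (\<lambda>(p, q). a p * b q)"
  have "(\<lambda>pq. norm (F pq)) summable_on (UNIV \<times> UNIV)"
    unfolding Infinite_Sum.abs_summable_on_Sigma_iff F_def
  proof (intro conjI ballI)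
    show "(\<lambda>q. norm (case (p, q) of (p, q) \<Rightarrow> a p * b q)) summable_on UNIV" for p
      using b(2) by (simp add: norm_mult summable_on_cmult_right)
    show "(\<lambda>p. norm (\<Sum>\<^sub>\<infinity>q. norm (case (p, q) of (p, q) \<Rightarrow> a p * b q))) summable_on UNIV"
      using a(2) by (simp add: norm_mult infsum_cmult_right' summable_on_cmult_left abs_mult)
  qed
  hence s: "F summable_on (UNIV \<times> UNIV)"
    by (rule abs_summable_summable)
  have "(F has_sum (A * B)) (UNIV \<times> UNIV)"
  proof (rule has_sum_SigmaI[OF _ _ s])
    show "((\<lambda>q. F (p, q)) has_sum (a p * B)) UNIV" for p
      unfolding F_def by (simp add: has_sum_cmult_right b)
    show "((\<lambda>p. a p * B) has_sum A * B) UNIV"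
      by (intro has_sum_cmult_left a)
  qed
  moreover have "((\<lambda>((n, m), (k, l)). a (k, l) * b (n - k, m - l)) has_sum (A * B))
      (SIGMA (n, m):UNIV. {..n} \<times> {..m}) = (F has_sum (A * B)) (UNIV \<times> UNIV)"
    by (rule has_sum_reindex_bij_witness[where
        j = "\<lambda>((n, m), (k, l)). ((k, l), (n - k, m - l))" and
        i = "\<lambda>((k, l), (n, m)). ((n + k, m + l), (k, l))"]) (auto simp: F_def)
  ultimately have "((\<lambda>((n, m), (k, l)). a (k, l) * b (n - k, m - l)) has_sum (A * B))
      (SIGMA (n, m):UNIV. {..n} \<times> {..m})" by simp
  hence "((\<lambda>((n, m), (k, l)). a (k, l) * b (n - k, m - l)) has_sum (A * B))
      (Sigma UNIV (\<lambda>p. {..fst p} \<times> {..snd p}))" by (simp add: case_prod_unfold)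
  thus ?thesis
  proof (rule has_sum_SigmaD)
    fix p :: "nat \<times> nat"
    obtain n m where p: "p = (n, m)" by (cases p)
    show "((\<lambda>y. case (p, y) of (x, xa) \<Rightarrow> (case x of (n, m) \<Rightarrow> \<lambda>(k, l). a (k, l) * b (n - k, m - l)) xa)
         has_sum conv2 a b p) ({..fst p} \<times> {..snd p})"
      by (rule has_sum_finiteI) (auto simp: p conv2_def sum.cartesian_product)
  qed
qed

section \<open>The weighted algebra seen through coefficients\<close>

text \<open>This is \<open>wiener_algebra\<close> without continuity and joint differentiability.
  Membership depends on values on the open bidisc only, so functions given by their coefficients,
  such as the truncated Cauchy integrals, belong to it at once. Polynomial approximation restores
  the missing conditions at the end.\<close>

definition wiener_class :: "real \<Rightarrow> real \<Rightarrow> (complex \<times> complex \<Rightarrow> complex) set"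
  where "wiener_class \<alpha> \<beta> =
    {f. \<exists>a. expands2 f a \<and> (\<lambda>p. norm (a p) * wiener_weight \<alpha> \<beta> p) summable_on UNIV}"

lemma wiener_weight_nonneg [simp]: "0 \<le> wiener_weight \<alpha> \<beta> p"
  by (simp add: wiener_weight_def case_prod_unfold)

lemma wiener_weight_ge_1: "0 \<le> \<alpha> \<Longrightarrow> 0 \<le> \<beta> \<Longrightarrow> 1 \<le> wiener_weight \<alpha> \<beta> p"
  unfolding wiener_weight_def case_prod_unfold
  by (metis ge_one_powr_ge_zero le_add_same_cancel1 mult_ge1_I of_nat_0_le_iff)

lemma wiener_weight_mono:
  "\<alpha> \<le> \<alpha>' \<Longrightarrow> \<beta> \<le> \<beta>' \<Longrightarrow> wiener_weight \<alpha> \<beta> p \<le> wiener_weight \<alpha>' \<beta>' p"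
  unfolding wiener_weight_def case_prod_unfold by (intro mult_mono powr_mono) auto

lemma wiener_weight_0_0 [simp]: "wiener_weight 0 0 p = 1"
  by (simp add: wiener_weight_def case_prod_unfold)

lemma one_plus_add_powr_le:
  assumes "0 \<le> \<alpha>"
  shows "(1 + real (k + l)) powr \<alpha> \<le> (1 + real k) powr \<alpha> * (1 + real l) powr \<alpha>"
proof -
  have "1 + real (k + l) \<le> (1 + real k) * (1 + real l)"
    by (simp add: algebra_simps)
  hence "(1 + real (k + l)) powr \<alpha> \<le> ((1 + real k) * (1 + real l)) powr \<alpha>"
    using assms by (intro powr_mono2) auto
  thus ?thesis by (simp add: powr_mult)
qed

text \<open>On (0, 1] one has \<open>u \<le> u powr \<alpha>\<close>. Applied to the two parts
  \<open>x / (x + y)\<close> and \<open>y / (x + y)\<close> of 1, and rescaled, this is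
  subadditivity.\<close>

lemma powr_subadd:
  fixes x y :: real
  assumes "0 \<le> \<alpha>" "\<alpha> \<le> 1" "0 < x" "0 < y"
  shows "(x + y) powr \<alpha> \<le> x powr \<alpha> + y powr \<alpha>"
proof -
  have "u \<le> u powr \<alpha>" if "0 < u" "u \<le> 1" for u :: real
    using powr_mono'[of \<alpha> 1 u] assms that by simp
  from this[of "x / (x + y)"] this[of "y / (x + y)"]
  have "x / (x + y) + y / (x + y) \<le> (x / (x + y)) powr \<alpha> + (y / (x + y)) powr \<alpha>"
    using assms by (intro add_mono) auto
  moreover have "x / (x + y) + y / (x + y) = 1"
    using assms by (simp add: add_divide_distrib[symmetric])
  ultimately have "(x + y) powr \<alpha> * 1 \<le> (x + y) powr \<alpha> * ((x / (x + y)) powr \<alpha> + (y / (x + y)) powr \<alpha>)"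
    by (intro mult_left_mono) auto
  also have "\<dots> = x powr \<alpha> + y powr \<alpha>"
    using assms by (simp add: powr_divide distrib_left)
  finally show ?thesis by simp
qed

lemma one_plus_add_powr_le_add:
  assumes "0 \<le> \<alpha>" "\<alpha> \<le> 1"
  shows "(1 + real (k + l)) powr \<alpha> \<le> (1 + real k) powr \<alpha> + (1 + real l) powr \<alpha>"
proof -
  have "(1 + real (k + l)) powr \<alpha> \<le> ((1 + real k) + (1 + real l)) powr \<alpha>"
    using assms by (intro powr_mono2) auto
  also have "\<dots> \<le> (1 + real k) powr \<alpha> + (1 + real l) powr \<alpha>"
    using assms by (intro powr_subadd) auto
  finally show ?thesis .
qed

text \<open>One estimate for all weighted norms of products. A one-element \<open>I\<close>
  expresses submultiplicativity of the weight; an \<open>I\<close> built from booleans records which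
  factor carries the weight of which index.\<close>

lemma summable_on_conv2_weighted:
  fixes a b :: "nat \<times> nat \<Rightarrow> complex" and w :: "nat \<times> nat \<Rightarrow> real"
  assumes "finite I"
    and a: "\<And>i. i \<in> I \<Longrightarrow> (\<lambda>p. norm (a p) * u i p) summable_on UNIV"
    and b: "\<And>i. i \<in> I \<Longrightarrow> (\<lambda>p. norm (b p) * v i p) summable_on UNIV"
    and uv: "\<And>i p. i \<in> I \<Longrightarrow> 0 \<le> u i p" "\<And>i p. i \<in> I \<Longrightarrow> 0 \<le> v i p" and w: "\<And>p. 0 \<le> w p"
    and le: "\<And>k l k' l'. w (k + k', l + l') \<le> (\<Sum>i\<in>I. u i (k, l) * v i (k', l'))"
  shows "(\<lambda>p. norm (conv2 a b p) * w p) summable_on UNIV"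
    and "(\<Sum>\<^sub>\<infinity>p. norm (conv2 a b p) * w p) \<le>
      (\<Sum>i\<in>I. (\<Sum>\<^sub>\<infinity>p. norm (a p) * u i p) * (\<Sum>\<^sub>\<infinity>p. norm (b p) * v i p))"
proof -
  define R where "R = (\<lambda>p. \<Sum>i\<in>I. conv2 (\<lambda>p. norm (a p) * u i p) (\<lambda>p. norm (b p) * v i p) p)"
  have R: "(R has_sum (\<Sum>i\<in>I. (\<Sum>\<^sub>\<infinity>p. norm (a p) * u i p) * (\<Sum>\<^sub>\<infinity>p. norm (b p) * v i p))) UNIV"
    unfolding R_def
    by (intro has_sum_sum has_sum_conv2 has_sum_infsum a b) (use a b uv \<open>finite I\<close> in \<open>auto simp: abs_mult\<close>)
  have le': "norm (conv2 a b p) * w p \<le> R p" for p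
  proof -
    obtain n m where p: "p = (n, m)" by (cases p)
    have "norm (conv2 a b p) * w p \<le> (\<Sum>k\<le>n. \<Sum>l\<le>m. norm (a (k, l)) * norm (b (n - k, m - l))) * w p"
      using w unfolding conv2_def p
      by (intro mult_right_mono) (auto intro!: sum_norm_le order.trans[OF norm_sum] sum_mono simp: norm_mult)
    also have "\<dots> = (\<Sum>k\<le>n. \<Sum>l\<le>m. norm (a (k, l)) * norm (b (n - k, m - l)) * w (k + (n - k), l + (m - l)))"
      by (simp add: sum_distrib_right p)
    also have "\<dots> \<le> (\<Sum>k\<le>n. \<Sum>l\<le>m. norm (a (k, l)) * norm (b (n - k, m - l)) *
        (\<Sum>i\<in>I. u i (k, l) * v i (n - k, m - l)))"
      by (intro sum_mono mult_left_mono le) auto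
    also have "\<dots> = (\<Sum>k\<le>n. \<Sum>l\<le>m. \<Sum>i\<in>I.
        (norm (a (k, l)) * u i (k, l)) * (norm (b (n - k, m - l)) * v i (n - k, m - l)))"
      by (simp add: sum_distrib_left mult_ac)
    also have "\<dots> = (\<Sum>k\<le>n. \<Sum>i\<in>I. \<Sum>l\<le>m.
        (norm (a (k, l)) * u i (k, l)) * (norm (b (n - k, m - l)) * v i (n - k, m - l)))"
      by (intro sum.cong refl sum.swap)
    also have "\<dots> = R p"
      unfolding R_def conv2_def p by (simp, rule sum.swap)
    finally show ?thesis .
  qed
  show s: "(\<lambda>p. norm (conv2 a b p) * w p) summable_on UNIV"
    by (rule summable_on_comparison_test[OF has_sum_imp_summable[OF R]]) (use le' w in auto)
  show "(\<Sum>\<^sub>\<infinity>p. norm (conv2 a b p) * w p) \<le>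
      (\<Sum>i\<in>I. (\<Sum>\<^sub>\<infinity>p. norm (a p) * u i p) * (\<Sum>\<^sub>\<infinity>p. norm (b p) * v i p))"
    by (rule has_sum_mono[OF has_sum_infsum[OF s] R]) (use le' in auto)
qed

lemma wiener_classI:
  assumes "expands2 f a" "(\<lambda>p. norm (a p) * wiener_weight \<alpha> \<beta> p) summable_on UNIV"
  shows "f \<in> wiener_class \<alpha> \<beta>"
  using assms unfolding wiener_class_def by blast

lemma wiener_classD:
  assumes "f \<in> wiener_class \<alpha> \<beta>"
  shows "expands2 f (coeff2 f)" "(\<lambda>p. norm (coeff2 f p) * wiener_weight \<alpha> \<beta> p) summable_on UNIV"
  using assms unfolding wiener_class_def by (auto simp: coeff2_eq)

lemma wiener_class_mono:
  assumes "f \<in> wiener_class \<alpha>' \<beta>'" "\<alpha> \<le> \<alpha>'" "\<beta> \<le> \<beta>'"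
  shows "f \<in> wiener_class \<alpha> \<beta>" "wiener_norm \<alpha> \<beta> f \<le> wiener_norm \<alpha>' \<beta>' f"
proof -
  note f = wiener_classD[OF assms(1)]
  have le: "norm (coeff2 f p) * wiener_weight \<alpha> \<beta> p \<le> norm (coeff2 f p) * wiener_weight \<alpha>' \<beta>' p" for p
    using assms by (intro mult_left_mono wiener_weight_mono) auto
  have s: "(\<lambda>p. norm (coeff2 f p) * wiener_weight \<alpha> \<beta> p) summable_on UNIV"
    by (rule summable_on_comparison_test[OF f(2)]) (use le in auto)
  show "f \<in> wiener_class \<alpha> \<beta>"
    by (rule wiener_classI[OF f(1) s])
  show "wiener_norm \<alpha> \<beta> f \<le> wiener_norm \<alpha>' \<beta>' f"
    unfolding wiener_norm_def by (rule infsum_mono[OF s f(2) le])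
qed

lemma wiener_norm_nonneg [simp]: "0 \<le> wiener_norm \<alpha> \<beta> f"
  unfolding wiener_norm_def by (intro infsum_nonneg) auto

lemma wiener_norm_le:
  assumes "expands2 f a" "\<And>p. norm (a p) * wiener_weight \<alpha> \<beta> p \<le> b p" "(b has_sum B) UNIV"
  shows "f \<in> wiener_class \<alpha> \<beta>" "wiener_norm \<alpha> \<beta> f \<le> B"
proof -
  have s: "(\<lambda>p. norm (a p) * wiener_weight \<alpha> \<beta> p) summable_on UNIV"
    by (rule summable_on_comparison_test[OF has_sum_imp_summable[OF assms(3)]]) (use assms(2) in auto)
  show "f \<in> wiener_class \<alpha> \<beta>"
    by (rule wiener_classI[OF assms(1) s])
  show "wiener_norm \<alpha> \<beta> f \<le> B"
    unfolding wiener_norm_def coeff2_eq[OF assms(1)]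
    by (rule has_sum_mono[OF has_sum_infsum[OF s] assms(3)]) (rule assms(2))
qed

lemma expands2_add:
  assumes "expands2 f a" "expands2 g b"
  shows "expands2 (\<lambda>p. f p + g p) (\<lambda>p. a p + b p)"
  unfolding expands2_def
proof safe
  fix z w :: complex assume "z \<in> ball 0 1" "w \<in> ball 0 1"
  hence "((\<lambda>(n, m). a (n, m) * z ^ n * w ^ m) has_sum f (z, w)) UNIV"
    "((\<lambda>(n, m). b (n, m) * z ^ n * w ^ m) has_sum g (z, w)) UNIV"
    using assms by (auto simp: expands2_def)
  from has_sum_add[OF this]
  show "((\<lambda>(n, m). (a (n, m) + b (n, m)) * z ^ n * w ^ m) has_sum f (z, w) + g (z, w)) UNIV"
    by (simp add: case_prod_unfold distrib_right)
qed

lemma expands2_cmult: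
  assumes "expands2 f a"
  shows "expands2 (\<lambda>p. c * f p) (\<lambda>p. c * a p)"
  unfolding expands2_def
proof safe
  fix z w :: complex assume "z \<in> ball 0 1" "w \<in> ball 0 1"
  hence "((\<lambda>(n, m). a (n, m) * z ^ n * w ^ m) has_sum f (z, w)) UNIV"
    using assms by (auto simp: expands2_def)
  from has_sum_cmult_right[OF this, of c]
  show "((\<lambda>(n, m). c * a (n, m) * z ^ n * w ^ m) has_sum c * f (z, w)) UNIV"
    by (simp add: case_prod_unfold mult.assoc)
qed

lemma expands2_diff:
  assumes "expands2 f a" "expands2 g b"
  shows "expands2 (\<lambda>p. f p - g p) (\<lambda>p. a p - b p)"
  using expands2_add[OF assms(1) expands2_cmult[OF assms(2), of "-1"]] by simp

lemma expands2_cong: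
  assumes "\<And>p. p \<in> open_bidisc \<Longrightarrow> f p = g p"
  shows "expands2 f a \<longleftrightarrow> expands2 g a"
  unfolding expands2_def by (intro ball_cong) (use assms in auto)

lemma coeff2_cong:
  assumes "\<And>p. p \<in> open_bidisc \<Longrightarrow> f p = g p"
  shows "coeff2 f = coeff2 g"
  unfolding coeff2_def using expands2_cong[OF assms] by presburger

lemma wiener_norm_cong:
  assumes "\<And>p. p \<in> open_bidisc \<Longrightarrow> f p = g p"
  shows "wiener_norm \<alpha> \<beta> f = wiener_norm \<alpha> \<beta> g"
  unfolding wiener_norm_def using coeff2_cong[OF assms] by presburger

lemma expands2_mult:
  assumes "expands2 f a" "expands2 g b"
  shows "expands2 (\<lambda>p. f p * g p) (conv2 a b)"
  unfolding expands2_def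
proof safe
  fix z w :: complex assume "z \<in> ball 0 1" "w \<in> ball 0 1"
  hence *: "((\<lambda>(n, m). a (n, m) * z ^ n * w ^ m) has_sum f (z, w)) UNIV"
    "((\<lambda>(n, m). b (n, m) * z ^ n * w ^ m) has_sum g (z, w)) UNIV"
    using assms by (auto simp: expands2_def)
  have "conv2 (\<lambda>(n, m). a (n, m) * z ^ n * w ^ m) (\<lambda>(n, m). b (n, m) * z ^ n * w ^ m) =
      (\<lambda>(n, m). conv2 a b (n, m) * z ^ n * w ^ m)"
  proof (rule ext, clarsimp)
    fix n m
    have eq: "a (k, l) * z ^ k * w ^ l * (b (n - k, m - l) * z ^ (n - k) * w ^ (m - l)) =
        a (k, l) * b (n - k, m - l) * z ^ n * w ^ m" if "k \<le> n" "l \<le> m" for k l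
    proof -
      have "z ^ k * z ^ (n - k) = z ^ n" "w ^ l * w ^ (m - l) = w ^ m"
        using that by (simp_all add: power_add[symmetric])
      moreover have "a (k, l) * z ^ k * w ^ l * (b (n - k, m - l) * z ^ (n - k) * w ^ (m - l)) =
          a (k, l) * b (n - k, m - l) * (z ^ k * z ^ (n - k)) * (w ^ l * w ^ (m - l))"
        by (simp only: mult_ac)
      ultimately show ?thesis by simp
    qed
    show "conv2 (\<lambda>(n, m). a (n, m) * z ^ n * w ^ m) (\<lambda>(n, m). b (n, m) * z ^ n * w ^ m) (n, m) =
        conv2 a b (n, m) * z ^ n * w ^ m"
      unfolding conv2_def prod.case sum_distrib_right by (intro sum.cong refl eq) auto
  qed
  thus "((\<lambda>(n, m). conv2 a b (n, m) * z ^ n * w ^ m) has_sum f (z, w) * g (z, w)) UNIV"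
    using has_sum_conv2[OF *(1) _ *(2)] *[THEN has_sum_imp_summable]
    by (simp add: summable_on_iff_abs_summable_on_complex)
qed

lemma wiener_class_add:
  assumes "f \<in> wiener_class \<alpha> \<beta>" "g \<in> wiener_class \<alpha> \<beta>"
  shows "(\<lambda>p. f p + g p) \<in> wiener_class \<alpha> \<beta>"
    and "wiener_norm \<alpha> \<beta> (\<lambda>p. f p + g p) \<le> wiener_norm \<alpha> \<beta> f + wiener_norm \<alpha> \<beta> g"
proof -
  note f = wiener_classD[OF assms(1)] and g = wiener_classD[OF assms(2)]
  have *: "norm (coeff2 f p + coeff2 g p) * wiener_weight \<alpha> \<beta> p \<le>
      norm (coeff2 f p) * wiener_weight \<alpha> \<beta> p + norm (coeff2 g p) * wiener_weight \<alpha> \<beta> p" for p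
    by (simp add: distrib_right[symmetric] mult_right_mono norm_triangle_ineq)
  note has_sum_add[OF f(2)[THEN has_sum_infsum] g(2)[THEN has_sum_infsum]]
  from wiener_norm_le[OF expands2_add[OF f(1) g(1)] * this]
  show "(\<lambda>p. f p + g p) \<in> wiener_class \<alpha> \<beta>"
    and "wiener_norm \<alpha> \<beta> (\<lambda>p. f p + g p) \<le> wiener_norm \<alpha> \<beta> f + wiener_norm \<alpha> \<beta> g"
    by (auto simp: wiener_norm_def)
qed

lemma wiener_class_cmult:
  assumes "f \<in> wiener_class \<alpha> \<beta>"
  shows "(\<lambda>p. c * f p) \<in> wiener_class \<alpha> \<beta>"
    and "wiener_norm \<alpha> \<beta> (\<lambda>p. c * f p) = norm c * wiener_norm \<alpha> \<beta> f"
proof -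
  note f = wiener_classD[OF assms(1)]
  note e = expands2_cmult[OF f(1), of c]
  show "(\<lambda>p. c * f p) \<in> wiener_class \<alpha> \<beta>"
    by (rule wiener_classI[OF e]) (simp add: norm_mult mult.assoc summable_on_cmult_right f)
  show "wiener_norm \<alpha> \<beta> (\<lambda>p. c * f p) = norm c * wiener_norm \<alpha> \<beta> f"
    by (simp add: wiener_norm_def coeff2_eq[OF e] norm_mult mult.assoc infsum_cmult_right')
qed

lemma wiener_class_uminus:
  assumes "f \<in> wiener_class \<alpha> \<beta>"
  shows "(\<lambda>p. - f p) \<in> wiener_class \<alpha> \<beta>"
    and "wiener_norm \<alpha> \<beta> (\<lambda>p. - f p) = wiener_norm \<alpha> \<beta> f"
  using wiener_class_cmult[OF assms, of "-1"] by simp_all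

lemma wiener_class_diff:
  assumes "f \<in> wiener_class \<alpha> \<beta>" "g \<in> wiener_class \<alpha> \<beta>"
  shows "(\<lambda>p. f p - g p) \<in> wiener_class \<alpha> \<beta>"
    and "wiener_norm \<alpha> \<beta> (\<lambda>p. f p - g p) \<le> wiener_norm \<alpha> \<beta> f + wiener_norm \<alpha> \<beta> g"
  using wiener_class_add[OF assms(1) wiener_class_uminus(1)[OF assms(2)]]
    wiener_class_uminus(2)[OF assms(2)] by simp_all

lemma wiener_class_sum:
  assumes "\<And>i. i \<in> I \<Longrightarrow> f i \<in> wiener_class \<alpha> \<beta>"
  shows "(\<lambda>p. \<Sum>i\<in>I. f i p) \<in> wiener_class \<alpha> \<beta> \<and>
    wiener_norm \<alpha> \<beta> (\<lambda>p. \<Sum>i\<in>I. f i p) \<le> (\<Sum>i\<in>I. wiener_norm \<alpha> \<beta> (f i))"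
  using assms
proof (induction I rule: infinite_finite_induct)
  case (insert i I)
  thus ?case
    using wiener_class_add[of "f i" \<alpha> \<beta> "\<lambda>p. \<Sum>i\<in>I. f i p"] by auto
qed (use wiener_norm_le[of "\<lambda>_. 0" "\<lambda>_. 0" \<alpha> \<beta> "\<lambda>_. 0" 0] in \<open>auto simp: expands2_def case_prod_unfold\<close>)

lemma wiener_class_mult:
  assumes f: "f \<in> wiener_class \<alpha> \<beta>" and g: "g \<in> wiener_class \<alpha> \<beta>" and "0 \<le> \<alpha>" "0 \<le> \<beta>"
  shows "(\<lambda>p. f p * g p) \<in> wiener_class \<alpha> \<beta>"
    and "wiener_norm \<alpha> \<beta> (\<lambda>p. f p * g p) \<le> wiener_norm \<alpha> \<beta> f * wiener_norm \<alpha> \<beta> g"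
proof -
  note f = wiener_classD[OF f] and g = wiener_classD[OF g]
  note e = expands2_mult[OF f(1) g(1)]
  have le: "wiener_weight \<alpha> \<beta> (k + k', l + l') \<le>
      (\<Sum>i\<in>{()}. wiener_weight \<alpha> \<beta> (k, l) * wiener_weight \<alpha> \<beta> (k', l'))" for k l k' l'
  proof -
    have "wiener_weight \<alpha> \<beta> (k + k', l + l') \<le>
      ((1 + real k) powr \<alpha> * (1 + real k') powr \<alpha>) * ((1 + real l) powr \<beta> * (1 + real l') powr \<beta>)"
      unfolding wiener_weight_def using one_plus_add_powr_le[of \<alpha> k k'] one_plus_add_powr_le[of \<beta> l l'] assms
      by (auto intro!: mult_mono)
    thus ?thesis by (simp add: wiener_weight_def mult_ac)
  qed
  note c = summable_on_conv2_weighted[of "{()}" "coeff2 f" "\<lambda>_. wiener_weight \<alpha> \<beta>" "coeff2 g"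
      "\<lambda>_. wiener_weight \<alpha> \<beta>" "wiener_weight \<alpha> \<beta>", OF _ f(2) g(2) _ _ _ le, simplified]
  show "(\<lambda>p. f p * g p) \<in> wiener_class \<alpha> \<beta>"
    by (rule wiener_classI[OF e c(1)])
  show "wiener_norm \<alpha> \<beta> (\<lambda>p. f p * g p) \<le> wiener_norm \<alpha> \<beta> f * wiener_norm \<alpha> \<beta> g"
    unfolding wiener_norm_def coeff2_eq[OF e] by (rule c(2))
qed

text \<open>The pairs \<open>u i\<close> and \<open>v i\<close> are exponents of weights. They stay
  below \<open>\<alpha>\<close> and \<open>\<beta>\<close>, so that all norms on the right are sums
  of convergent series.\<close>

lemma wiener_norm_mult_le_sum:
  assumes f: "f \<in> wiener_class \<alpha> \<beta>" and g: "g \<in> wiener_class \<alpha> \<beta>" and "finite I"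
    and u: "\<And>i. i \<in> I \<Longrightarrow> fst (u i) \<le> \<alpha> \<and> snd (u i) \<le> \<beta>"
    and v: "\<And>i. i \<in> I \<Longrightarrow> fst (v i) \<le> \<alpha> \<and> snd (v i) \<le> \<beta>"
    and le: "\<And>k l k' l'. wiener_weight \<alpha> \<beta> (k + k', l + l') \<le>
      (\<Sum>i\<in>I. case_prod wiener_weight (u i) (k, l) * case_prod wiener_weight (v i) (k', l'))"
  shows "wiener_norm \<alpha> \<beta> (\<lambda>p. f p * g p) \<le>
    (\<Sum>i\<in>I. case_prod wiener_norm (u i) f * case_prod wiener_norm (v i) g)"
proof -
  have *: "(\<lambda>p. norm (coeff2 h p) * case_prod wiener_weight t p) summable_on UNIV"
    if "h \<in> wiener_class \<alpha> \<beta>" "fst t \<le> \<alpha> \<and> snd t \<le> \<beta>" for h t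
    using wiener_classD(2)[OF wiener_class_mono(1)[OF that(1), of "fst t" "snd t"]] that(2)
    by (simp add: case_prod_unfold)
  note e = expands2_mult[OF wiener_classD(1)[OF f] wiener_classD(1)[OF g]]
  have "wiener_norm \<alpha> \<beta> (\<lambda>p. f p * g p) \<le>
      (\<Sum>i\<in>I. (\<Sum>\<^sub>\<infinity>p. norm (coeff2 f p) * case_prod wiener_weight (u i) p) *
        (\<Sum>\<^sub>\<infinity>p. norm (coeff2 g p) * case_prod wiener_weight (v i) p))"
    unfolding wiener_norm_def coeff2_eq[OF e]
    by (rule summable_on_conv2_weighted(2)[OF \<open>finite I\<close> *[OF f u] *[OF g v] _ _ _ le])
      (auto simp: case_prod_unfold)
  thus ?thesis by (simp add: wiener_norm_def case_prod_unfold)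
qed

text \<open>Since the weights are subadditive in each index, only one factor at a time has to carry
  the weight of an index.\<close>

lemma wiener_norm_mult_le:
  assumes f: "f \<in> wiener_class \<alpha> \<beta>" and g: "g \<in> wiener_class \<alpha> \<beta>"
    and ab: "0 \<le> \<alpha>" "\<alpha> \<le> 1" "0 \<le> \<beta>" "\<beta> \<le> 1"
  shows "wiener_norm \<alpha> \<beta> (\<lambda>p. f p * g p) \<le>
    wiener_norm \<alpha> \<beta> f * wiener_norm 0 0 g + wiener_norm \<alpha> 0 f * wiener_norm 0 \<beta> g +
    wiener_norm 0 \<beta> f * wiener_norm \<alpha> 0 g + wiener_norm 0 0 f * wiener_norm \<alpha> \<beta> g"
proof -
  \<comment> \<open>The booleans tell whether the first factor carries the weight of the first and
    of the second index; \<open>v\<close> gives to the second factor the weights that the first one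
    does not carry.\<close>
  define u where "u = (\<lambda>(s::bool, t::bool). (if s then \<alpha> else 0, if t then \<beta> else 0))"
  define v where "v = (\<lambda>(s, t). u (\<not> s, \<not> t))"
  have "wiener_norm \<alpha> \<beta> (\<lambda>p. f p * g p) \<le>
      (\<Sum>i\<in>UNIV. case_prod wiener_norm (u i) f * case_prod wiener_norm (v i) g)"
  proof (rule wiener_norm_mult_le_sum[OF f g])
    fix k l k' l' :: nat
    have "wiener_weight \<alpha> \<beta> (k + k', l + l') \<le>
      ((1 + real k) powr \<alpha> + (1 + real k') powr \<alpha>) * ((1 + real l) powr \<beta> + (1 + real l') powr \<beta>)"
      unfolding wiener_weight_def
      using one_plus_add_powr_le_add[of \<alpha> k k'] one_plus_add_powr_le_add[of \<beta> l l'] ab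
      by (auto intro!: mult_mono add_nonneg_nonneg)
    also have "\<dots> = (\<Sum>i\<in>UNIV. case_prod wiener_weight (u i) (k, l) * case_prod wiener_weight (v i) (k', l'))"
      by (simp add: UNIV_Times_UNIV[symmetric] UNIV_bool sum.cartesian_product[symmetric] u_def v_def
          wiener_weight_def algebra_simps del: UNIV_Times_UNIV)
    finally show "wiener_weight \<alpha> \<beta> (k + k', l + l') \<le>
      (\<Sum>i\<in>UNIV. case_prod wiener_weight (u i) (k, l) * case_prod wiener_weight (v i) (k', l'))" .
  qed (use ab in \<open>auto simp: u_def v_def case_prod_unfold\<close>)
  also have "\<dots> = wiener_norm \<alpha> \<beta> f * wiener_norm 0 0 g + wiener_norm \<alpha> 0 f * wiener_norm 0 \<beta> g +
    wiener_norm 0 \<beta> f * wiener_norm \<alpha> 0 g + wiener_norm 0 0 f * wiener_norm \<alpha> \<beta> g"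
    by (simp add: UNIV_Times_UNIV[symmetric] UNIV_bool sum.cartesian_product[symmetric] u_def v_def
          algebra_simps del: UNIV_Times_UNIV)
  finally show ?thesis .
qed

lemma wiener_norm_mult_le_fst:
  assumes f: "f \<in> wiener_class \<alpha> 0" and g: "g \<in> wiener_class \<alpha> 0" and ab: "0 \<le> \<alpha>" "\<alpha> \<le> 1"
  shows "wiener_norm \<alpha> 0 (\<lambda>p. f p * g p) \<le>
    wiener_norm \<alpha> 0 f * wiener_norm 0 0 g + wiener_norm 0 0 f * wiener_norm \<alpha> 0 g"
proof -
  define u where "u = (\<lambda>s::bool. (if s then \<alpha> else 0, 0::real))"
  have "wiener_norm \<alpha> 0 (\<lambda>p. f p * g p) \<le>
      (\<Sum>i\<in>UNIV. case_prod wiener_norm (u i) f * case_prod wiener_norm (u (\<not> i)) g)"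
    by (rule wiener_norm_mult_le_sum[OF f g])
      (use ab one_plus_add_powr_le_add[of \<alpha>] in \<open>auto simp: u_def UNIV_bool wiener_weight_def add.commute\<close>)
  thus ?thesis by (simp add: u_def UNIV_bool add.commute)
qed

lemma wiener_norm_mult_le_snd:
  assumes f: "f \<in> wiener_class 0 \<beta>" and g: "g \<in> wiener_class 0 \<beta>" and ab: "0 \<le> \<beta>" "\<beta> \<le> 1"
  shows "wiener_norm 0 \<beta> (\<lambda>p. f p * g p) \<le>
    wiener_norm 0 \<beta> f * wiener_norm 0 0 g + wiener_norm 0 0 f * wiener_norm 0 \<beta> g"
proof -
  define u where "u = (\<lambda>s::bool. (0::real, if s then \<beta> else 0))"
  have "wiener_norm 0 \<beta> (\<lambda>p. f p * g p) \<le>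
      (\<Sum>i\<in>UNIV. case_prod wiener_norm (u i) f * case_prod wiener_norm (u (\<not> i)) g)"
    by (rule wiener_norm_mult_le_sum[OF f g])
      (use ab one_plus_add_powr_le_add[of \<beta>] in \<open>auto simp: u_def UNIV_bool wiener_weight_def add.commute\<close>)
  thus ?thesis by (simp add: u_def UNIV_bool add.commute)
qed

lemma wiener_algebra_eq: "wiener_algebra \<alpha> \<beta> = bidisc_algebra \<inter> wiener_class \<alpha> \<beta>"
  by (auto simp: wiener_algebra_def wiener_class_def)

section \<open>Functions built from coefficients: series, polynomials, tensor products\<close>

lemma norm_monomial_le:
  fixes z w :: complex
  assumes "norm z \<le> 1" "norm w \<le> 1"
  shows "norm (c * z ^ n * w ^ m) \<le> norm c"
proof -
  have "norm z ^ n * norm w ^ m \<le> 1"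
    using assms by (intro mult_le_one power_le_one) auto
  hence "norm c * (norm z ^ n * norm w ^ m) \<le> norm c * 1"
    by (rule mult_left_mono) simp
  thus ?thesis by (simp add: norm_mult norm_power mult.assoc)
qed

lemma expands2_summable:
  assumes "(\<lambda>p. norm (a p)) summable_on UNIV"
  shows "expands2 (\<lambda>(z, w). \<Sum>\<^sub>\<infinity>(n, m). a (n, m) * z ^ n * w ^ m) a"
  unfolding expands2_def
proof safe
  fix z w :: complex assume zw: "z \<in> ball 0 1" "w \<in> ball 0 1"
  have "norm (case p of (n, m) \<Rightarrow> a (n, m) * z ^ n * w ^ m) \<le> norm (a p)" for p
    using zw by (cases p) (simp add: norm_monomial_le)
  hence "(\<lambda>p. norm (case p of (n, m) \<Rightarrow> a (n, m) * z ^ n * w ^ m)) summable_on UNIV"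
    by (intro summable_on_comparison_test[OF assms]) auto
  thus "((\<lambda>(n, m). a (n, m) * z ^ n * w ^ m) has_sum
      (\<Sum>\<^sub>\<infinity>(n, m). a (n, m) * z ^ n * w ^ m)) UNIV"
    by (rule has_sum_infsum[OF abs_summable_summable])
qed

lemma expands2_finite:
  assumes "finite A" "\<And>p. p \<notin> A \<Longrightarrow> a p = 0"
  shows "expands2 (\<lambda>(z, w). \<Sum>(n, m)\<in>A. a (n, m) * z ^ n * w ^ m) a"
  unfolding expands2_def
proof safe
  fix z w :: complex
  show "((\<lambda>(n, m). a (n, m) * z ^ n * w ^ m) has_sum (\<Sum>(n, m)\<in>A. a (n, m) * z ^ n * w ^ m)) UNIV"
    by (rule has_sum_finite_neutralI[OF assms(1)]) (auto simp: assms(2))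
qed

lemma finite_imp_wiener_class:
  assumes "expands2 f a" "finite A" "\<And>p. p \<notin> A \<Longrightarrow> a p = 0"
  shows "f \<in> wiener_class \<alpha> \<beta>" "wiener_norm \<alpha> \<beta> f = (\<Sum>p\<in>A. norm (a p) * wiener_weight \<alpha> \<beta> p)"
proof -
  have *: "((\<lambda>p. norm (a p) * wiener_weight \<alpha> \<beta> p) has_sum
      (\<Sum>p\<in>A. norm (a p) * wiener_weight \<alpha> \<beta> p)) UNIV"
    by (rule has_sum_finite_neutralI[OF assms(2)]) (auto simp: assms(3))
  show "f \<in> wiener_class \<alpha> \<beta>"
    by (rule wiener_classI[OF assms(1) has_sum_imp_summable[OF *]])
  show "wiener_norm \<alpha> \<beta> f = (\<Sum>p\<in>A. norm (a p) * wiener_weight \<alpha> \<beta> p)"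
    unfolding wiener_norm_def coeff2_eq[OF assms(1)] by (rule infsumI[OF *])
qed

lemma expands2_monomial:
  "expands2 (\<lambda>p. c * fst p ^ n * snd p ^ m) (\<lambda>p. if p = (n, m) then c else 0)"
proof -
  have "expands2 (\<lambda>(z, w). \<Sum>(k, l)\<in>{(n, m)}. (if (k, l) = (n, m) then c else 0) * z ^ k * w ^ l)
      (\<lambda>p. if p = (n, m) then c else 0)"
    using expands2_finite[of "{(n, m)}" "\<lambda>p. if p = (n, m) then c else 0"] by simp
  thus ?thesis by (simp add: case_prod_unfold)
qed

lemma wiener_class_monomial [simp]: "(\<lambda>p. c * fst p ^ n * snd p ^ m) \<in> wiener_class \<alpha> \<beta>"
  by (rule finite_imp_wiener_class[OF expands2_monomial, of "{(n, m)}"]) auto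

lemma wiener_norm_monomial:
  "wiener_norm \<alpha> \<beta> (\<lambda>p. c * fst p ^ n * snd p ^ m) = norm c * wiener_weight \<alpha> \<beta> (n, m)"
  using finite_imp_wiener_class(2)[OF expands2_monomial, of "{(n, m)}" n m c \<alpha> \<beta>] by simp

lemma wiener_class_const [simp]: "(\<lambda>_. c) \<in> wiener_class \<alpha> \<beta>"
  using wiener_class_monomial[of c 0 0] by simp

lemma wiener_class_fst [simp]: "fst \<in> wiener_class \<alpha> \<beta>"
  using wiener_class_monomial[of 1 1 0] by simp

lemma wiener_class_snd [simp]: "snd \<in> wiener_class \<alpha> \<beta>"
  using wiener_class_monomial[of 1 0 1] by simp

lemma wiener_class_power:
  assumes "f \<in> wiener_class \<alpha> \<beta>" "0 \<le> \<alpha>" "0 \<le> \<beta>"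
  shows "(\<lambda>p. f p ^ n) \<in> wiener_class \<alpha> \<beta>"
  using wiener_class_mult(1)[OF assms(1) _ assms(2,3)] by (induction n) auto

lemma expands2_tensor:
  assumes "\<And>z. z \<in> ball 0 1 \<Longrightarrow> ((\<lambda>n. u n * z ^ n) has_sum U z) UNIV"
    and "\<And>z. z \<in> ball 0 1 \<Longrightarrow> ((\<lambda>n. v n * z ^ n) has_sum V z) UNIV"
  shows "expands2 (\<lambda>(z, w). U z * V w) (\<lambda>(n, m). u n * v m)"
  unfolding expands2_def
proof safe
  fix z w :: complex assume zw: "z \<in> ball 0 1" "w \<in> ball 0 1"
  note u = assms(1)[OF zw(1)] and v = assms(2)[OF zw(2)]
  have au: "(\<lambda>n. norm (u n * z ^ n)) summable_on UNIV" and av: "(\<lambda>n. norm (v n * w ^ n)) summable_on UNIV"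
    by (rule summable_on_iff_abs_summable_on_complex[THEN iffD1, OF has_sum_imp_summable[OF u]],
        rule summable_on_iff_abs_summable_on_complex[THEN iffD1, OF has_sum_imp_summable[OF v]])
  define F where "F = (\<lambda>(n, m). u n * z ^ n * (v m * w ^ m))"
  have "(\<lambda>p. norm (F p)) summable_on (UNIV \<times> UNIV)"
    unfolding Infinite_Sum.abs_summable_on_Sigma_iff F_def
  proof (intro conjI ballI)
    show "(\<lambda>m. norm (case (n, m) of (n, m) \<Rightarrow> u n * z ^ n * (v m * w ^ m))) summable_on UNIV" for n
      using summable_on_cmult_right[OF av, of "norm (u n * z ^ n)"] by (simp add: norm_mult)
    show "(\<lambda>n. norm (\<Sum>\<^sub>\<infinity>m. norm (case (n, m) of (n, m) \<Rightarrow> u n * z ^ n * (v m * w ^ m)))) summable_on UNIV"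
      using summable_on_cmult_left[OF au, of "norm (\<Sum>\<^sub>\<infinity>m. norm (v m * w ^ m))"]
      by (simp add: norm_mult[of "u _ * z ^ _"] infsum_cmult_right' abs_mult)
  qed
  hence "F summable_on (UNIV \<times> UNIV)"
    by (rule abs_summable_summable)
  hence "(F has_sum U z * V w) (UNIV \<times> UNIV)"
    unfolding F_def by (intro has_sum_SigmaI[where g = "\<lambda>n. u n * z ^ n * V w"])
      (auto intro!: has_sum_cmult_right has_sum_cmult_left u v)
  thus "((\<lambda>(n, m). u n * v m * z ^ n * w ^ m) has_sum U z * V w) UNIV"
    by (simp add: F_def mult_ac case_prod_unfold)
qed

section \<open>Truncations and the size of the remainder\<close>

definition truncation :: "nat \<Rightarrow> (complex \<times> complex \<Rightarrow> complex) \<Rightarrow> complex \<times> complex \<Rightarrow> complex"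
  where "truncation N f = (\<lambda>(z, w). \<Sum>(n, m)\<in>{..<N} \<times> {..<N}. coeff2 f (n, m) * z ^ n * w ^ m)"

lemma expands2_truncation:
  "expands2 (truncation N f) (\<lambda>p. if p \<in> {..<N} \<times> {..<N} then coeff2 f p else 0)"
proof -
  have *: "truncation N f = (\<lambda>(z, w). \<Sum>(n, m)\<in>{..<N} \<times> {..<N}.
      (if (n, m) \<in> {..<N} \<times> {..<N} then coeff2 f (n, m) else 0) * z ^ n * w ^ m)"
    unfolding truncation_def by (auto simp: fun_eq_iff intro!: sum.cong)
  show ?thesis
    unfolding * by (rule expands2_finite) auto
qed

lemma wiener_class_truncation [simp]: "truncation N f \<in> wiener_class \<alpha> \<beta>"
  by (rule finite_imp_wiener_class[OF expands2_truncation, of "{..<N} \<times> {..<N}"]) auto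

lemma expands2_tail:
  assumes "f \<in> wiener_class \<alpha> \<beta>"
  shows "expands2 (\<lambda>p. f p - truncation N f p) (\<lambda>p. if p \<in> {..<N} \<times> {..<N} then 0 else coeff2 f p)"
proof -
  have "(\<lambda>p. if p \<in> {..<N} \<times> {..<N} then 0 else coeff2 f p) =
      (\<lambda>p. coeff2 f p - (if p \<in> {..<N} \<times> {..<N} then coeff2 f p else 0))"
    by auto
  thus ?thesis
    using expands2_diff[OF wiener_classD(1)[OF assms] expands2_truncation, of N] by simp
qed

lemma truncation_tendsto:
  assumes f: "f \<in> wiener_class \<alpha> \<beta>" and "\<epsilon> > 0"
  shows "\<exists>N0. \<forall>N\<ge>N0. wiener_norm \<alpha> \<beta> (\<lambda>p. f p - truncation N f p) < \<epsilon>"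
proof -
  define h where "h = (\<lambda>p. norm (coeff2 f p) * wiener_weight \<alpha> \<beta> p)"
  have s: "h summable_on UNIV"
    unfolding h_def by (rule wiener_classD(2)[OF f])
  obtain X where X: "finite X" "dist (sum h X) (infsum h UNIV) \<le> \<epsilon> / 2"
    using infsum_finite_approximation[OF s, of "\<epsilon> / 2"] \<open>\<epsilon> > 0\<close> by auto
  obtain N0 where N0: "\<And>p. p \<in> X \<Longrightarrow> fst p < N0 \<and> snd p < N0"
  proof (rule that)
    fix p assume "p \<in> X"
    hence "fst p \<le> Max (fst ` X)" "snd p \<le> Max (snd ` X)"
      using X(1) by auto
    thus "fst p < Suc (max (Max (fst ` X)) (Max (snd ` X))) \<and> snd p < Suc (max (Max (fst ` X)) (Max (snd ` X)))"
      by linarith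
  qed
  have "wiener_norm \<alpha> \<beta> (\<lambda>p. f p - truncation N f p) < \<epsilon>" if "N \<ge> N0" for N
  proof -
    let ?B = "{..<N} \<times> {..<N}"
    have "X \<subseteq> ?B" using N0 that by fastforce
    hence "sum h X \<le> sum h ?B"
      by (intro sum_mono2) (auto simp: h_def)
    moreover have "wiener_norm \<alpha> \<beta> (\<lambda>p. f p - truncation N f p) = infsum (\<lambda>p. if p \<in> ?B then 0 else h p) UNIV"
      unfolding wiener_norm_def coeff2_eq[OF expands2_tail[OF f]] h_def by (rule infsum_cong) auto
    moreover have "\<dots> = infsum h (UNIV - ?B)"
      by (rule infsum_cong_neutral) auto
    moreover have "\<dots> = infsum h UNIV - sum h ?B"
      using infsum_Diff[of h UNIV ?B] s by (simp add: summable_on_finite)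
    ultimately show ?thesis using X(2) \<open>\<epsilon> > 0\<close> unfolding dist_real_def by linarith
  qed
  thus ?thesis by blast
qed

text \<open>An index outside the square has a component that is at least \<open>N\<close>, so its
  weight is at least \<open>N powr \<gamma>\<close>. Passing to the unweighted norm gains this
  factor, and this gain is the smallness that drives the approximate division.\<close>

lemma wiener_norm_tail_le:
  assumes f: "f \<in> wiener_class \<alpha> \<beta>" and "0 \<le> \<gamma>" "\<gamma> \<le> \<alpha>" "\<gamma> \<le> \<beta>" "N > 0"
  shows "wiener_norm 0 0 (\<lambda>p. f p - truncation N f p) \<le> real N powr (-\<gamma>) * wiener_norm \<alpha> \<beta> f"
proof (rule wiener_norm_le(2)[OF expands2_tail[OF f]])
  show "((\<lambda>p. real N powr (-\<gamma>) * (norm (coeff2 f p) * wiener_weight \<alpha> \<beta> p)) has_sum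
      real N powr (-\<gamma>) * wiener_norm \<alpha> \<beta> f) UNIV"
    unfolding wiener_norm_def by (intro has_sum_cmult_right has_sum_infsum wiener_classD(2)[OF f])
  fix p :: "nat \<times> nat"
  obtain n m where p: "p = (n, m)" by (cases p)
  have *: "real N powr \<gamma> \<le> wiener_weight \<alpha> \<beta> p" if out: "\<not> (n < N \<and> m < N)"
  proof -
    have ge: "real N powr \<gamma> \<le> (1 + real k) powr \<delta>" if "k \<ge> N" "\<gamma> \<le> \<delta>" for k \<delta>
    proof -
      have "real N powr \<gamma> \<le> (1 + real k) powr \<gamma>"
        using that assms by (intro powr_mono2) auto
      also have "\<dots> \<le> (1 + real k) powr \<delta>"
        using that by (intro powr_mono) auto
      finally show ?thesis .
    qed
    have ge1: "1 \<le> (1 + real k) powr \<delta>" if "0 \<le> \<delta>" for k \<delta>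
      using that by (intro ge_one_powr_ge_zero) auto
    consider "n \<ge> N" | "m \<ge> N" using out by (auto simp: not_less)
    thus ?thesis
    proof cases
      case 1
      hence "real N powr \<gamma> * 1 \<le> (1 + real n) powr \<alpha> * (1 + real m) powr \<beta>"
        using assms by (intro mult_mono ge ge1) auto
      thus ?thesis by (simp add: wiener_weight_def p)
    next
      case 2
      hence "1 * real N powr \<gamma> \<le> (1 + real n) powr \<alpha> * (1 + real m) powr \<beta>"
        using assms by (intro mult_mono ge ge1) auto
      thus ?thesis by (simp add: wiener_weight_def p)
    qed
  qed
  have "1 \<le> real N powr (-\<gamma>) * wiener_weight \<alpha> \<beta> p" if "\<not> (n < N \<and> m < N)"
  proof -
    have "real N powr (-\<gamma>) * real N powr \<gamma> \<le> real N powr (-\<gamma>) * wiener_weight \<alpha> \<beta> p"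
      using * that by (intro mult_left_mono) auto
    thus ?thesis using \<open>N > 0\<close> by (simp add: powr_add[symmetric])
  qed
  hence "norm (coeff2 f p) * 1 \<le> norm (coeff2 f p) * (real N powr (-\<gamma>) * wiener_weight \<alpha> \<beta> p)"
    if "\<not> (n < N \<and> m < N)"
    using that by (intro mult_left_mono) auto
  thus "norm (if p \<in> {..<N} \<times> {..<N} then 0 else coeff2 f p) * wiener_weight 0 0 p
    \<le> real N powr (-\<gamma>) * (norm (coeff2 f p) * wiener_weight \<alpha> \<beta> p)"
    by (cases "n < N \<and> m < N") (simp_all add: p mult.left_commute)
qed

lemma norm_le_wiener_norm:
  assumes f: "f \<in> wiener_class \<alpha> \<beta>" and "p \<in> open_bidisc" "0 \<le> \<alpha>" "0 \<le> \<beta>"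
  shows "norm (f p) \<le> wiener_norm \<alpha> \<beta> f"
proof -
  obtain z w where p: "p = (z, w)" by (cases p)
  have "((\<lambda>(n, m). coeff2 f (n, m) * z ^ n * w ^ m) has_sum f (z, w)) UNIV"
    using wiener_classD(1)[OF f] assms p by (auto simp: expands2_def)
  thus ?thesis unfolding p wiener_norm_def
  proof (rule norm_infsum_le[OF _ has_sum_infsum[OF wiener_classD(2)[OF f]]])
    fix q :: "nat \<times> nat"
    have "norm (case q of (n, m) \<Rightarrow> coeff2 f (n, m) * z ^ n * w ^ m) \<le> norm (coeff2 f q) * 1"
      using assms p by (cases q) (simp add: norm_monomial_le)
    also have "\<dots> \<le> norm (coeff2 f q) * wiener_weight \<alpha> \<beta> q"
      using assms by (intro mult_left_mono wiener_weight_ge_1) auto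
    finally show "norm (case q of (n, m) \<Rightarrow> coeff2 f (n, m) * z ^ n * w ^ m) \<le>
        norm (coeff2 f q) * wiener_weight \<alpha> \<beta> q" .
  qed
qed

text \<open>Membership in \<open>wiener_class\<close> says nothing about boundary values; continuity
  carries the bound from the dense open bidisc to its closure.\<close>

lemma norm_le_wiener_norm_closed:
  assumes f: "f \<in> wiener_class \<alpha> \<beta>" and "continuous_on closed_bidisc f"
    and "p \<in> closed_bidisc" "0 \<le> \<alpha>" "0 \<le> \<beta>"
  shows "norm (f p) \<le> wiener_norm \<alpha> \<beta> f"
proof -
  have "closure open_bidisc = (closed_bidisc :: (complex \<times> complex) set)"
    by (simp add: closure_Times)
  thus ?thesis
    using continuous_on_closure_norm_le[of open_bidisc f "wiener_norm \<alpha> \<beta> f" p]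
      norm_le_wiener_norm[OF f] assms by auto
qed

section \<open>Polynomials as jointly holomorphic functions\<close>

lemma holomorphic2_on_const: "holomorphic2_on (\<lambda>_. c) S"
  unfolding holomorphic2_on_def
  by (auto intro!: exI[of _ 0] simp: case_prod_unfold)

lemma holomorphic2_on_fst: "holomorphic2_on fst S"
  unfolding holomorphic2_on_def
proof
  show "\<exists>A B. (fst has_derivative (\<lambda>(h, k). A * h + B * k)) (at p)" for p :: "complex \<times> complex"
    by (rule exI[of _ 1], rule exI[of _ 0])
      (auto simp: case_prod_unfold intro!: derivative_eq_intros)
qed

lemma holomorphic2_on_snd: "holomorphic2_on snd S"
  unfolding holomorphic2_on_def
proof
  show "\<exists>A B. (snd has_derivative (\<lambda>(h, k). A * h + B * k)) (at p)" for p :: "complex \<times> complex"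
    by (rule exI[of _ 0], rule exI[of _ 1])
      (auto simp: case_prod_unfold intro!: derivative_eq_intros)
qed

lemma holomorphic2_on_add:
  assumes "holomorphic2_on f S" "holomorphic2_on g S"
  shows "holomorphic2_on (\<lambda>p. f p + g p) S"
  unfolding holomorphic2_on_def
proof
  fix p assume "p \<in> S"
  then obtain A B A' B' where
    "(f has_derivative (\<lambda>(h, k). A * h + B * k)) (at p)"
    "(g has_derivative (\<lambda>(h, k). A' * h + B' * k)) (at p)"
    using assms unfolding holomorphic2_on_def by blast
  from has_derivative_add[OF this]
  have "((\<lambda>p. f p + g p) has_derivative (\<lambda>(h, k). (A + A') * h + (B + B') * k)) (at p)"
    by (simp add: case_prod_unfold algebra_simps)
  thus "\<exists>A B. ((\<lambda>p. f p + g p) has_derivative (\<lambda>(h, k). A * h + B * k)) (at p)" by blast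
qed

lemma holomorphic2_on_mult:
  assumes "holomorphic2_on f S" "holomorphic2_on g S"
  shows "holomorphic2_on (\<lambda>p. f p * g p) S"
  unfolding holomorphic2_on_def
proof
  fix p assume "p \<in> S"
  then obtain A B A' B' where
    "(f has_derivative (\<lambda>(h, k). A * h + B * k)) (at p)"
    "(g has_derivative (\<lambda>(h, k). A' * h + B' * k)) (at p)"
    using assms unfolding holomorphic2_on_def by blast
  from has_derivative_mult[OF this]
  have "((\<lambda>p. f p * g p) has_derivative
      (\<lambda>(h, k). (f p * A' + g p * A) * h + (f p * B' + g p * B) * k)) (at p)"
    by (simp add: case_prod_unfold algebra_simps)
  thus "\<exists>A B. ((\<lambda>p. f p * g p) has_derivative (\<lambda>(h, k). A * h + B * k)) (at p)" by blast
qed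

lemma holomorphic2_on_power: "holomorphic2_on f S \<Longrightarrow> holomorphic2_on (\<lambda>p. f p ^ n) S"
  by (induction n) (auto intro: holomorphic2_on_const holomorphic2_on_mult)

lemma holomorphic2_on_sum:
  "(\<And>i. i \<in> I \<Longrightarrow> holomorphic2_on (f i) S) \<Longrightarrow> holomorphic2_on (\<lambda>p. \<Sum>i\<in>I. f i p) S"
  by (induction I rule: infinite_finite_induct) (auto intro: holomorphic2_on_const holomorphic2_on_add)

lemma truncation_in_bidisc_algebra: "truncation N f \<in> bidisc_algebra"
  unfolding bidisc_algebra_def truncation_def case_prod_unfold mem_Collect_eq
  by (intro conjI continuous_intros holomorphic2_on_sum holomorphic2_on_mult holomorphic2_on_power
      holomorphic2_on_const holomorphic2_on_fst holomorphic2_on_snd)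

section \<open>Cauchy integrals over a circle with a gap at 1\<close>

text \<open>Here \<open>s\<close> is the scale of the gap at 1 and \<open>\<delta>\<close> the
  distance by which the contour leaves the unit disc. As \<open>\<delta> \<le> s / 8\<close>, every
  point of modulus at most \<open>1 + 2 * \<delta>\<close> stays to the left of
  \<open>1 + s\<close>, the pole in the exponent of the damping factor.\<close>

locale keyhole =
  fixes s \<delta> :: real
  assumes s_pos: "0 < s" and s_le: "s \<le> 1/4" and delta_pos: "0 < \<delta>" and delta_le: "\<delta> \<le> s / 8"
begin

definition R :: real where "R = 1 + \<delta>"

text \<open>A disc slightly larger than the unit disc, with a right-angled wedge removed whose apex
  is \<open>1 - s / 2\<close> and which opens to the right. What remains is starlike about 0,
  contains the long arc \<open>far\<close> and the detour \<open>bump\<close>, and keeps a distance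
  of at least \<open>s / 4\<close> from 1.\<close>

definition domain :: "complex set"
  where "domain = {z. norm z < 1 + 2 * \<delta> \<and> Re z < 1 - s / 2 + \<bar>Im z\<bar>}"

definition corner :: complex where "corner = R * cis (arcsin s)"

definition far :: "real \<Rightarrow> complex"
  where "far = part_circlepath 0 R (arcsin s) (2 * pi - arcsin s)"

text \<open>The detour that joins the two ends of the arc and passes 1 on its left, through the real
  point \<open>1 - s\<close>.\<close>

definition bump :: "real \<Rightarrow> complex"
  where "bump = linepath (cnj corner) (of_real (1 - s)) +++ linepath (of_real (1 - s)) corner"

text \<open>Large enough to contain both the detour and the omitted arc, small enough for the
  damping factor to be exponentially small on it.\<close>

definition near_set :: "complex set"
  where "near_set = {z. norm z \<le> R \<and> norm (1 - z) \<le> 4 * s}"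

lemma R_bounds: "1 < R" "R < 33/32 + 1/1000" "0 < R"
  using s_pos s_le delta_pos delta_le by (auto simp: R_def)

lemma sqrt_ge: "1 - s \<le> sqrt (1 - s\<^sup>2)" "sqrt (1 - s\<^sup>2) \<le> 1"
proof -
  have "(1 - s)\<^sup>2 \<le> 1 - s\<^sup>2"
    using s_pos s_le by (simp add: power2_eq_square algebra_simps)
  thus "1 - s \<le> sqrt (1 - s\<^sup>2)" by (rule real_le_rsqrt)
  show "sqrt (1 - s\<^sup>2) \<le> 1" by simp
qed

lemma arcsin_s: "0 < arcsin s" "arcsin s \<le> pi / 2" "sin (arcsin s) = s" "cos (arcsin s) = sqrt (1 - s\<^sup>2)"
proof -
  show "sin (arcsin s) = s" "cos (arcsin s) = sqrt (1 - s\<^sup>2)"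
    using s_pos s_le by (auto simp: cos_arcsin)
  show "0 < arcsin s"
    using s_pos s_le arcsin_less_arcsin[of 0 s] by simp
  show "arcsin s \<le> pi / 2"
    using s_pos s_le by (intro arcsin_ubound) auto
qed

lemma corner_Re_Im: "Re corner = R * sqrt (1 - s\<^sup>2)" "Im corner = R * s"
  by (auto simp: corner_def arcsin_s)

lemma open_domain: "open domain"
  unfolding domain_def by (intro open_Collect_conj open_Collect_less continuous_intros)

lemma scale_in_domain:
  assumes "z \<in> domain" "0 \<le> u" "u \<le> 1"
  shows "of_real u * z \<in> domain"
proof -
  have z: "norm z < 1 + 2 * \<delta>" "Re z < 1 - s / 2 + \<bar>Im z\<bar>"
    using assms by (auto simp: domain_def)
  have "norm (of_real u * z) \<le> 1 * norm z"
    unfolding norm_mult using assms by (intro mult_right_mono) auto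
  moreover have "u * Re z < 1 - s / 2 + u * \<bar>Im z\<bar>"
  proof (cases "u = 0")
    case False
    have "u * Re z < u * (1 - s / 2 + \<bar>Im z\<bar>)"
      using False assms z by (intro mult_strict_left_mono) auto
    moreover have "u * (1 - s / 2) \<le> 1 * (1 - s / 2)"
      using assms s_le by (intro mult_right_mono) auto
    ultimately show ?thesis by (simp add: algebra_simps)
  qed (use s_le in simp)
  ultimately show ?thesis
    using z(1) assms by (simp add: domain_def abs_mult)
qed

lemma starlike_domain: "starlike domain"
  unfolding starlike_def
proof (intro bexI ballI subsetI)
  fix z x assume "z \<in> domain" "x \<in> closed_segment 0 z"
  thus "x \<in> domain"
    using scale_in_domain[of z] by (auto simp: in_segment scaleR_conv_of_real)
next
  show "0 \<in> domain"
    using s_le delta_pos by (auto simp: domain_def)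
qed

lemma domain_norm_le: "z \<in> domain \<Longrightarrow> s / 4 \<le> norm (1 - z)"
proof -
  assume "z \<in> domain"
  hence "s / 2 < (1 - Re z) + \<bar>Im z\<bar>"
    by (auto simp: domain_def)
  also have "1 - Re z \<le> norm (1 - z)"
    using complex_Re_le_cmod[of "1 - z"] by simp
  also have "\<bar>Im z\<bar> \<le> norm (1 - z)"
    using abs_Im_le_cmod[of "1 - z"] by simp
  finally show ?thesis by simp
qed

text \<open>In the right half-plane the excess of \<open>Re z\<close> over \<open>1 - s / 2\<close>
  is at most \<open>\<delta> + s / 2\<close>, which is less than the height \<open>R * s\<close>; so
  the point misses the wedge.\<close>

lemma sphere_in_domain:
  assumes "norm z = R" "Re z \<le> 0 \<or> R * s \<le> \<bar>Im z\<bar>"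
  shows "z \<in> domain"
proof -
  have "norm z < 1 + 2 * \<delta>" using assms delta_pos by (simp add: R_def)
  moreover have "Re z < 1 - s / 2 + \<bar>Im z\<bar>"
  proof (cases "Re z \<le> 0")
    case True
    moreover have "0 < 1 - s / 2" using s_le by simp
    ultimately show ?thesis using abs_ge_zero[of "Im z"] by linarith
  next
    case False
    hence "s * 1 \<le> s * R" "s * R \<le> \<bar>Im z\<bar>"
      using assms R_bounds s_pos by (simp_all add: mult.commute)
    moreover have "Re z \<le> 1 + \<delta>"
      using complex_Re_le_cmod[of z] assms by (simp add: R_def)
    ultimately show ?thesis using delta_le s_pos by linarith
  qed
  ultimately show ?thesis by (simp add: domain_def)
qed

lemma far_image:
  assumes "z \<in> path_image far"
  shows "norm z = R" "z \<in> domain"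
proof -
  have le: "arcsin s \<le> 2 * pi - arcsin s"
    using arcsin_s pi_gt3 by linarith
  then obtain t where t: "arcsin s \<le> t" "t \<le> 2 * pi - arcsin s" "z = R * cis t"
    using assms by (auto simp: far_def path_image_part_circlepath' closed_segment_eq_real_ivl)
  show n: "norm z = R" using t R_bounds by (simp add: norm_mult)
  have "cos t \<le> 0 \<or> s \<le> \<bar>sin t\<bar>"
  proof -
    consider "t \<le> pi / 2" | "pi / 2 \<le> t" "t \<le> 3 * pi / 2" | "3 * pi / 2 \<le> t" by linarith
    thus ?thesis
    proof cases
      case 1
      hence "sin (arcsin s) \<le> sin t"
        using t arcsin_s by (intro sin_monotone_2pi_le) (auto)
      thus ?thesis using abs_ge_self[of "sin t"] unfolding arcsin_s by linarith
    next
      case 2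
      have "cos t = - sin (t - pi / 2)" by (simp add: sin_diff)
      moreover have "0 \<le> sin (t - pi / 2)" using 2 by (intro sin_ge_zero) auto
      ultimately show ?thesis by simp
    next
      case 3
      hence "sin (arcsin s) \<le> sin (2 * pi - t)"
        using t arcsin_s by (intro sin_monotone_2pi_le) (auto)
      hence "s \<le> - sin t" unfolding arcsin_s by (simp add: sin_diff)
      thus ?thesis using abs_ge_minus_self[of "sin t"] by linarith
    qed
  qed
  hence "Re z \<le> 0 \<or> R * s \<le> \<bar>Im z\<bar>"
    using t R_bounds s_pos by (auto simp: mult_le_0_iff abs_mult)
  thus "z \<in> domain" by (rule sphere_in_domain[OF n])
qed

lemma corner_near: "corner \<in> near_set" "cnj corner \<in> near_set"
proof -
  have "R * s \<le> 2 * s" using R_bounds s_pos by (intro mult_right_mono) auto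
  hence "\<bar>Im (1 - corner)\<bar> \<le> 2 * s"
    using R_bounds s_pos by (simp add: corner_Re_Im)
  moreover have "\<bar>Re (1 - corner)\<bar> \<le> 2 * s"
  proof -
    have "1 * (1 - s) \<le> R * sqrt (1 - s\<^sup>2)"
      using R_bounds s_le sqrt_ge by (intro mult_mono) auto
    moreover have "R * sqrt (1 - s\<^sup>2) \<le> R * 1"
      using R_bounds sqrt_ge by (intro mult_left_mono) auto
    ultimately show ?thesis using s_pos delta_le by (simp add: corner_Re_Im R_def)
  qed
  ultimately have "norm (1 - corner) \<le> 4 * s"
    using cmod_le[of "1 - corner"] by linarith
  moreover have "norm corner = R" using R_bounds by (simp add: corner_def norm_mult)
  ultimately show "corner \<in> near_set" by (simp add: near_set_def)
  moreover have "norm (1 - cnj corner) = norm (cnj (1 - corner))" by simp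
  ultimately show "cnj corner \<in> near_set" unfolding complex_mod_cnj by (simp add: near_set_def)
qed

lemma near_set_eq: "near_set = cball 0 R \<inter> cball 1 (4 * s)"
  by (auto simp: near_set_def dist_norm)

lemma segment_in:
  assumes "c = corner \<or> c = cnj corner" "z \<in> closed_segment (of_real (1 - s)) c"
  shows "z \<in> near_set" "z \<in> domain"
proof -
  have "norm (of_real (1 - s) :: complex) = 1 - s"
    unfolding norm_of_real using s_le by simp
  hence "of_real (1 - s) \<in> near_set"
    using s_pos s_le R_bounds by (simp add: near_set_def)
  moreover have "c \<in> near_set" using assms corner_near by auto
  moreover have "convex near_set" by (simp add: near_set_eq convex_Int)
  ultimately show near: "z \<in> near_set"
    using assms(2) by (meson convex_contains_segment subsetD)
  obtain u where u: "0 \<le> u" "u \<le> 1" "z = (1 - u) *\<^sub>R of_real (1 - s) + u *\<^sub>R c"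
    using assms(2) by (auto simp: in_segment)
  have "Re z = (1 - u) * (1 - s) + u * Re corner" "\<bar>Im z\<bar> = u * (R * s)"
    using u assms(1) s_pos R_bounds by (auto simp: corner_Re_Im abs_mult)
  moreover have "Re corner \<le> 1 + \<delta>"
    using mult_left_mono[OF sqrt_ge(2), of R] R_bounds by (simp add: corner_Re_Im R_def)
  hence "u * Re corner \<le> u * (1 + \<delta>)" using u by (intro mult_left_mono) auto
  moreover have "u * \<delta> \<le> 1 * \<delta>" using u delta_pos by (intro mult_right_mono) auto
  moreover have "u * s * 1 \<le> u * s * R" using u s_pos R_bounds by (intro mult_left_mono) auto
  ultimately have "Re z \<le> (1 - u) * (1 - s) + u * (1 + \<delta>)" "u * \<delta> \<le> \<delta>" "u * s \<le> \<bar>Im z\<bar>"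
    by (simp_all add: mult.assoc mult.commute[of R s])
  hence "Re z < 1 - s / 2 + \<bar>Im z\<bar>"
    using s_pos delta_le by (simp add: algebra_simps)
  moreover have "norm z < 1 + 2 * \<delta>" using near delta_pos by (simp add: near_set_def R_def)
  ultimately show "z \<in> domain" by (simp add: domain_def)
qed

lemma valid_far [simp]: "valid_path far" by (simp add: far_def)

lemma valid_bump: "valid_path bump" by (simp add: bump_def valid_path_join)

lemma bump_image: "path_image bump \<subseteq> near_set \<inter> domain"
proof -
  have "path_image bump = closed_segment (of_real (1 - s)) (cnj corner) \<union> closed_segment (of_real (1 - s)) corner"
    by (simp add: bump_def path_image_join closed_segment_commute)
  thus ?thesis using segment_in by blast
qed

lemma corner_ends: "pathstart far = corner" "pathfinish far = cnj corner"
  "pathstart bump = cnj corner" "pathfinish bump = corner"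
proof -
  show "pathstart far = corner" by (simp add: far_def corner_def cis_conv_exp)
  have "exp (\<i> * (2 * of_real pi - of_real (arcsin s))) = cis (2 * pi - arcsin s)"
    by (simp add: cis_conv_exp)
  also have "\<dots> = cnj (cis (arcsin s))"
    by (simp add: complex_eq_iff cos_diff sin_diff)
  finally have "exp (\<i> * (2 * of_real pi - of_real (arcsin s))) = cnj (cis (arcsin s))" .
  thus "pathfinish far = cnj corner" by (simp add: far_def corner_def)
qed (simp_all add: bump_def)

text \<open>The length of the arc is at most \<open>2 * pi * R\<close>, which is below 8.\<close>

lemma contour_integral_far_bound:
  assumes "continuous_on (path_image far) F" "\<And>z. z \<in> path_image far \<Longrightarrow> norm (F z) \<le> B" "0 \<le> B"
  shows "norm (contour_integral far F) \<le> 8 * B"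
proof -
  have "norm (contour_integral far F) \<le> B * R * \<bar>2 * pi - arcsin s - arcsin s\<bar>"
    unfolding far_def
    by (rule contour_integral_bound_part_circlepath)
      (use assms R_bounds in \<open>auto simp: far_def intro: contour_integrable_continuous_part_circlepath\<close>)
  also have "\<dots> = (R * (2 * pi - 2 * arcsin s)) * B"
    using arcsin_s pi_gt3 by simp
  also have "R * (2 * pi - 2 * arcsin s) \<le> (33/32 + 1/1000) * (2 * 3.2)"
    using arcsin_s pi_gt3 R_bounds pi_approx by (intro mult_mono) auto
  also have "(33/32 + 1/1000) * (2 * 3.2) * B \<le> 8 * B" using assms by simp
  finally show ?thesis using assms(3) by (simp add: mult_right_mono)
qed

text \<open>The arc followed by the detour is a closed path in a starlike domain. Cauchy's theorem
  therefore trades the arc, on which \<open>F\<close> may be large, for the detour, on which it is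
  at most \<open>B\<close> and whose two segments have total length at most 4.\<close>

lemma contour_integral_far_deform:
  assumes F: "F holomorphic_on domain" and B: "\<And>z. z \<in> near_set \<inter> domain \<Longrightarrow> norm (F z) \<le> B" "0 \<le> B"
  shows "norm (contour_integral far F) \<le> 4 * B"
proof -
  have cont: "continuous_on domain F" using F by (rule holomorphic_on_imp_continuous_on)
  have "(F has_contour_integral 0) (far +++ bump)"
    using bump_image far_image(2)
    by (intro Cauchy_theorem_starlike_simple[OF open_domain starlike_domain F])
      (auto simp: valid_path_join valid_bump corner_ends path_image_join)
  hence "contour_integral (far +++ bump) F = 0" by (rule contour_integral_unique)
  moreover have "F contour_integrable_on far"
    by (rule contour_integrable_holomorphic_simple[OF F open_domain]) (auto intro: far_image)
  moreover have "F contour_integrable_on bump"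
    by (rule contour_integrable_holomorphic_simple[OF F open_domain valid_bump]) (use bump_image in auto)
  ultimately have eq: "contour_integral far F = - contour_integral bump F"
    by (simp add: contour_integral_join valid_bump add_eq_0_iff)
  have li: "F contour_integrable_on linepath (of_real (1 - s)) c" if "c = corner \<or> c = cnj corner" for c
    using segment_in[OF that] by (intro contour_integrable_continuous_linepath continuous_on_subset[OF cont]) auto
  have lb: "norm (contour_integral (linepath (of_real (1 - s)) c) F) \<le> 2 * B" if c: "c = corner \<or> c = cnj corner" for c
  proof -
    have "norm (contour_integral (linepath (of_real (1 - s)) c) F) \<le> B * norm (c - of_real (1 - s))"
      using segment_in[OF c]
      by (intro has_contour_integral_bound_linepath[OF has_contour_integral_integral[OF li[OF c]]] B) auto
    also have "B * norm (c - of_real (1 - s)) \<le> B * 2"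
    proof (rule mult_left_mono[OF _ B(2)])
      have "norm (c - of_real (1 - s)) \<le> norm (1 - c) + norm (of_real s :: complex)"
      using norm_triangle_ineq4[of "of_real s" "1 - c"] by (simp add: algebra_simps)
    also have "\<dots> \<le> 4 * s + s"
      using corner_near c s_pos by (auto simp: near_set_def)
      also have "\<dots> \<le> 2" using s_le by simp
      finally show "norm (c - of_real (1 - s)) \<le> 2" .
    qed
    finally show ?thesis by (simp add: mult.commute)
  qed
  have cs: "continuous_on (closed_segment (of_real (1 - s)) (cnj corner)) F"
    using segment_in by (intro continuous_on_subset[OF cont]) auto
  have "contour_integral bump F = contour_integral (linepath (cnj corner) (of_real (1 - s))) F +
      contour_integral (linepath (of_real (1 - s)) corner) F"
    unfolding bump_def using li[of corner] cs
    by (intro contour_integral_join) (auto simp: closed_segment_commute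
        intro: contour_integrable_continuous_linepath)
  also have "contour_integral (linepath (cnj corner) (of_real (1 - s))) F =
      - contour_integral (linepath (of_real (1 - s)) (cnj corner)) F"
    using cs by (intro contour_integral_reverse_linepath) (simp add: closed_segment_commute)
  finally have "norm (contour_integral bump F) \<le> norm (contour_integral (linepath (of_real (1 - s)) (cnj corner)) F) +
      norm (contour_integral (linepath (of_real (1 - s)) corner) F)"
    by (metis norm_minus_cancel norm_triangle_ineq)
  thus ?thesis unfolding eq norm_minus_cancel
    using lb[of corner] lb[of "cnj corner"] by simp
qed

text \<open>The two integrals differ by the short arc around 1, which lies in
  \<open>near_set\<close> and has length at most 4. It appears as two intervals of angles, one at
  each end of the full turn.\<close>

lemma contour_integral_circle_far:
  assumes F: "continuous_on (sphere 0 R) F" and B: "\<And>z. z \<in> near_set \<Longrightarrow> norm z = R \<Longrightarrow> norm (F z) \<le> B" "0 \<le> B"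
  shows "norm (contour_integral (circlepath 0 R) F - contour_integral far F) \<le> 4 * B"
proof -
  define t where "t = arcsin s"
  have t: "0 < t" "t \<le> pi / 2" "t < 2 * pi - t" "2 * pi - t < 2 * pi"
    using arcsin_s pi_gt3 by (auto simp: t_def)
  define g where "g = (\<lambda>x. F (0 + R * cis x) * R * \<i> * cis x)"
  have "continuous_on UNIV (\<lambda>x. F (0 + R * cis x))"
    by (intro continuous_on_compose2[OF F] continuous_intros) (use R_bounds in \<open>auto simp: norm_mult\<close>)
  hence gc: "continuous_on A g" for A
    unfolding g_def by (intro continuous_intros) (auto intro: continuous_on_subset)
  have gi: "g integrable_on {a..b}" for a b
    by (rule integrable_continuous_real[OF gc])
  have "contour_integral (circlepath 0 R) F = integral {0..2*pi} g"
    unfolding circlepath_def g_def by (subst contour_integral_part_circlepath_eq) auto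
  also have "\<dots> = integral {0..t} g + integral {t..2*pi-t} g + integral {2*pi-t..2*pi} g"
    using Henstock_Kurzweil_Integration.integral_combine[of 0 t "2*pi-t" g]
      Henstock_Kurzweil_Integration.integral_combine[of 0 "2*pi-t" "2*pi" g] t gi by simp
  also have "integral {t..2*pi-t} g = contour_integral far F"
    unfolding far_def g_def t_def[symmetric] using t by (subst contour_integral_part_circlepath_eq) auto
  finally have eq: "contour_integral (circlepath 0 R) F - contour_integral far F =
      integral {0..t} g + integral {2*pi-t..2*pi} g" by simp
  have bd: "norm (g x) \<le> B * R" if "\<bar>sin x\<bar> \<le> s" "sqrt (1 - s\<^sup>2) \<le> cos x" for x
  proof -
    have "norm (1 - R * cis x) \<le> \<bar>1 - R * cos x\<bar> + \<bar>R * sin x\<bar>"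
      using cmod_le[of "1 - R * cis x"] by simp
    moreover have "\<bar>R * sin x\<bar> \<le> 2 * s"
      unfolding abs_mult using that R_bounds s_pos by (intro mult_mono) auto
    moreover have "\<bar>1 - R * cos x\<bar> \<le> s"
    proof -
      have lo: "1 - s \<le> R * cos x"
        using mult_mono[of 1 R "1 - s" "cos x"] that R_bounds sqrt_ge s_le by simp
      have "R * cos x \<le> R * 1" using R_bounds by (intro mult_left_mono) auto
      hence hi: "R * cos x \<le> 1 + s" using delta_le s_pos unfolding R_def by simp
      from lo hi show ?thesis unfolding abs_le_iff by simp
    qed
    ultimately have "norm (1 - R * cis x) \<le> 4 * s"
      using s_pos by linarith
    hence "norm (F (R * cis x)) \<le> B"
      using R_bounds by (intro B) (auto simp: near_set_def norm_mult)
    thus ?thesis using R_bounds by (simp add: g_def norm_mult)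
  qed
  have nb: "norm (integral {a..b} g) \<le> B * R * (b - a)"
    if "a \<le> b" "\<And>x. x \<in> {a..b} \<Longrightarrow> \<bar>sin x\<bar> \<le> s \<and> sqrt (1 - s\<^sup>2) \<le> cos x" for a b
    using that bd by (intro integral_bound gc) auto
  have "norm (integral {0..t} g) \<le> B * R * (t - 0)"
  proof (rule nb)
    fix x assume x: "x \<in> {0..t}"
    have "sin x \<le> sin t" using x t pi_gt3 by (intro sin_monotone_2pi_le) auto
    moreover have "0 \<le> sin x" using x t pi_gt3 by (intro sin_ge_zero) auto
    moreover have "cos t \<le> cos x" using x t pi_gt3 by (intro cos_monotone_0_pi_le) auto
    ultimately show "\<bar>sin x\<bar> \<le> s \<and> sqrt (1 - s\<^sup>2) \<le> cos x" using arcsin_s by (simp add: t_def)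
  qed (use t in simp)
  moreover have "norm (integral {2*pi-t..2*pi} g) \<le> B * R * (2*pi - (2*pi - t))"
  proof (rule nb)
    fix y assume y: "y \<in> {2*pi-t..2*pi}"
    define x where "x = 2 * pi - y"
    have x: "x \<in> {0..t}" using y by (auto simp: x_def)
    have "sin x \<le> sin t" using x t pi_gt3 by (intro sin_monotone_2pi_le) auto
    moreover have "0 \<le> sin x" using x t pi_gt3 by (intro sin_ge_zero) auto
    moreover have "cos t \<le> cos x" using x t pi_gt3 by (intro cos_monotone_0_pi_le) auto
    moreover have "sin y = - sin x" "cos y = cos x" by (simp_all add: x_def sin_diff cos_diff)
    ultimately show "\<bar>sin y\<bar> \<le> s \<and> sqrt (1 - s\<^sup>2) \<le> cos y" using arcsin_s by (simp add: t_def)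
  qed (use t in simp)
  moreover have "B * (R * t) \<le> B * ((33/32 + 1/1000) * 1.6)"
    using B t R_bounds pi_approx by (intro mult_mono mult_left_mono) auto
  hence "B * R * t \<le> 2 * B" using B(2) by simp
  ultimately show ?thesis
    unfolding eq using norm_triangle_ineq[of "integral {0..t} g" "integral {2*pi-t..2*pi} g"] by simp
qed

end

section \<open>The damping factor and its Taylor coefficients\<close>

text \<open>To the left of the pole \<open>1 + s\<close> the exponent has nonpositive real part, so
  the exponential never exceeds 1 in modulus there. The positive shift \<open>s\<close> keeps the
  function holomorphic across the unit circle.\<close>

definition damp :: "real \<Rightarrow> real \<Rightarrow> complex \<Rightarrow> complex"
  where "damp \<kappa> s z = (1 - z) ^ 4 * exp (- of_real \<kappa> / (1 - z + of_real s))"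

lemma damp_holomorphic: "damp \<kappa> s holomorphic_on {z. Re z < 1 + s}"
proof -
  have "1 - z + of_real s \<noteq> 0" if "Re z < 1 + s" for z
    using that by (auto simp: complex_eq_iff)
  thus ?thesis unfolding damp_def by (intro holomorphic_intros) auto
qed

lemma Re_inverse_eq: "Re (of_real \<kappa> / x) = \<kappa> * Re x / (norm x)\<^sup>2"
  by (simp add: Re_divide cmod_power2)

lemma norm_damp_le:
  assumes "Re z \<le> 1 + s" "0 \<le> \<kappa>"
  shows "norm (damp \<kappa> s z) \<le> norm (1 - z) ^ 4"
proof -
  have "0 \<le> Re (of_real \<kappa> / (1 - z + of_real s))"
    unfolding Re_inverse_eq using assms by (intro divide_nonneg_nonneg mult_nonneg_nonneg) auto
  hence "norm (1 - z) ^ 4 * exp (Re (- of_real \<kappa> / (1 - z + of_real s))) \<le> norm (1 - z) ^ 4 * 1"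
    by (intro mult_left_mono) auto
  thus ?thesis by (simp add: damp_def norm_mult norm_power)
qed

text \<open>With \<open>x = 1 - z + s\<close>, the real part of \<open>1 / x\<close> is
  \<open>Re x / (norm x)^2\<close>. As \<open>Re x\<close> is at least \<open>s / 2\<close> and
  \<open>norm x\<close> at most \<open>5 * s\<close>, it is at least \<open>1 / (50 * s)\<close>;
  this is the origin of the constant 50.\<close>

lemma norm_damp_near:
  assumes "norm (1 - z) \<le> 4 * s" "Re z \<le> 1 + s / 2" "0 \<le> \<kappa>" "0 < s" "s \<le> 1/4"
  shows "norm (damp \<kappa> s z) \<le> exp (- (\<kappa> / (50 * s)))"
proof -
  define x where "x = 1 - z + of_real s"
  have x: "s / 2 \<le> Re x" using assms by (simp add: x_def)
  have x5: "norm x \<le> 5 * s"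
    using norm_triangle_ineq[of "1 - z" "of_real s"] assms by (simp add: x_def)
  have "0 < norm x" using x assms by auto
  have "1 / (50 * s) = (s / 2) / (5 * s)\<^sup>2"
    using assms by (simp add: power2_eq_square field_simps)
  also have "\<dots> \<le> Re x / (norm x)\<^sup>2"
    using x x5 \<open>0 < norm x\<close> assms by (intro frac_le power_mono zero_less_power) auto
  finally have "\<kappa> * (1 / (50 * s)) \<le> \<kappa> * (Re x / (norm x)\<^sup>2)"
    using assms by (intro mult_left_mono) auto
  hence "exp (Re (- of_real \<kappa> / x)) \<le> exp (- (\<kappa> / (50 * s)))"
    using Re_inverse_eq[of \<kappa> x] by simp
  moreover have "norm (1 - z) ^ 4 \<le> 1" using assms by (intro power_le_one) auto
  ultimately have "norm (1 - z) ^ 4 * exp (Re (- of_real \<kappa> / x)) \<le> 1 * exp (- (\<kappa> / (50 * s)))"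
    by (intro mult_mono) auto
  thus ?thesis by (simp add: damp_def norm_mult norm_power x_def)
qed

lemma taylor_has_sum:
  assumes "f holomorphic_on ball 0 1" "z \<in> ball 0 1"
  shows "((\<lambda>n. (deriv ^^ n) f 0 / fact n * z ^ n) has_sum f z) UNIV"
proof -
  define r where "r = (norm z + 1) / 2"
  have r: "norm z < r" "r < 1" using assms(2) by (auto simp: r_def)
  have "(\<lambda>n. (deriv ^^ n) f 0 / fact n * (of_real r - 0) ^ n) sums f (of_real r)"
    using r by (intro holomorphic_power_series[OF assms(1)]) (auto simp: r_def)
  hence "summable (\<lambda>n. (deriv ^^ n) f 0 / fact n * of_real r ^ n)"
    by (simp add: sums_iff)
  hence "summable (\<lambda>n. norm ((deriv ^^ n) f 0 / fact n * z ^ n))"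
    by (rule powser_insidea) (use r in \<open>auto simp: r_def\<close>)
  moreover have "(\<lambda>n. (deriv ^^ n) f 0 / fact n * (z - 0) ^ n) sums f z"
    by (rule holomorphic_power_series[OF assms])
  ultimately show ?thesis
    by (intro norm_summable_imp_has_sum) auto
qed

lemma powi_neg_Suc: "(x::'a::division_ring) powi (- int n - 1) = inverse (x ^ Suc n)"
proof -
  have "- int n - 1 = - int (Suc n)" by simp
  thus ?thesis by (simp only: power_int_minus power_int_of_nat)
qed

definition damp_coeff :: "real \<Rightarrow> real \<Rightarrow> nat \<Rightarrow> complex"
  where "damp_coeff \<kappa> s n = (deriv ^^ n) (damp \<kappa> s) 0 / fact n"

context keyhole
begin

lemma far_nonzero: "z \<in> path_image far \<Longrightarrow> z \<noteq> 0"
  using far_image(1) R_bounds by force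

lemma contour_integrable_far: "continuous_on (path_image far) F \<Longrightarrow> F contour_integrable_on far"
  by (simp add: far_def contour_integrable_continuous_part_circlepath)

lemma damp_in_domain:
  assumes "z \<in> domain" "0 \<le> \<kappa>"
  shows "norm (damp \<kappa> s z) \<le> 81"
proof -
  have z: "norm z < 1 + 2 * \<delta>" using assms by (simp add: domain_def)
  have "norm (1 - z) \<le> 3"
    using norm_triangle_ineq4[of 1 z] z delta_le s_le by simp
  hence "norm (1 - z) ^ 4 \<le> 3 ^ 4" by (intro power_mono) auto
  moreover have "Re z \<le> 1 + s"
    using complex_Re_le_cmod[of z] z delta_le s_pos by simp
  ultimately show ?thesis using norm_damp_le[of z s \<kappa>] assms by simp
qed

lemma damp_in_near:
  assumes "z \<in> near_set" "0 \<le> \<kappa>"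
  shows "norm (damp \<kappa> s z) \<le> exp (- (\<kappa> / (50 * s)))"
  using assms complex_Re_le_cmod[of z] delta_le s_pos s_le
  by (intro norm_damp_near) (auto simp: near_set_def R_def)

lemma damp_holomorphic_domain: "damp \<kappa> s holomorphic_on domain"
proof (rule holomorphic_on_subset[OF damp_holomorphic])
  show "domain \<subseteq> {z. Re z < 1 + s}"
  proof
    fix z assume "z \<in> domain"
    thus "z \<in> {z. Re z < 1 + s}"
      using complex_Re_le_cmod[of z] delta_le s_pos by (auto simp: domain_def)
  qed
qed

definition far_coeff :: "real \<Rightarrow> nat \<Rightarrow> complex"
  where "far_coeff \<kappa> n = contour_integral far (\<lambda>z. z powi (- int n - 1) * damp \<kappa> s z) / (2 * pi * \<i>)"

lemma norm_powi_far: "norm (z::complex) = R \<Longrightarrow> norm (z powi e) = R powi e"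
  by (simp add: norm_power_int)

lemma powi_R_le: "R powi (- int n - 1) \<le> (1 / R) ^ n"
proof -
  have "R powi (- int n - 1) = inverse (R ^ n * R)"
    by (simp add: powi_neg_Suc mult.commute)
  also have "\<dots> \<le> inverse (R ^ n * 1)"
    using R_bounds by (intro le_imp_inverse_le mult_left_mono) auto
  finally show ?thesis by (simp add: power_one_over inverse_eq_divide)
qed

lemma continuous_powi_far: "continuous_on (path_image far) (\<lambda>z. z powi e)"
  by (intro continuous_intros) (use far_nonzero in auto)

text \<open>On the arc \<open>damp\<close> is at most 3^4 = 81, and \<open>8 * 81 / (2 * pi)\<close>
  is below 110.\<close>

lemma norm_far_coeff_le:
  assumes "0 \<le> \<kappa>"
  shows "norm (far_coeff \<kappa> n) \<le> 110 * (1 / R) ^ n"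
proof -
  have "norm (contour_integral far (\<lambda>z. z powi (- int n - 1) * damp \<kappa> s z)) \<le> 8 * ((1 / R) ^ n * 81)"
  proof (rule contour_integral_far_bound)
    show "continuous_on (path_image far) (\<lambda>z. z powi (- int n - 1) * damp \<kappa> s z)"
      by (intro continuous_on_mult continuous_powi_far
          continuous_on_subset[OF holomorphic_on_imp_continuous_on[OF damp_holomorphic_domain]])
        (auto intro: far_image)
    fix z assume z: "z \<in> path_image far"
    show "norm (z powi (- int n - 1) * damp \<kappa> s z) \<le> (1 / R) ^ n * 81"
      unfolding norm_mult norm_powi_far[OF far_image(1)[OF z]]
      by (intro mult_mono powi_R_le damp_in_domain far_image z assms) (use R_bounds in auto)
  qed (use R_bounds in auto)
  hence "norm (contour_integral far (\<lambda>z. z powi (- int n - 1) * damp \<kappa> s z)) / (2 * pi) \<le>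
      8 * ((1 / R) ^ n * 81) / (2 * pi)"
    by (rule divide_right_mono) simp
  hence "norm (far_coeff \<kappa> n) \<le> 8 * ((1 / R) ^ n * 81) / (2 * pi)"
    by (simp only: far_coeff_def norm_divide) (simp add: norm_mult)
  also have "\<dots> \<le> 8 * ((1 / R) ^ n * 81) / 6"
    using pi_gt3 R_bounds by (intro divide_left_mono) auto
  also have "\<dots> \<le> 110 * (1 / R) ^ n" using R_bounds by simp
  finally show ?thesis .
qed

text \<open>Cauchy's formula over the full circle of radius \<open>R\<close> is exact, because
  \<open>damp\<close> is holomorphic on that disc. The omitted arc contributes only the tiny values
  of \<open>damp\<close> near 1.\<close>

lemma damp_coeff_far_coeff:
  assumes "0 \<le> \<kappa>"
  shows "norm (damp_coeff \<kappa> s n - far_coeff \<kappa> n) \<le> exp (- (\<kappa> / (50 * s))) * (1 / R) ^ n"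
proof -
  define F where "F = (\<lambda>z. z powi (- int n - 1) * damp \<kappa> s z)"
  have sub: "cball 0 R \<subseteq> {z. Re z < 1 + s}"
  proof
    fix z assume "z \<in> cball (0::complex) R"
    thus "z \<in> {z. Re z < 1 + s}"
      using complex_Re_le_cmod[of z] delta_le s_pos by (auto simp: R_def)
  qed
  have hol: "damp \<kappa> s holomorphic_on cball 0 R"
    by (rule holomorphic_on_subset[OF damp_holomorphic sub])
  have "(deriv ^^ n) (damp \<kappa> s) 0 = fact n / (2 * pi * \<i>) *
      contour_integral (circlepath 0 R) (\<lambda>u. damp \<kappa> s u / (u - 0) ^ Suc n)"
    using R_bounds by (intro Cauchy_higher_derivative_integral_circlepath
        holomorphic_on_imp_continuous_on hol holomorphic_on_subset[OF hol]) auto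
  also have "(\<lambda>u. damp \<kappa> s u / (u - 0) ^ Suc n) = F"
  proof
    fix u :: complex
    show "damp \<kappa> s u / (u - 0) ^ Suc n = F u"
      unfolding F_def powi_neg_Suc by (simp add: field_simps)
  qed
  finally have eq: "damp_coeff \<kappa> s n - far_coeff \<kappa> n =
      (contour_integral (circlepath 0 R) F - contour_integral far F) / (2 * pi * \<i>)"
    by (simp add: damp_coeff_def far_coeff_def F_def diff_divide_distrib)
  have "norm (contour_integral (circlepath 0 R) F - contour_integral far F) \<le>
      4 * ((1 / R) ^ n * exp (- (\<kappa> / (50 * s))))"
  proof (rule contour_integral_circle_far)
    show "continuous_on (sphere 0 R) F"
      unfolding F_def
      by (intro continuous_intros continuous_on_subset[OF holomorphic_on_imp_continuous_on[OF hol]])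
        (use R_bounds in auto)
    fix z assume z: "z \<in> near_set" "norm z = R"
    show "norm (F z) \<le> (1 / R) ^ n * exp (- (\<kappa> / (50 * s)))"
      unfolding norm_mult F_def norm_powi_far[OF z(2)]
      by (intro mult_mono powi_R_le damp_in_near z assms) (use R_bounds in auto)
  qed (use R_bounds in auto)
  hence "norm (contour_integral (circlepath 0 R) F - contour_integral far F) / (2 * pi) \<le>
      4 * ((1 / R) ^ n * exp (- (\<kappa> / (50 * s)))) / (2 * pi)"
    by (rule divide_right_mono) simp
  hence "norm (damp_coeff \<kappa> s n - far_coeff \<kappa> n) \<le> 4 * ((1 / R) ^ n * exp (- (\<kappa> / (50 * s)))) / (2 * pi)"
    by (simp only: eq norm_divide) (simp add: norm_mult)
  also have "\<dots> \<le> 4 * ((1 / R) ^ n * exp (- (\<kappa> / (50 * s)))) / 4"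
    using pi_gt3 R_bounds by (intro divide_left_mono) auto
  finally show ?thesis by (simp add: mult.commute)
qed

text \<open>The exponents are integers because they cross zero: negative ones come from Cauchy
  kernels, and multiplication by a monomial shifts them, possibly to nonnegative values, where the
  integrand no longer has a pole at 0.\<close>

definition dint :: "(complex \<Rightarrow> complex \<Rightarrow> complex) \<Rightarrow> int \<Rightarrow> int \<Rightarrow> complex"
  where "dint H e f = contour_integral far (\<lambda>x. x powi e * contour_integral far (\<lambda>y. y powi f * H x y))"

text \<open>Parametrising the arc by its angle turns the inner integral into one over a fixed
  interval, which depends continuously on the parameter \<open>x\<close>.\<close>

lemma inner_continuous:
  assumes "continuous_on (path_image far \<times> path_image far) (\<lambda>(x, y). H x y)"
  shows "continuous_on (path_image far) (\<lambda>x. contour_integral far (\<lambda>y. y powi f * H x y))"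
proof -
  have lt: "arcsin s < 2 * pi - arcsin s" using arcsin_s pi_gt3 by linarith
  let ?I = "{arcsin s..2 * pi - arcsin s}"
  have im: "of_real R * cis t \<in> path_image far" if "t \<in> ?I" for t
    using that lt by (auto simp: far_def path_image_part_circlepath' closed_segment_eq_real_ivl)
  have ceq: "contour_integral far F = integral ?I (\<lambda>t. F (of_real R * cis t) * R * \<i> * cis t)"
    for F :: "complex \<Rightarrow> complex"
    unfolding far_def using lt by (subst contour_integral_part_circlepath_eq) auto
  have "continuous_on (path_image far \<times> ?I) ((\<lambda>(x, y). H x y) \<circ> (\<lambda>(x, t). (x, of_real R * cis t)))"
    by (intro continuous_on_compose continuous_on_subset[OF assms])
      (auto simp: case_prod_unfold intro!: continuous_intros im)
  hence c1: "continuous_on (path_image far \<times> ?I) (\<lambda>p. H (fst p) (of_real R * cis (snd p)))"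
    by (simp add: o_def case_prod_unfold)
  have "continuous_on (path_image far \<times> ?I)
      (\<lambda>p. (of_real R * cis (snd p)) powi f * H (fst p) (of_real R * cis (snd p)) * R * \<i> * cis (snd p))"
    by (intro continuous_intros c1) (use R_bounds in auto)
  hence "continuous_on (path_image far \<times> cbox (arcsin s) (2 * pi - arcsin s))
      (\<lambda>(x, t). (of_real R * cis t) powi f * H x (of_real R * cis t) * R * \<i> * cis t)"
    by (simp add: case_prod_unfold)
  from integral_continuous_on_param[OF this]
  have "continuous_on (path_image far) (\<lambda>x. integral ?I
      (\<lambda>t. (of_real R * cis t) powi f * H x (of_real R * cis t) * R * \<i> * cis t))"
    by (simp only: box_real prod.case)
  thus ?thesis
    by (rule continuous_on_eq) (rule ceq[symmetric])
qed

lemma continuous_far_slice: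
  assumes "continuous_on (path_image far \<times> path_image far) (\<lambda>(x, y). H x y)" "x \<in> path_image far"
  shows "continuous_on (path_image far) (H x)"
proof -
  have "continuous_on (path_image far) ((\<lambda>(x, y). H x y) \<circ> (\<lambda>y. (x, y)))"
    by (intro continuous_on_compose continuous_on_subset[OF assms(1)]) (use assms(2) in \<open>auto intro!: continuous_intros\<close>)
  thus ?thesis by (simp add: o_def)
qed

lemma dint_bound_aux:
  assumes "continuous_on (path_image far \<times> path_image far) (\<lambda>(x, y). H x y)"
    and "\<And>x. x \<in> path_image far \<Longrightarrow> norm (contour_integral far (\<lambda>y. y powi f * H x y)) \<le> 8 * (R powi f * B)"
    and "0 \<le> B"
  shows "norm (dint H e f) \<le> 64 * B * (R powi e * R powi f)"
proof -
  have "norm (dint H e f) \<le> 8 * (R powi e * (8 * (R powi f * B)))"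
    unfolding dint_def
  proof (rule contour_integral_far_bound)
    fix x assume x: "x \<in> path_image far"
    show "norm (x powi e * contour_integral far (\<lambda>y. y powi f * H x y)) \<le> R powi e * (8 * (R powi f * B))"
      unfolding norm_mult norm_powi_far[OF far_image(1)[OF x]]
      by (intro mult_left_mono assms x) (use R_bounds in auto)
  qed (use R_bounds assms in \<open>auto intro!: continuous_on_mult continuous_powi_far inner_continuous\<close>)
  thus ?thesis by (simp add: mult_ac)
qed

lemma dint_bound:
  assumes H: "continuous_on (path_image far \<times> path_image far) (\<lambda>(x, y). H x y)"
    and B: "\<And>x y. x \<in> path_image far \<Longrightarrow> y \<in> path_image far \<Longrightarrow> norm (H x y) \<le> B" and "0 \<le> B"
  shows "norm (dint H e f) \<le> 64 * B * (R powi e * R powi f)"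
proof (rule dint_bound_aux[OF H _ \<open>0 \<le> B\<close>])
  fix x assume x: "x \<in> path_image far"
  show "norm (contour_integral far (\<lambda>y. y powi f * H x y)) \<le> 8 * (R powi f * B)"
  proof (rule contour_integral_far_bound)
    show "continuous_on (path_image far) (\<lambda>y. y powi f * H x y)"
      by (intro continuous_on_mult continuous_powi_far continuous_far_slice[OF H x])
    fix y assume y: "y \<in> path_image far"
    show "norm (y powi f * H x y) \<le> R powi f * B"
      unfolding norm_mult norm_powi_far[OF far_image(1)[OF y]]
      by (intro mult_left_mono B x y) (use R_bounds in auto)
  qed (use R_bounds \<open>0 \<le> B\<close> in auto)
qed

text \<open>A nonnegative exponent leaves no pole at 0, so for each outer point \<open>x\<close> on
  the arc the inner integral may be moved to the detour, where \<open>H x\<close> is at most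
  \<open>B\<close>.\<close>

lemma dint_small_right:
  assumes H: "continuous_on (path_image far \<times> path_image far) (\<lambda>(x, y). H x y)"
    and hol: "\<And>x. x \<in> path_image far \<Longrightarrow> H x holomorphic_on domain"
    and B: "\<And>x y. x \<in> path_image far \<Longrightarrow> y \<in> near_set \<inter> domain \<Longrightarrow> norm (H x y) \<le> B"
    and "0 \<le> B" "0 \<le> f"
  shows "norm (dint H e f) \<le> 64 * B * (R powi e * R powi f)"
proof (rule dint_bound_aux[OF H _ \<open>0 \<le> B\<close>])
  fix x assume x: "x \<in> path_image far"
  obtain k where f: "f = int k" using \<open>0 \<le> f\<close> nonneg_int_cases by blast
  have "norm (contour_integral far (\<lambda>y. y powi f * H x y)) \<le> 4 * (R powi f * B)"
  proof (rule contour_integral_far_deform)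
    show "(\<lambda>y. y powi f * H x y) holomorphic_on domain"
      unfolding f power_int_of_nat by (intro holomorphic_intros hol x)
    fix y assume y: "y \<in> near_set \<inter> domain"
    have "norm y ^ k \<le> R ^ k" using y by (intro power_mono) (auto simp: near_set_def)
    thus "norm (y powi f * H x y) \<le> R powi f * B"
      unfolding norm_mult f power_int_of_nat norm_power using R_bounds
      by (intro mult_mono B x y) auto
  qed (use R_bounds \<open>0 \<le> B\<close> in auto)
  also have "\<dots> \<le> 8 * (R powi f * B)" using R_bounds \<open>0 \<le> B\<close> by simp
  finally show "norm (contour_integral far (\<lambda>y. y powi f * H x y)) \<le> 8 * (R powi f * B)" .
qed

lemma vector_derivative_far: "continuous_on {0..1} (\<lambda>t. vector_derivative far (at t))"
  unfolding far_def vector_derivative_part_circlepath by (intro continuous_intros)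

lemma contour_integral_far_cong:
  "(\<And>z. z \<in> path_image far \<Longrightarrow> F z = G z) \<Longrightarrow> contour_integral far F = contour_integral far G"
  by (rule contour_integral_cong) auto

text \<open>Fubini for the continuous integrand; it reduces the deformation in the first variable to
  that in the second.\<close>

lemma dint_swap:
  assumes H: "continuous_on (path_image far \<times> path_image far) (\<lambda>(x, y). H x y)"
  shows "dint H e f = dint (\<lambda>x y. H y x) f e"
proof -
  have "continuous_on (path_image far \<times> path_image far) ((\<lambda>(x, y). H x y) \<circ> prod.swap)"
    by (intro continuous_on_compose continuous_on_subset[OF H] continuous_on_swap) auto
  hence H': "continuous_on (path_image far \<times> path_image far) (\<lambda>(x, y). H y x)"
    by (simp add: o_def case_prod_unfold)
  have pow: "continuous_on (path_image far \<times> path_image far) (\<lambda>p. fst p powi e * (snd p powi f * (case p of (x, y) \<Rightarrow> H x y)))"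
    by (intro continuous_intros H) (use far_nonzero in auto)
  have "dint H e f = contour_integral far (\<lambda>x. contour_integral far (\<lambda>y. x powi e * (y powi f * H x y)))"
    unfolding dint_def
    by (intro contour_integral_far_cong contour_integral_lmul[symmetric] contour_integrable_far
        continuous_on_mult continuous_powi_far continuous_far_slice[OF H])
  also have "\<dots> = contour_integral far (\<lambda>y. contour_integral far (\<lambda>x. x powi e * (y powi f * H x y)))"
    by (rule contour_integral_swap) (use pow vector_derivative_far in \<open>auto simp: case_prod_unfold\<close>)
  also have "\<dots> = contour_integral far (\<lambda>y. contour_integral far (\<lambda>x. y powi f * (x powi e * H x y)))"
    by (simp add: mult.left_commute)
  also have "\<dots> = dint (\<lambda>x y. H y x) f e"
    unfolding dint_def
    by (intro contour_integral_far_cong contour_integral_lmul contour_integrable_far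
        continuous_on_mult continuous_powi_far continuous_far_slice[OF H'])
  finally show ?thesis .
qed

lemma dint_small_left:
  assumes H: "continuous_on (path_image far \<times> path_image far) (\<lambda>(x, y). H x y)"
    and hol: "\<And>y. y \<in> path_image far \<Longrightarrow> (\<lambda>x. H x y) holomorphic_on domain"
    and B: "\<And>x y. x \<in> near_set \<inter> domain \<Longrightarrow> y \<in> path_image far \<Longrightarrow> norm (H x y) \<le> B"
    and "0 \<le> B" "0 \<le> e"
  shows "norm (dint H e f) \<le> 64 * B * (R powi e * R powi f)"
proof -
  have "continuous_on (path_image far \<times> path_image far) ((\<lambda>(x, y). H x y) \<circ> prod.swap)"
    by (intro continuous_on_compose continuous_on_subset[OF H] continuous_on_swap) auto
  hence H': "continuous_on (path_image far \<times> path_image far) (\<lambda>(x, y). H y x)"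
    by (simp add: o_def case_prod_unfold)
  show ?thesis
    unfolding dint_swap[OF H] using dint_small_right[OF H' hol B \<open>0 \<le> B\<close> \<open>0 \<le> e\<close>, of f]
    by (simp add: mult_ac)
qed

lemma dint_cmult:
  assumes H: "continuous_on (path_image far \<times> path_image far) (\<lambda>(x, y). H x y)"
  shows "dint (\<lambda>x y. c * (x ^ k * y ^ l * H x y)) e f = c * dint H (e + int k) (f + int l)"
proof -
  have inner: "continuous_on (path_image far) (\<lambda>y. y powi (f + int l) * H x y)" if "x \<in> path_image far" for x
    by (intro continuous_on_mult continuous_powi_far continuous_far_slice[OF H that])
  have "x powi e * contour_integral far (\<lambda>y. y powi f * (c * (x ^ k * y ^ l * H x y))) =
      c * (x powi (e + int k) * contour_integral far (\<lambda>y. y powi (f + int l) * H x y))"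
    if x: "x \<in> path_image far" for x
  proof -
    have "contour_integral far (\<lambda>y. y powi f * (c * (x ^ k * y ^ l * H x y))) =
        contour_integral far (\<lambda>y. (c * x ^ k) * (y powi (f + int l) * H x y))"
      by (rule contour_integral_far_cong) (use far_nonzero in \<open>auto simp: power_int_add power_int_of_nat\<close>)
    also have "\<dots> = (c * x ^ k) * contour_integral far (\<lambda>y. y powi (f + int l) * H x y)"
      by (intro contour_integral_lmul contour_integrable_far inner x)
    finally show ?thesis
      using far_nonzero[OF x] by (simp add: power_int_add power_int_of_nat)
  qed
  hence "dint (\<lambda>x y. c * (x ^ k * y ^ l * H x y)) e f =
    contour_integral far (\<lambda>x. c * (x powi (e + int k) * contour_integral far (\<lambda>y. y powi (f + int l) * H x y)))"
    unfolding dint_def by (rule contour_integral_far_cong)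
  also have "\<dots> = c * dint H (e + int k) (f + int l)"
    unfolding dint_def by (intro contour_integral_lmul contour_integrable_far continuous_on_mult
        continuous_powi_far inner_continuous H)
  finally show ?thesis .
qed

lemma dint_sum:
  assumes "finite I"
    and H: "\<And>i. i \<in> I \<Longrightarrow> continuous_on (path_image far \<times> path_image far) (\<lambda>(x, y). H i x y)"
  shows "dint (\<lambda>x y. \<Sum>i\<in>I. H i x y) e f = (\<Sum>i\<in>I. dint (H i) e f)"
proof -
  have "dint (\<lambda>x y. \<Sum>i\<in>I. H i x y) e f =
      contour_integral far (\<lambda>x. \<Sum>i\<in>I. x powi e * contour_integral far (\<lambda>y. y powi f * H i x y))"
    unfolding dint_def sum_distrib_left
  proof (rule contour_integral_far_cong)
    fix x assume x: "x \<in> path_image far"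
    have "contour_integral far (\<lambda>y. \<Sum>i\<in>I. y powi f * H i x y) = (\<Sum>i\<in>I. contour_integral far (\<lambda>y. y powi f * H i x y))"
      by (intro contour_integral_sum \<open>finite I\<close> contour_integrable_far continuous_on_mult
          continuous_powi_far continuous_far_slice[OF H x])
    thus "x powi e * contour_integral far (\<lambda>y. \<Sum>i\<in>I. y powi f * H i x y) =
        (\<Sum>i\<in>I. x powi e * contour_integral far (\<lambda>y. y powi f * H i x y))"
      by (simp add: sum_distrib_left)
  qed
  also have "\<dots> = (\<Sum>i\<in>I. dint (H i) e f)"
    unfolding dint_def
    by (intro contour_integral_sum \<open>finite I\<close> contour_integrable_far continuous_on_mult
          continuous_powi_far inner_continuous H)
  finally show ?thesis .
qed

end

section \<open>Coefficients with geometric decay\<close>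

lemma has_sum_tensor_nonneg:
  fixes u v :: "nat \<Rightarrow> real"
  assumes "(u has_sum U) UNIV" "(v has_sum V) UNIV" "\<And>n. 0 \<le> u n" "\<And>n. 0 \<le> v n"
  shows "((\<lambda>(n, m). u n * v m) has_sum U * V) UNIV"
proof -
  have "((\<lambda>(n, m). u n * v m) has_sum U * V) (UNIV \<times> UNIV)"
  proof (rule has_sum_SigmaI)
    show i: "((\<lambda>m. case (n, m) of (n, m) \<Rightarrow> u n * v m) has_sum u n * V) UNIV" for n
      using has_sum_cmult_right[OF assms(2)] by simp
    show o: "((\<lambda>n. u n * V) has_sum U * V) UNIV"
      by (rule has_sum_cmult_left[OF assms(1)])
    show "(\<lambda>(n, m). u n * v m) summable_on UNIV \<times> UNIV"
      by (rule summable_on_SigmaI[OF i has_sum_imp_summable[OF o]]) (use assms in auto)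
  qed
  thus ?thesis by simp
qed

lemma has_sum_weighted_geometric:
  fixes r :: real
  assumes "0 \<le> r" "r < 1"
  shows "((\<lambda>(n, m). ((1 + real n) * r ^ n) * ((1 + real m) * r ^ m)) has_sum (1 / (1 - r)^2)^2) UNIV"
proof -
  have "(\<lambda>n. of_nat (Suc n) * r ^ n) sums (1 / (1 - r)^2)"
    using assms by (intro geometric_deriv_sums) auto
  hence 1: "((\<lambda>n. (1 + real n) * r ^ n) has_sum (1 / (1 - r)^2)) UNIV"
    using assms by (intro sums_nonneg_imp_has_sum) (auto simp: add.commute)
  from has_sum_tensor_nonneg[OF 1 1] show ?thesis
    using assms by (simp add: power2_eq_square)
qed

lemma one_plus_powr_le: "\<alpha> \<le> 1 \<Longrightarrow> (1 + real n) powr \<alpha> \<le> 1 + real n"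
  using powr_mono[of \<alpha> 1 "1 + real n"] by simp

text \<open>With exponents at most 1 the weight is at most \<open>(1 + n) * (1 + m)\<close>, and the
  sum of \<open>(1 + n) * r ^ n\<close> is \<open>1 / (1 - r)^2\<close> in each of the two
  variables.\<close>

lemma geometric_coeff_norm_le:
  fixes r :: real
  assumes r: "0 \<le> r" "r < 1" and a: "\<And>n m. norm (a (n, m)) \<le> b * (r ^ n * r ^ m)"
    and "expands2 f a" "\<alpha> \<le> 1" "\<beta> \<le> 1" and "0 \<le> b"
  shows "f \<in> wiener_class \<alpha> \<beta>" "wiener_norm \<alpha> \<beta> f \<le> b * (1 / (1 - r)^2)^2"
proof -
  have le: "norm (a p) * wiener_weight \<alpha> \<beta> p \<le>
      b * (case p of (n, m) \<Rightarrow> ((1 + real n) * r ^ n) * ((1 + real m) * r ^ m))" for p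
  proof -
    obtain n m where p: "p = (n, m)" by (cases p)
    have "wiener_weight \<alpha> \<beta> p \<le> (1 + real n) * (1 + real m)"
      unfolding wiener_weight_def p prod.case using assms by (intro mult_mono one_plus_powr_le) auto
    hence "norm (a p) * wiener_weight \<alpha> \<beta> p \<le> (b * (r ^ n * r ^ m)) * ((1 + real n) * (1 + real m))"
      unfolding p using assms by (intro mult_mono a) (auto simp: p)
    thus ?thesis by (simp add: p mult_ac)
  qed
  note * = wiener_norm_le[OF assms(4) le has_sum_cmult_right[OF has_sum_weighted_geometric[OF r]]]
  show "f \<in> wiener_class \<alpha> \<beta>" "wiener_norm \<alpha> \<beta> f \<le> b * (1 / (1 - r)^2)^2"
    by (rule *)+
qed

lemma geometric_coeff_obtain:
  fixes r :: real and a :: "nat \<times> nat \<Rightarrow> complex"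
  assumes r: "0 \<le> r" "r < 1" and a: "\<And>n m. norm (a (n, m)) \<le> b * (r ^ n * r ^ m)" and "0 \<le> b"
  obtains f where "expands2 f a"
proof -
  have "norm (a p) \<le> b * (case p of (n, m) \<Rightarrow> ((1 + real n) * r ^ n) * ((1 + real m) * r ^ m))" for p
  proof -
    obtain n m where p: "p = (n, m)" by (cases p)
    have "norm (a p) \<le> b * (r ^ n * r ^ m)" unfolding p by (rule a)
    also have "\<dots> \<le> b * (((1 + real n) * r ^ n) * ((1 + real m) * r ^ m))"
      using assms by (intro mult_left_mono mult_mono) (auto simp: mult_le_cancel_right1)
    finally show ?thesis by (simp add: p)
  qed
  hence "(\<lambda>p. norm (a p)) summable_on UNIV"
    by (intro summable_on_comparison_test[OF has_sum_imp_summable[OF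
        has_sum_cmult_right[OF has_sum_weighted_geometric[OF r]]]]) auto
  from that[OF expands2_summable[OF this]] show thesis .
qed

section \<open>Double Cauchy coefficients and products with polynomials\<close>

context keyhole
begin

text \<open>Taylor coefficients of the double Cauchy integral of \<open>H\<close> over the two arcs.
  The integral itself is never formed as a function of the point; the function is recovered as the
  sum of the series with these coefficients.\<close>

definition dcoeff :: "(complex \<Rightarrow> complex \<Rightarrow> complex) \<Rightarrow> nat \<times> nat \<Rightarrow> complex"
  where "dcoeff H = (\<lambda>(n, m). dint H (- int n - 1) (- int m - 1) / (2 * of_real pi * \<i>)\<^sup>2)"

lemma norm_two_pi_sq: "1 \<le> norm ((2 * of_real pi * \<i>)\<^sup>2)"
proof -
  have "1 \<le> (2 * pi)\<^sup>2" using pi_gt3 by (intro one_le_power) simp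
  thus ?thesis by (simp add: norm_power norm_mult)
qed

lemma norm_div_two_pi_le:
  assumes "norm x \<le> b"
  shows "norm (x / (2 * of_real pi * \<i>)\<^sup>2) \<le> b"
proof -
  have "norm x / norm ((2 * of_real pi * \<i>)\<^sup>2) \<le> norm x / 1"
    using norm_two_pi_sq by (intro divide_left_mono) auto
  thus ?thesis using assms by (simp only: norm_divide)
qed

lemma norm_dcoeff_le:
  assumes H: "continuous_on (path_image far \<times> path_image far) (\<lambda>(x, y). H x y)"
    and B: "\<And>x y. x \<in> path_image far \<Longrightarrow> y \<in> path_image far \<Longrightarrow> norm (H x y) \<le> B" and "0 \<le> B"
  shows "norm (dcoeff H (n, m)) \<le> 64 * B * ((1 / R) ^ n * (1 / R) ^ m)"
proof -
  have "norm (dint H (- int n - 1) (- int m - 1)) \<le> 64 * B * (R powi (- int n - 1) * R powi (- int m - 1))"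
    by (rule dint_bound[OF H B \<open>0 \<le> B\<close>])
  also have "\<dots> \<le> 64 * B * ((1 / R) ^ n * (1 / R) ^ m)"
    using R_bounds \<open>0 \<le> B\<close> by (intro mult_left_mono mult_mono powi_R_le) auto
  finally show ?thesis unfolding dcoeff_def prod.case by (rule norm_div_two_pi_le)
qed

lemma dcoeff_cong:
  assumes "\<And>x y. x \<in> path_image far \<Longrightarrow> y \<in> path_image far \<Longrightarrow> H x y = H' x y"
  shows "dcoeff H = dcoeff H'"
proof -
  have "dint H e f = dint H' e f" for e f
    unfolding dint_def by (intro contour_integral_far_cong arg_cong2[of _ _ _ _ "(*)"] refl) (use assms in auto)
  thus ?thesis by (simp add: dcoeff_def)
qed

text \<open>In the product of a power series whose coefficients are truncated Cauchy integrals of \<open>H\<close>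
  with a polynomial, the terms missing from the truncated Cauchy integrals of \<open>H\<close> times the
  polynomial contain a nonnegative power of one variable.  There the integrand is holomorphic
  inside, so the contour can be moved to the small bump around \<open>1\<close>, where \<open>H\<close> is small.\<close>

lemma conv2_dcoeff:
  assumes H: "continuous_on (path_image far \<times> path_image far) (\<lambda>(x, y). H x y)"
    and hol: "\<And>y. y \<in> path_image far \<Longrightarrow> (\<lambda>x. H x y) holomorphic_on domain"
      "\<And>x. x \<in> path_image far \<Longrightarrow> H x holomorphic_on domain"
    and B: "\<And>x y. x \<in> near_set \<inter> domain \<Longrightarrow> y \<in> path_image far \<Longrightarrow> norm (H x y) \<le> B"
      "\<And>x y. x \<in> path_image far \<Longrightarrow> y \<in> near_set \<inter> domain \<Longrightarrow> norm (H x y) \<le> B" "0 \<le> B"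
    and p: "\<And>q. q \<notin> {..<N} \<times> {..<N} \<Longrightarrow> p q = 0"
  shows "norm (conv2 p (dcoeff H) (n, m) -
      dcoeff (\<lambda>x y. H x y * (\<Sum>(k, l)\<in>{..<N} \<times> {..<N}. p (k, l) * x ^ k * y ^ l)) (n, m)) \<le>
    (\<Sum>q\<in>{..<N} \<times> {..<N}. norm (p q)) * (64 * B * R ^ (2 * N)) * ((1 / R) ^ n * (1 / R) ^ m)"
proof -
  define Bx where "Bx = {..<N} \<times> {..<N}"
  define J where "J = (\<lambda>(k, l). dint H (int k - int n - 1) (int l - int m - 1))"
  define S where "S = {..n} \<times> {..m}"
  define c where "c = (2 * of_real pi * \<i>)\<^sup>2"
  have H': "continuous_on (path_image far \<times> path_image far) (\<lambda>(x, y). c * (x ^ k * y ^ l * H x y))" for c k l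
  proof -
    have "continuous_on (path_image far \<times> path_image far)
        (\<lambda>q. c * (fst q ^ k * snd q ^ l * (case q of (x, y) \<Rightarrow> H x y)))"
      by (intro continuous_intros H)
    thus ?thesis by (simp add: case_prod_unfold)
  qed
  have "dcoeff (\<lambda>x y. H x y * (\<Sum>(k, l)\<in>Bx. p (k, l) * x ^ k * y ^ l)) (n, m) =
      dint (\<lambda>x y. \<Sum>q\<in>Bx. p q * (x ^ fst q * y ^ snd q * H x y)) (- int n - 1) (- int m - 1) / c"
    unfolding dcoeff_def prod.case c_def
    by (simp add: sum_distrib_left case_prod_unfold mult_ac)
  also have "dint (\<lambda>x y. \<Sum>q\<in>Bx. p q * (x ^ fst q * y ^ snd q * H x y)) (- int n - 1) (- int m - 1) =
      (\<Sum>q\<in>Bx. dint (\<lambda>x y. p q * (x ^ fst q * y ^ snd q * H x y)) (- int n - 1) (- int m - 1))"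
    by (rule dint_sum) (simp_all only: Bx_def finite_cartesian_product finite_lessThan H')
  also have "\<dots> = (\<Sum>q\<in>Bx. p q * J q)"
    unfolding dint_cmult[OF H]
  proof (intro sum.cong refl arg_cong2[of _ _ _ _ "(*)"])
    fix q :: "nat \<times> nat"
    have "- int n - 1 + int (fst q) = int (fst q) - int n - 1"
      "- int m - 1 + int (snd q) = int (snd q) - int m - 1" by simp_all
    thus "dint H (- int n - 1 + int (fst q)) (- int m - 1 + int (snd q)) = J q"
      by (simp only: J_def case_prod_unfold)
  qed
  finally have d: "dcoeff (\<lambda>x y. H x y * (\<Sum>(k, l)\<in>Bx. p (k, l) * x ^ k * y ^ l)) (n, m) =
      (\<Sum>q\<in>Bx. p q * J q) / c" .
  have "conv2 p (dcoeff H) (n, m) = (\<Sum>q\<in>S. p q * dcoeff H (n - fst q, m - snd q))"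
    unfolding conv2_def S_def prod.case sum.cartesian_product by (simp add: case_prod_unfold)
  also have "\<dots> = (\<Sum>q\<in>S. p q * (J q / c))"
  proof (intro sum.cong refl arg_cong2[of _ _ _ _ "(*)"])
    fix q assume "q \<in> S"
    hence "- int (n - fst q) - 1 = int (fst q) - int n - 1" "- int (m - snd q) - 1 = int (snd q) - int m - 1"
      by (auto simp: S_def)
    thus "dcoeff H (n - fst q, m - snd q) = J q / c"
      by (simp only: dcoeff_def J_def case_prod_unfold fst_conv snd_conv c_def)
  qed
  also have "\<dots> = (\<Sum>q\<in>S \<inter> Bx. p q * (J q / c))"
    by (rule sum.mono_neutral_right) (auto simp: S_def Bx_def intro: p)
  also have "\<dots> = (\<Sum>q\<in>Bx \<inter> S. p q * J q) / c"
    by (simp add: sum_divide_distrib Int_commute)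
  finally have e: "conv2 p (dcoeff H) (n, m) = (\<Sum>q\<in>Bx \<inter> S. p q * J q) / c" .
  \<comment> \<open>Both sides add up the same terms \<open>p q * J q\<close>. The Cauchy product
    stops at the index \<open>(n, m)\<close>, so the discrepancy consists of the \<open>q\<close> in
    the box that lie outside \<open>S\<close>.\<close>
  have "(\<Sum>q\<in>Bx. p q * J q) = (\<Sum>q\<in>Bx \<inter> S. p q * J q) + (\<Sum>q\<in>Bx - S. p q * J q)"
    using sum.Int_Diff[of Bx "\<lambda>q. p q * J q" S] by (simp add: Bx_def)
  hence eq: "conv2 p (dcoeff H) (n, m) -
      dcoeff (\<lambda>x y. H x y * (\<Sum>(k, l)\<in>Bx. p (k, l) * x ^ k * y ^ l)) (n, m) =
      (- (\<Sum>q\<in>Bx - S. p q * J q)) / c"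
    unfolding d e by (simp add: diff_divide_distrib add_divide_distrib)
  have J: "norm (J q) \<le> 64 * B * R ^ (2 * N) * ((1 / R) ^ n * (1 / R) ^ m)" if "q \<in> Bx - S" for q
  proof -
    obtain k l where q: "q = (k, l)" by (cases q)
    \<comment> \<open>Outside \<open>S\<close> one of the inequalities is strict, so one of the
      exponents \<open>k - n - 1\<close> and \<open>l - m - 1\<close> is nonnegative in spite of the
      -1 of the Cauchy kernel.\<close>
    have kl: "k < N" "l < N" "n < k \<or> m < l" using that by (auto simp: q Bx_def S_def)
    have pw: "R powi (int i - int j - 1) \<le> R ^ N * (1 / R) ^ j" if "i < N" for i j
    proof -
      have "R powi (int i - int j - 1) = R ^ i * R powi (- int j - 1)"
        using R_bounds power_int_add[of R "int i" "- int j - 1"] by (simp add: power_int_of_nat algebra_simps)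
      also have "\<dots> \<le> R ^ N * (1 / R) ^ j"
        using R_bounds that by (intro mult_mono powi_R_le power_increasing) auto
      finally show ?thesis .
    qed
    have "norm (J q) \<le> 64 * B * (R powi (int k - int n - 1) * R powi (int l - int m - 1))"
      using kl(3)
    proof
      assume "n < k"
      thus ?thesis unfolding q J_def prod.case
        by (intro dint_small_left H hol B) auto
    next
      assume "m < l"
      thus ?thesis unfolding q J_def prod.case
        by (intro dint_small_right H hol B) auto
    qed
    also have "\<dots> \<le> 64 * B * ((R ^ N * (1 / R) ^ n) * (R ^ N * (1 / R) ^ m))"
      using B(3) R_bounds by (intro mult_left_mono mult_mono pw kl) auto
    also have "\<dots> = 64 * B * R ^ (2 * N) * ((1 / R) ^ n * (1 / R) ^ m)"
    proof -
      have "R ^ (2 * N) = R ^ N * R ^ N" by (simp only: mult_2 power_add)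
      thus ?thesis by (simp only: mult_ac)
    qed
    finally show ?thesis .
  qed
  have "norm (- (\<Sum>q\<in>Bx - S. p q * J q)) \<le>
      (\<Sum>q\<in>Bx - S. norm (p q) * (64 * B * R ^ (2 * N) * ((1 / R) ^ n * (1 / R) ^ m)))"
    unfolding norm_minus_cancel
    by (intro sum_norm_le) (auto simp: norm_mult intro!: mult_left_mono J)
  also have "\<dots> \<le> (\<Sum>q\<in>Bx. norm (p q) * (64 * B * R ^ (2 * N) * ((1 / R) ^ n * (1 / R) ^ m)))"
    using B(3) R_bounds by (intro sum_mono2) (auto simp: Bx_def)
  also have "\<dots> = (\<Sum>q\<in>Bx. norm (p q)) * (64 * B * R ^ (2 * N)) * ((1 / R) ^ n * (1 / R) ^ m)"
    by (simp only: sum_distrib_right mult.assoc)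
  finally show ?thesis
    unfolding Bx_def[symmetric] eq c_def by (rule norm_div_two_pi_le)
qed

end

section \<open>A finite Neumann series and the powers of the remainder\<close>

text \<open>If \<open>Y i\<close> were exactly \<open>Y 0 / P ^ i\<close>, the sum would be the
  geometric series of \<open>Y 0 / (P + g)\<close> cut after \<open>n\<close> terms. The recursion
  \<open>P * Y (Suc i) = Y i\<close> holds only up to the defect \<open>\<rho> i\<close>, and the
  defects are carried along with the coefficients of the series.\<close>

lemma telescoping_inverse:
  fixes f P y0 :: "'a::comm_ring_1"
  assumes "f = P + g" "\<And>i. i < n \<Longrightarrow> \<rho> i = P * Y (Suc i) - Y i"
  shows "f * (\<Sum>i<n. (- g) ^ i * Y (Suc i)) = Y 0 - (- g) ^ n * Y n + (\<Sum>i<n. (- g) ^ i * \<rho> i)"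
  using assms(2)
proof (induction n)
  case (Suc n)
  have IH: "f * (\<Sum>i<n. (- g) ^ i * Y (Suc i)) = Y 0 - (- g) ^ n * Y n + (\<Sum>i<n. (- g) ^ i * \<rho> i)"
    using Suc by simp
  have "f * ((- g) ^ n * Y (Suc n)) = (- g) ^ n * (P * Y (Suc n)) - (- g) ^ Suc n * Y (Suc n)"
    unfolding assms(1) by (simp add: algebra_simps)
  also have "P * Y (Suc n) = \<rho> n + Y n" using Suc.prems[of n] by simp
  finally show ?case
    by (simp add: distrib_left IH del: power_Suc)
qed simp

text \<open>Subadditivity hands each weight to a single factor. So in a power of \<open>g\<close>
  one factor (for one weight) or at most two (for both) are charged the large norm \<open>A\<close>,
  and the others the small unweighted norm \<open>q\<close>. The factors in front count the choices:
  the exponent for one weight, its square for both.\<close>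

lemma wiener_norm_power_le:
  assumes g: "g \<in> wiener_class \<alpha> \<beta>" and ab: "0 \<le> \<alpha>" "\<alpha> \<le> 1" "0 \<le> \<beta>" "\<beta> \<le> 1"
    and A: "wiener_norm \<alpha> \<beta> g \<le> A" and q: "wiener_norm 0 0 g \<le> q" "q \<le> A"
  shows "(\<lambda>p. g p ^ Suc n) \<in> wiener_class \<alpha> \<beta> \<and> wiener_norm 0 0 (\<lambda>p. g p ^ Suc n) \<le> q ^ Suc n \<and>
    wiener_norm \<alpha> 0 (\<lambda>p. g p ^ Suc n) \<le> real (Suc n) * A * q ^ n \<and>
    wiener_norm 0 \<beta> (\<lambda>p. g p ^ Suc n) \<le> real (Suc n) * A * q ^ n \<and>
    wiener_norm \<alpha> \<beta> (\<lambda>p. g p ^ Suc (Suc n)) \<le> real (Suc (Suc n)) ^ 2 * A ^ 2 * q ^ n"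
proof -
  have q0: "0 \<le> q" using order.trans[OF wiener_norm_nonneg q(1)] .
  have A0: "0 \<le> A" using q0 q by simp
  have Aa: "wiener_norm \<alpha> 0 g \<le> A" and Ab: "wiener_norm 0 \<beta> g \<le> A"
    using wiener_class_mono(2)[OF g, of \<alpha> 0] wiener_class_mono(2)[OF g, of 0 \<beta>] ab A by linarith+
  have sub: "h \<in> wiener_class \<alpha>' \<beta>'" if "h \<in> wiener_class \<alpha> \<beta>" "\<alpha>' \<in> {0, \<alpha>}" "\<beta>' \<in> {0, \<beta>}" for h \<alpha>' \<beta>'
    by (rule wiener_class_mono(1)[OF that(1)]) (use that ab in auto)
  have mem: "(\<lambda>p. g p ^ n) \<in> wiener_class \<alpha> \<beta>" for n
    by (rule wiener_class_power[OF g]) (use ab in auto)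
  have n0: "wiener_norm 0 0 (\<lambda>p. g p ^ Suc n) \<le> q ^ Suc n" for n
  proof (induction n)
    case (Suc n)
    have "wiener_norm 0 0 (\<lambda>p. g p * g p ^ Suc n) \<le> wiener_norm 0 0 g * wiener_norm 0 0 (\<lambda>p. g p ^ Suc n)"
      by (rule wiener_class_mult(2)[OF sub[OF g] sub[OF mem]]) auto
    also have "\<dots> \<le> q * q ^ Suc n"
      by (intro mult_mono q Suc) (use q0 in auto)
    finally show ?case by simp
  qed (use q in simp)
  have one: "wiener_norm \<alpha>' \<beta>' (\<lambda>p. g p ^ Suc n) \<le> real (Suc n) * A * q ^ n"
    if "(\<alpha>', \<beta>') = (\<alpha>, 0) \<or> (\<alpha>', \<beta>') = (0, \<beta>)" for n \<alpha>' \<beta>'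
  proof (induction n)
    case 0
    show ?case using that Aa Ab by auto
  next
    case (Suc n)
    let ?h = "\<lambda>p. g p ^ Suc n"
    have gA: "wiener_norm \<alpha>' \<beta>' g \<le> A" using that Aa Ab by auto
    have "wiener_norm \<alpha>' \<beta>' (\<lambda>p. g p * ?h p) \<le> wiener_norm \<alpha>' \<beta>' g * wiener_norm 0 0 ?h +
        wiener_norm 0 0 g * wiener_norm \<alpha>' \<beta>' ?h"
      using that
    proof
      assume "(\<alpha>', \<beta>') = (\<alpha>, 0)"
      thus ?thesis
        using wiener_norm_mult_le_fst[OF sub[OF g] sub[OF mem], of \<alpha>] ab by (simp del: power_Suc)
    next
      assume "(\<alpha>', \<beta>') = (0, \<beta>)"
      thus ?thesis
        using wiener_norm_mult_le_snd[OF sub[OF g] sub[OF mem], of \<beta>] ab by (simp del: power_Suc)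
    qed
    also have "\<dots> \<le> A * q ^ Suc n + q * (real (Suc n) * A * q ^ n)"
      by (intro add_mono mult_mono gA n0 q Suc) (use A0 q0 in auto)
    also have "\<dots> = real (Suc (Suc n)) * A * q ^ Suc n" by (simp add: algebra_simps)
    finally show ?case by simp
  qed
  have two: "wiener_norm \<alpha> \<beta> (\<lambda>p. g p ^ Suc (Suc n)) \<le> real (Suc (Suc n)) ^ 2 * A ^ 2 * q ^ n" for n
  proof (induction n)
    case 0
    have "wiener_norm \<alpha> \<beta> (\<lambda>p. g p * g p) \<le> wiener_norm \<alpha> \<beta> g * wiener_norm \<alpha> \<beta> g"
      by (rule wiener_class_mult(2)[OF g g]) (use ab in auto)
    also have "\<dots> \<le> A * A" by (intro mult_mono A) (use A0 in auto)
    also have "\<dots> \<le> 4 * (A * A)" using A0 by simp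
    finally show ?case by (simp add: power2_eq_square)
  next
    case (Suc n)
    let ?h = "\<lambda>p. g p ^ Suc (Suc n)"
    have "wiener_norm \<alpha> \<beta> (\<lambda>p. g p * ?h p) \<le>
      wiener_norm \<alpha> \<beta> g * wiener_norm 0 0 ?h + wiener_norm \<alpha> 0 g * wiener_norm 0 \<beta> ?h +
      wiener_norm 0 \<beta> g * wiener_norm \<alpha> 0 ?h + wiener_norm 0 0 g * wiener_norm \<alpha> \<beta> ?h"
      by (rule wiener_norm_mult_le[OF g mem ab])
    also have "\<dots> \<le> A * (A * q ^ Suc n) + A * (real (Suc (Suc n)) * A * q ^ Suc n) +
      A * (real (Suc (Suc n)) * A * q ^ Suc n) + q * (real (Suc (Suc n)) ^ 2 * A ^ 2 * q ^ n)"
    proof (intro add_mono)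
      \<comment> \<open>When one factor carries both weights, all the others are small. One of them
        is estimated by \<open>A\<close> to reach the common form
        \<open>A ^ 2 * q ^ Suc n\<close>.\<close>
      have "q * q ^ Suc n \<le> A * q ^ Suc n"
        using q q0 by (intro mult_right_mono) auto
      hence "wiener_norm 0 0 ?h \<le> A * q ^ Suc n"
        using n0[of "Suc n"] by simp
      thus "wiener_norm \<alpha> \<beta> g * wiener_norm 0 0 ?h \<le> A * (A * q ^ Suc n)"
        by (rule mult_mono[OF A]) (use A0 in auto)
      show "wiener_norm \<alpha> 0 g * wiener_norm 0 \<beta> ?h \<le> A * (real (Suc (Suc n)) * A * q ^ Suc n)"
        by (rule mult_mono[OF Aa one]) (use A0 in auto)
      show "wiener_norm 0 \<beta> g * wiener_norm \<alpha> 0 ?h \<le> A * (real (Suc (Suc n)) * A * q ^ Suc n)"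
        by (rule mult_mono[OF Ab one]) (use A0 in auto)
      show "wiener_norm 0 0 g * wiener_norm \<alpha> \<beta> ?h \<le> q * (real (Suc (Suc n)) ^ 2 * A ^ 2 * q ^ n)"
        by (rule mult_mono[OF q(1) Suc]) (use q0 in auto)
    qed
    \<comment> \<open>With \<open>k = n + 2\<close>, the four terms combine by
      \<open>1 + 2 * k + k ^ 2 = (k + 1) ^ 2\<close>.\<close>
    also have "\<dots> = real (Suc (Suc (Suc n))) ^ 2 * A ^ 2 * q ^ Suc n"
      by (simp add: algebra_simps power2_eq_square)
    finally show ?case by simp
  qed
  show ?thesis
    by (intro conjI mem n0 two) (rule one, simp)+
qed

section \<open>Approximate division by f\<close>

lemma wiener_norm_power_mult_le:
  assumes "g \<in> wiener_class \<alpha> \<beta>" "h \<in> wiener_class \<alpha> \<beta>" "0 \<le> \<alpha>" "0 \<le> \<beta>"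
    and "wiener_norm \<alpha> \<beta> g \<le> A" "wiener_norm \<alpha> \<beta> h \<le> B"
  shows "wiener_norm \<alpha> \<beta> (\<lambda>p. g p ^ i * h p) \<le> A ^ i * B"
proof (induction i)
  case (Suc i)
  have A0: "0 \<le> A" using order.trans[OF wiener_norm_nonneg assms(5)] .
  have "wiener_norm \<alpha> \<beta> (\<lambda>p. g p * (g p ^ i * h p)) \<le> wiener_norm \<alpha> \<beta> g * wiener_norm \<alpha> \<beta> (\<lambda>p. g p ^ i * h p)"
    by (rule wiener_class_mult(2)) (use assms in \<open>auto intro: wiener_class_mult wiener_class_power\<close>)
  also have "\<dots> \<le> A * (A ^ i * B)"
    by (intro mult_mono assms Suc) (use A0 in auto)
  finally show ?case by (simp add: mult.assoc)
qed (use assms in simp)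

lemma wiener_norm_tail_le_norm:
  assumes f: "f \<in> wiener_class \<alpha> \<beta>"
  shows "wiener_norm \<alpha> \<beta> (\<lambda>p. f p - truncation N f p) \<le> wiener_norm \<alpha> \<beta> f"
proof (rule wiener_norm_le(2)[OF expands2_tail[OF f]])
  show "((\<lambda>p. norm (coeff2 f p) * wiener_weight \<alpha> \<beta> p) has_sum wiener_norm \<alpha> \<beta> f) UNIV"
    unfolding wiener_norm_def by (rule has_sum_infsum[OF wiener_classD(2)[OF f]])
qed auto

lemma sum_norm_coeff2_le:
  assumes f: "f \<in> wiener_class \<alpha> \<beta>" and "finite X" "0 \<le> \<alpha>" "0 \<le> \<beta>"
  shows "(\<Sum>p\<in>X. norm (coeff2 f p)) \<le> wiener_norm \<alpha> \<beta> f"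
proof -
  have "(\<Sum>p\<in>X. norm (coeff2 f p)) \<le> (\<Sum>p\<in>X. norm (coeff2 f p) * wiener_weight \<alpha> \<beta> p)"
    using mult_left_mono[OF wiener_weight_ge_1[OF assms(3,4)] norm_ge_zero] by (intro sum_mono) simp
  also have "\<dots> \<le> wiener_norm \<alpha> \<beta> f"
    unfolding wiener_norm_def by (rule finite_sum_le_infsum[OF wiener_classD(2)[OF f] assms(2)]) auto
  finally show ?thesis .
qed

lemma expands2_damp:
  assumes "0 < s"
  shows "expands2 (\<lambda>p. damp \<kappa> s (fst p) * damp \<kappa> s (snd p)) (\<lambda>(n, m). damp_coeff \<kappa> s n * damp_coeff \<kappa> s m)"
proof -
  have "damp \<kappa> s holomorphic_on ball 0 1"
  proof (rule holomorphic_on_subset[OF damp_holomorphic])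
    show "ball 0 1 \<subseteq> {z. Re z < 1 + s}"
    proof
      fix z :: complex assume "z \<in> ball 0 1"
      thus "z \<in> {z. Re z < 1 + s}" using complex_Re_le_cmod[of z] assms by auto
    qed
  qed
  from expands2_tensor[OF taylor_has_sum[OF this] taylor_has_sum[OF this]]
  show ?thesis by (simp add: damp_coeff_def case_prod_unfold)
qed

context keyhole
begin

lemma dcoeff_damp:
  "dcoeff (\<lambda>x y. damp \<kappa> s x * damp \<kappa> s y) (n, m) = far_coeff \<kappa> n * far_coeff \<kappa> m"
proof -
  define I where "I = (\<lambda>n. contour_integral far (\<lambda>x. x powi (- int n - 1) * damp \<kappa> s x))"
  have c: "(\<lambda>x. x powi e * damp \<kappa> s x) contour_integrable_on far" for e
    by (intro contour_integrable_far continuous_on_mult continuous_powi_far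
          continuous_on_subset[OF holomorphic_on_imp_continuous_on[OF damp_holomorphic_domain]])
        (auto intro: far_image)
  have "contour_integral far (\<lambda>y. y powi (- int m - 1) * (damp \<kappa> s x * damp \<kappa> s y)) = damp \<kappa> s x * I m" for x
    using contour_integral_lmul[OF c[of "- int m - 1"], of "damp \<kappa> s x"] by (simp add: I_def mult_ac)
  hence "dint (\<lambda>x y. damp \<kappa> s x * damp \<kappa> s y) (- int n - 1) (- int m - 1) =
      contour_integral far (\<lambda>x. x powi (- int n - 1) * damp \<kappa> s x * I m)"
    unfolding dint_def by (simp add: mult.assoc)
  also have "\<dots> = I n * I m"
    using contour_integral_rmul[OF c[of "- int n - 1"], of "I m"] by (simp add: I_def)
  finally show ?thesis
    by (simp add: dcoeff_def far_coeff_def I_def power2_eq_square)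
qed

text \<open>Three errors add up. \<open>Y 0\<close> differs from the damped function by the omitted
  arcs, which costs \<open>221 * T\<close>. The Neumann series ends after \<open>j + 2\<close> terms
  and leaves a power of the remainder in which two factors are charged \<open>A\<close> and
  \<open>j\<close> factors \<open>q\<close>. The recursion of the \<open>Y i\<close> has defects
  proportional to \<open>T\<close>. The common factor is the norm of geometric coefficients with
  ratio \<open>1 / R\<close>; the constants are 419904 = 64 * 81^2 and 5184 = 64 * 81.\<close>

lemma approximation_bound:
  fixes f :: "complex \<times> complex \<Rightarrow> complex"
  assumes f: "f \<in> wiener_class \<alpha> \<beta>" and ab: "0 \<le> \<alpha>" "\<alpha> \<le> 1" "0 \<le> \<beta>" "\<beta> \<le> 1" and "0 \<le> \<kappa>"
    and A: "wiener_norm \<alpha> \<beta> f \<le> A" "1 \<le> A"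
    and nu: "0 < \<nu>" "\<nu> \<le> 1" "\<And>x y. x \<in> domain \<Longrightarrow> y \<in> domain \<Longrightarrow> \<nu> \<le> norm (truncation N f (x, y))"
    and q: "wiener_norm 0 0 (\<lambda>p. f p - truncation N f p) \<le> q" "q \<le> A"
  defines "T \<equiv> exp (- (\<kappa> / (50 * s)))"
  shows "\<exists>y\<in>wiener_class \<alpha> \<beta>.
    wiener_norm \<alpha> \<beta> (\<lambda>p. damp \<kappa> s (fst p) * damp \<kappa> s (snd p) - f p * y p) \<le>
    (1 / (1 - 1 / R)\<^sup>2)\<^sup>2 * (221 * T + real (j + 2) ^ 2 * A ^ 2 * q ^ j * (419904 / \<nu> ^ (j + 2)) +
      real (j + 2) * (A ^ (j + 3) * (5184 * R ^ (2 * N) * T / \<nu> ^ (j + 2))))"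
proof -
  define P where "P = truncation N f"
  define g where "g = (\<lambda>p. f p - P p)"
  define CW where "CW = (1 / (1 - 1 / R)\<^sup>2)\<^sup>2"
  define H where "H = (\<lambda>i x y. damp \<kappa> s x * damp \<kappa> s y / P (x, y) ^ i)"
  define pc where "pc = (\<lambda>p. if p \<in> {..<N} \<times> {..<N} then coeff2 f p else 0)"
  define r where "r = 1 / R"
  have r: "0 \<le> r" "r < 1" using R_bounds by (auto simp: r_def)
  have A0: "0 \<le> A" using A by simp
  have T: "0 < T" "T \<le> 1" using \<open>0 \<le> \<kappa>\<close> s_pos by (auto simp: T_def)
  have CW0: "0 \<le> CW" by (simp add: CW_def)
  have q0: "0 \<le> q" using order.trans[OF wiener_norm_nonneg q(1)] .
  have P0: "P (x, y) \<noteq> 0" if "x \<in> domain" "y \<in> domain" for x y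
    using nu(1) nu(3)[OF that] by (auto simp: P_def)
  have P_eq: "P (x, y) = (\<Sum>(k, l)\<in>{..<N} \<times> {..<N}. pc (k, l) * x ^ k * y ^ l)" for x y
    unfolding P_def truncation_def pc_def by (auto intro!: sum.cong)
  have dc: "continuous_on domain (damp \<kappa> s)"
    by (rule holomorphic_on_imp_continuous_on[OF damp_holomorphic_domain])
  have Pc: "continuous_on S P" for S
    unfolding P_def truncation_def case_prod_unfold by (intro continuous_intros)
  have "continuous_on (domain \<times> domain) (\<lambda>z. damp \<kappa> s (fst z) * damp \<kappa> s (snd z) / P z ^ i)" for i
    by (intro continuous_intros Pc continuous_on_compose2[OF dc]) (use P0 in auto)
  hence "continuous_on (domain \<times> domain) (\<lambda>(x, y). H i x y)" for i
    by (simp add: H_def case_prod_unfold)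
  hence Hc: "continuous_on (path_image far \<times> path_image far) (\<lambda>(x, y). H i x y)" for i
    by (rule continuous_on_subset) (auto intro: far_image)
  have Ph1: "(\<lambda>x. P (x, y)) holomorphic_on S" and Ph2: "(\<lambda>x. P (y, x)) holomorphic_on S" for y S
    unfolding P_eq case_prod_unfold by (intro holomorphic_intros)+
  have Hh1: "(\<lambda>x. H i x y) holomorphic_on domain" if "y \<in> path_image far" for i y
    unfolding H_def by (intro holomorphic_intros damp_holomorphic_domain Ph1) (use P0 far_image(2)[OF that] in auto)
  have Hh2: "H i x holomorphic_on domain" if "x \<in> path_image far" for i x
    unfolding H_def by (intro holomorphic_intros damp_holomorphic_domain Ph2) (use P0 far_image(2)[OF that] in auto)
  have Hb: "norm (H i x y) \<le> b * c / \<nu> ^ i"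
    if "x \<in> domain" "y \<in> domain" "norm (damp \<kappa> s x) \<le> b" "norm (damp \<kappa> s y) \<le> c" for i x y b c
  proof -
    have b: "0 \<le> b" "0 \<le> b * c"
      using order.trans[OF norm_ge_zero that(3)] order.trans[OF norm_ge_zero that(4)] by simp_all
    show ?thesis
      unfolding H_def norm_divide norm_mult norm_power
      using that b nu by (intro frac_le mult_mono power_mono) (auto simp: P_def)
  qed
  have Hb1: "norm (H i x y) \<le> 6561 / \<nu> ^ i" if "x \<in> path_image far" "y \<in> path_image far" for i x y
    using Hb[of x y 81 81 i] that far_image(2) damp_in_domain[OF _ \<open>0 \<le> \<kappa>\<close>] by simp
  have Hb2: "norm (H i x y) \<le> 81 * T / \<nu> ^ i" if "x \<in> near_set \<inter> domain" "y \<in> path_image far" for i x y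
    using Hb[of x y T 81 i] that far_image(2) damp_in_domain[OF _ \<open>0 \<le> \<kappa>\<close>]
      damp_in_near[OF _ \<open>0 \<le> \<kappa>\<close>] by (simp add: T_def mult.commute)
  have Hb3: "norm (H i x y) \<le> 81 * T / \<nu> ^ i" if "x \<in> path_image far" "y \<in> near_set \<inter> domain" for i x y
    using Hb[of x y 81 T i] that far_image(2) damp_in_domain[OF _ \<open>0 \<le> \<kappa>\<close>]
      damp_in_near[OF _ \<open>0 \<le> \<kappa>\<close>] by (simp add: T_def)
  have dH: "norm (dcoeff (H i) (n, m)) \<le> 64 * (6561 / \<nu> ^ i) * (r ^ n * r ^ m)" for i n m
    unfolding r_def by (rule norm_dcoeff_le[OF Hc Hb1]) (use nu in auto)
  have "\<exists>F. expands2 F (dcoeff (H i))" for i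
  proof -
    obtain F where "expands2 F (dcoeff (H i))"
      by (rule geometric_coeff_obtain[OF r dH]) (use nu in auto)
    thus ?thesis by blast
  qed
  then obtain Y where Y: "\<And>i. expands2 (Y i) (dcoeff (H i))" by metis
  have Yc: "Y i \<in> wiener_class \<alpha> \<beta>" and Yn: "wiener_norm \<alpha> \<beta> (Y i) \<le> 64 * (6561 / \<nu> ^ i) * CW" for i
    using geometric_coeff_norm_le[OF r dH Y[of i] ab(2,4)] nu by (auto simp: CW_def r_def)
  define E where "E = (\<lambda>p. damp \<kappa> s (fst p) * damp \<kappa> s (snd p))"
  have H0: "dcoeff (H 0) (n, m) = far_coeff \<kappa> n * far_coeff \<kappa> m" for n m
    using dcoeff_damp[of \<kappa> n m] by (simp add: H_def)
  \<comment> \<open>An exact coefficient exceeds the one over the arc by at most 1 in the constant,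
    which gives 111; telescoping the product of two coefficients then gives 111 + 110 = 221.\<close>
  have "norm ((case (n, m) of (n, m) \<Rightarrow> damp_coeff \<kappa> s n * damp_coeff \<kappa> s m) - dcoeff (H 0) (n, m)) \<le> 221 * T * (r ^ n * r ^ m)" for n m
  proof -
    let ?G = "damp_coeff \<kappa> s" and ?F = "far_coeff \<kappa>"
    have d: "norm (?G n - ?F n) \<le> T * r ^ n" for n
      unfolding T_def r_def by (rule damp_coeff_far_coeff[OF \<open>0 \<le> \<kappa>\<close>])
    have F: "norm (?F n) \<le> 110 * r ^ n" for n
      unfolding r_def by (rule norm_far_coeff_le[OF \<open>0 \<le> \<kappa>\<close>])
    have "T * r ^ m \<le> 1 * r ^ m" using T r by (intro mult_right_mono) auto
    hence G: "norm (?G m) \<le> 111 * r ^ m"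
      using norm_triangle_sub[of "?G m" "?F m"] d[of m] F[of m] by linarith
    have "?G n * ?G m - ?F n * ?F m = (?G n - ?F n) * ?G m + ?F n * (?G m - ?F m)"
      by (simp add: algebra_simps)
    hence "norm (?G n * ?G m - ?F n * ?F m) \<le> norm (?G n - ?F n) * norm (?G m) + norm (?F n) * norm (?G m - ?F m)"
      by (metis norm_mult norm_triangle_ineq)
    also have "\<dots> \<le> (T * r ^ n) * (111 * r ^ m) + (110 * r ^ n) * (T * r ^ m)"
      using T r by (intro add_mono mult_mono d F G) auto
    finally show ?thesis by (simp add: H0 mult_ac)
  qed
  from geometric_coeff_norm_le[OF r this expands2_diff[OF expands2_damp[OF s_pos] Y[of 0]] ab(2,4)] T
  have EY: "(\<lambda>p. E p - Y 0 p) \<in> wiener_class \<alpha> \<beta>" "wiener_norm \<alpha> \<beta> (\<lambda>p. E p - Y 0 p) \<le> 221 * T * CW"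
    by (auto simp: E_def CW_def r_def)
  define \<rho> where "\<rho> = (\<lambda>i p. P p * Y (Suc i) p - Y i p)"
  have "\<rho> i \<in> wiener_class \<alpha> \<beta> \<and> wiener_norm \<alpha> \<beta> (\<rho> i) \<le> A * (64 * (81 * T / \<nu> ^ Suc i) * R ^ (2 * N)) * CW" for i
  proof -
    \<comment> \<open>On the arcs \<open>H (Suc i)\<close> times \<open>P\<close> is
      \<open>H i\<close>. Hence the defect is the difference between multiplying after and before
      taking Cauchy coefficients, which is what \<open>conv2_dcoeff\<close> estimates.\<close>
    have eq: "dcoeff (H i) = dcoeff (\<lambda>x y. H (Suc i) x y * (\<Sum>(k, l)\<in>{..<N} \<times> {..<N}. pc (k, l) * x ^ k * y ^ l))"
      by (rule dcoeff_cong) (use P0 far_image(2) in \<open>auto simp: H_def P_eq[symmetric]\<close>)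
    have e: "expands2 (\<rho> i) (\<lambda>p. conv2 pc (dcoeff (H (Suc i))) p - dcoeff (H i) p)"
      unfolding \<rho>_def P_def pc_def by (intro expands2_diff expands2_mult expands2_truncation Y)
    have b: "norm (conv2 pc (dcoeff (H (Suc i))) (n, m) - dcoeff (H i) (n, m)) \<le>
        A * (64 * (81 * T / \<nu> ^ Suc i) * R ^ (2 * N)) * (r ^ n * r ^ m)" for n m
    proof -
      have "norm (conv2 pc (dcoeff (H (Suc i))) (n, m) - dcoeff (H i) (n, m)) \<le>
        (\<Sum>q\<in>{..<N} \<times> {..<N}. norm (pc q)) * (64 * (81 * T / \<nu> ^ Suc i) * R ^ (2 * N)) * ((1 / R) ^ n * (1 / R) ^ m)"
        unfolding eq by (rule conv2_dcoeff[OF Hc Hh1 Hh2 Hb2 Hb3])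
          (use nu T in \<open>auto simp: pc_def\<close>)
      also have "\<dots> \<le> A * (64 * (81 * T / \<nu> ^ Suc i) * R ^ (2 * N)) * (r ^ n * r ^ m)"
        unfolding r_def
      proof (intro mult_right_mono)
        have "(\<Sum>q\<in>{..<N} \<times> {..<N}. norm (pc q)) = (\<Sum>q\<in>{..<N} \<times> {..<N}. norm (coeff2 f q))"
          by (intro sum.cong) (auto simp: pc_def)
        also have "\<dots> \<le> A" by (rule order.trans[OF sum_norm_coeff2_le[OF f] A(1)]) (use ab in auto)
        finally show "(\<Sum>q\<in>{..<N} \<times> {..<N}. norm (pc q)) \<le> A" .
      qed (use nu T R_bounds in auto)
      finally show ?thesis .
    qed
    have nn: "0 \<le> A * (64 * (81 * T / \<nu> ^ Suc i) * R ^ (2 * N))"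
      using A0 T nu R_bounds by auto
    show ?thesis
      using geometric_coeff_norm_le[OF r b e ab(2,4) nn] unfolding CW_def r_def by blast
  qed
  hence \<rho>c: "\<rho> i \<in> wiener_class \<alpha> \<beta>"
    and \<rho>n: "wiener_norm \<alpha> \<beta> (\<rho> i) \<le> A * (64 * (81 * T / \<nu> ^ Suc i) * R ^ (2 * N)) * CW" for i
    by auto
  define g' where "g' = (\<lambda>p. - g p)"
  have g: "g \<in> wiener_class \<alpha> \<beta>" unfolding g_def P_def by (intro wiener_class_diff f wiener_class_truncation)
  have gA: "wiener_norm \<alpha> \<beta> g \<le> A"
    using wiener_norm_tail_le_norm[OF f, of N] A by (simp add: g_def P_def)
  have g': "g' \<in> wiener_class \<alpha> \<beta>" "wiener_norm \<alpha> \<beta> g' \<le> A"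
    using wiener_class_uminus[OF g] gA by (simp_all add: g'_def)
  have g'q: "wiener_norm 0 0 g' \<le> q"
    using wiener_class_uminus(2)[OF wiener_class_mono(1)[OF g ab(1,3)]] q(1) by (simp add: g'_def g_def P_def)
  define n where "n = j + 2"
  define y where "y = (\<lambda>p. \<Sum>i<n. g' p ^ i * Y (Suc i) p)"
  have y: "y \<in> wiener_class \<alpha> \<beta>"
    unfolding y_def
    by (rule conjunct1[OF wiener_class_sum]) (intro wiener_class_mult wiener_class_power g' Yc ab)
  have eq: "E p - f p * y p = (E p - Y 0 p) + g' p ^ n * Y n p - (\<Sum>i<n. g' p ^ i * \<rho> i p)" for p
    using telescoping_inverse[of "f p" "P p" "g p" n "\<lambda>i. \<rho> i p" "\<lambda>i. Y i p"]
    by (simp add: g_def \<rho>_def y_def g'_def)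
  have c2: "(\<lambda>p. g' p ^ n * Y n p) \<in> wiener_class \<alpha> \<beta>"
    by (intro wiener_class_mult wiener_class_power g' Yc ab)
  have c3: "(\<lambda>p. g' p ^ i * \<rho> i p) \<in> wiener_class \<alpha> \<beta>" for i
    by (intro wiener_class_mult wiener_class_power g' \<rho>c ab)
  have n2: "wiener_norm \<alpha> \<beta> (\<lambda>p. g' p ^ n * Y n p) \<le> (real n ^ 2 * A ^ 2 * q ^ j) * (64 * (6561 / \<nu> ^ n) * CW)"
  proof -
    have "wiener_norm \<alpha> \<beta> (\<lambda>p. g' p ^ n) \<le> real n ^ 2 * A ^ 2 * q ^ j"
      using wiener_norm_power_le[OF g'(1) ab g'(2) g'q q(2), of j] by (simp add: n_def)
    hence "wiener_norm \<alpha> \<beta> (\<lambda>p. g' p ^ n) * wiener_norm \<alpha> \<beta> (Y n) \<le>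
        (real n ^ 2 * A ^ 2 * q ^ j) * (64 * (6561 / \<nu> ^ n) * CW)"
      using q0 by (intro mult_mono Yn) auto
    thus ?thesis
      using wiener_class_mult(2)[OF wiener_class_power[OF g'(1) ab(1,3), of n] Yc[of n] ab(1,3)] by linarith
  qed
  have n3: "wiener_norm \<alpha> \<beta> (\<lambda>p. g' p ^ i * \<rho> i p) \<le> A ^ (n + 1) * (5184 * R ^ (2 * N) * T / \<nu> ^ n) * CW"
    if "i < n" for i
  proof -
    have "wiener_norm \<alpha> \<beta> (\<lambda>p. g' p ^ i * \<rho> i p) \<le> A ^ i * (A * (64 * (81 * T / \<nu> ^ Suc i) * R ^ (2 * N)) * CW)"
      by (rule wiener_norm_power_mult_le[OF g'(1) \<rho>c ab(1,3) g'(2) \<rho>n])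
    also have "\<dots> = A ^ (i + 1) * (5184 * R ^ (2 * N) * T / \<nu> ^ Suc i) * CW"
      by simp
    also have "\<dots> \<le> A ^ (n + 1) * (5184 * R ^ (2 * N) * T / \<nu> ^ n) * CW"
      using A A0 T nu R_bounds CW0 that
      by (intro mult_right_mono mult_mono power_increasing divide_left_mono power_decreasing) auto
    finally show ?thesis .
  qed
  have s3: "(\<lambda>p. \<Sum>i<n. g' p ^ i * \<rho> i p) \<in> wiener_class \<alpha> \<beta>"
    "wiener_norm \<alpha> \<beta> (\<lambda>p. \<Sum>i<n. g' p ^ i * \<rho> i p) \<le> real n * (A ^ (n + 1) * (5184 * R ^ (2 * N) * T / \<nu> ^ n) * CW)"
  proof -
    note s = wiener_class_sum[of "{..<n}" "\<lambda>i p. g' p ^ i * \<rho> i p", OF c3]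
    show "(\<lambda>p. \<Sum>i<n. g' p ^ i * \<rho> i p) \<in> wiener_class \<alpha> \<beta>" using s by blast
    have "(\<Sum>i<n. wiener_norm \<alpha> \<beta> (\<lambda>p. g' p ^ i * \<rho> i p)) \<le>
        real (card {..<n}) * (A ^ (n + 1) * (5184 * R ^ (2 * N) * T / \<nu> ^ n) * CW)"
      by (rule sum_bounded_above) (use n3 in auto)
    thus "wiener_norm \<alpha> \<beta> (\<lambda>p. \<Sum>i<n. g' p ^ i * \<rho> i p) \<le> real n * (A ^ (n + 1) * (5184 * R ^ (2 * N) * T / \<nu> ^ n) * CW)"
      using s by simp
  qed
  have "wiener_norm \<alpha> \<beta> (\<lambda>p. E p - f p * y p) \<le> 221 * T * CW +
      (real n ^ 2 * A ^ 2 * q ^ j) * (64 * (6561 / \<nu> ^ n) * CW) +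
      real n * (A ^ (n + 1) * (5184 * R ^ (2 * N) * T / \<nu> ^ n) * CW)"
    unfolding eq
    using wiener_class_diff(2)[OF wiener_class_add(1)[OF EY(1) c2] s3(1)] wiener_class_add(2)[OF EY(1) c2]
      EY(2) n2 s3(2) by linarith
  also have "\<dots> = CW * (221 * T + real (j + 2) ^ 2 * A ^ 2 * q ^ j * (419904 / \<nu> ^ (j + 2)) +
      real (j + 2) * (A ^ (j + 3) * (5184 * R ^ (2 * N) * T / \<nu> ^ (j + 2))))"
    by (simp add: n_def algebra_simps numeral_3_eq_3)
  finally show ?thesis using y unfolding E_def CW_def by blast
qed

end

section \<open>Lower bounds for f and for its truncation\<close>

text \<open>Points of \<open>domain\<close> may lie outside the closed disc, where \<open>f\<close>
  has no prescribed values. Dividing by \<open>1 + 2 * \<delta>\<close> moves them inside while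
  keeping a distance \<open>s / 8\<close> from 1. There the truncation is within \<open>q\<close> of
  \<open>f\<close>, and moving back changes it little because its degrees are below
  \<open>N\<close>.\<close>

lemma (in keyhole) truncation_lower_bound:
  assumes f: "f \<in> wiener_class \<alpha> \<beta>" and ab: "0 \<le> \<alpha>" "0 \<le> \<beta>" and A: "wiener_norm \<alpha> \<beta> f \<le> A"
    and low: "\<And>x y. norm x < 1 \<Longrightarrow> norm y < 1 \<Longrightarrow> s / 8 \<le> norm (1 - x) \<Longrightarrow> s / 8 \<le> norm (1 - y) \<Longrightarrow>
      \<mu> \<le> norm (f (x, y))"
    and q: "wiener_norm 0 0 (\<lambda>p. f p - truncation N f p) \<le> q"
    and d: "\<delta> \<le> s / 16" "4 * \<delta> * real N \<le> 1" and xy: "x \<in> domain" "y \<in> domain"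
  shows "\<mu> - q - 8 * \<delta> * real N * A \<le> norm (truncation N f (x, y))"
proof -
  define r where "r = 1 + 2 * \<delta>"
  have r: "1 < r" using delta_pos by (simp add: r_def)
  define x' y' where "x' = x / of_real r" and "y' = y / of_real r"
  have scale: "norm (z / of_real r) < 1 \<and> s / 8 \<le> norm (1 - z / of_real r)" if "z \<in> domain" for z
  proof -
    have z: "norm z < r" "s / 4 \<le> norm (1 - z)"
      using that domain_norm_le by (auto simp: domain_def r_def)
    have n: "norm (z / of_real r) < 1" using z r by (simp add: norm_divide)
    have "z - z / of_real r = of_real (r - 1) * (z / of_real r)"
      using r by (simp add: field_simps)
    hence "norm (z - z / of_real r) = (r - 1) * norm (z / of_real r)"
      using r by (simp only: norm_mult norm_of_real)
    also have "\<dots> \<le> (r - 1) * 1" using r n by (intro mult_left_mono) auto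
    finally have "norm (z - z / of_real r) \<le> s / 8" using d by (simp add: r_def)
    moreover have "norm (1 - z) \<le> norm (1 - z / of_real r) + norm (z - z / of_real r)"
      using norm_triangle_ineq4[of "1 - z / of_real r" "z - z / of_real r"] by simp
    ultimately show ?thesis using n z by linarith
  qed
  have x': "norm x' < 1" "s / 8 \<le> norm (1 - x')" and y': "norm y' < 1" "s / 8 \<le> norm (1 - y')"
    using scale xy by (auto simp: x'_def y'_def)
  have xr: "x = of_real r * x'" "y = of_real r * y'" using r by (auto simp: x'_def y'_def)
  \<comment> \<open>With \<open>u = 4 * \<delta> * N \<le> 1\<close> the power is at most
    \<open>exp u \<le> 1 + u + u ^ 2 \<le> 1 + 2 * u\<close>.\<close>
  have "r ^ (2 * N) \<le> exp (2 * \<delta>) ^ (2 * N)"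
    using exp_ge_add_one_self[of "2 * \<delta>"] r by (intro power_mono) (auto simp: r_def)
  also have "\<dots> = exp (4 * \<delta> * real N)"
    by (simp add: exp_of_nat_mult[symmetric] mult_ac)
  also have "\<dots> \<le> 1 + 4 * \<delta> * real N + (4 * \<delta> * real N)\<^sup>2"
    using d delta_pos by (intro exp_bound) auto
  also have "(4 * \<delta> * real N)\<^sup>2 \<le> 4 * \<delta> * real N"
    unfolding power2_eq_square using d delta_pos by (intro mult_left_le) auto
  finally have rN: "r ^ (2 * N) - 1 \<le> 8 * \<delta> * real N" by simp
  have "norm (truncation N f (x, y) - truncation N f (x', y')) \<le>
      (\<Sum>p\<in>{..<N} \<times> {..<N}. norm (coeff2 f p) * (8 * \<delta> * real N))"
    unfolding truncation_def prod.case sum_subtractf[symmetric]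
  proof (intro sum_norm_le)
    fix p assume p: "p \<in> {..<N} \<times> {..<N}"
    obtain k l where kl: "p = (k, l)" by (cases p)
    have "x ^ k * y ^ l - x' ^ k * y' ^ l = of_real (r ^ (k + l) - 1) * (x' ^ k * y' ^ l)"
      by (simp add: xr power_mult_distrib power_add algebra_simps)
    hence "norm (x ^ k * y ^ l - x' ^ k * y' ^ l) = \<bar>r ^ (k + l) - 1\<bar> * (norm x' ^ k * norm y' ^ l)"
      by (simp only: norm_mult norm_of_real norm_power)
    also have "\<dots> \<le> (r ^ (2 * N) - 1) * 1"
    proof (intro mult_mono mult_le_one power_le_one)
      have "r ^ (k + l) \<le> r ^ (2 * N)" using p kl r by (intro power_increasing) auto
      moreover have "1 \<le> r ^ (k + l)" using r by (intro one_le_power) auto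
      ultimately show "\<bar>r ^ (k + l) - 1\<bar> \<le> r ^ (2 * N) - 1" by simp
    qed (use x' y' r in \<open>auto simp: one_le_power\<close>)
    also have "\<dots> \<le> 8 * \<delta> * real N" using rN by simp
    finally have "norm (coeff2 f p) * norm (x ^ k * y ^ l - x' ^ k * y' ^ l) \<le> norm (coeff2 f p) * (8 * \<delta> * real N)"
      by (intro mult_left_mono) auto
    thus "norm ((case p of (n, m) \<Rightarrow> coeff2 f (n, m) * x ^ n * y ^ m) -
        (case p of (n, m) \<Rightarrow> coeff2 f (n, m) * x' ^ n * y' ^ m)) \<le> norm (coeff2 f p) * (8 * \<delta> * real N)"
      by (simp add: kl norm_mult[symmetric] algebra_simps)
  qed
  also have "\<dots> = (\<Sum>p\<in>{..<N} \<times> {..<N}. norm (coeff2 f p)) * (8 * \<delta> * real N)"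
    by (simp add: sum_distrib_right)
  also have "\<dots> \<le> A * (8 * \<delta> * real N)"
    using order.trans[OF sum_norm_coeff2_le[OF f] A, of "{..<N} \<times> {..<N}"] ab delta_pos
    by (intro mult_right_mono) auto
  finally have 1: "norm (truncation N f (x, y) - truncation N f (x', y')) \<le> 8 * \<delta> * real N * A"
    by (simp add: mult_ac)
  have "(\<lambda>p. f p - truncation N f p) \<in> wiener_class 0 0"
    using wiener_class_mono(1)[OF wiener_class_diff(1)[OF f wiener_class_truncation] ab] .
  hence "norm (f (x', y') - truncation N f (x', y')) \<le> q"
    using order.trans[OF norm_le_wiener_norm q, of "(x', y')"] x' y' by auto
  moreover have "\<mu> \<le> norm (f (x', y'))" by (rule low) (use x' y' in auto)
  ultimately show ?thesis
    using 1 norm_triangle_ineq2[of "f (x', y')" "f (x', y') - truncation N f (x', y')"]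
      norm_triangle_ineq2[of "truncation N f (x', y')" "truncation N f (x', y') - truncation N f (x, y)"]
    by (simp add: norm_minus_commute)
qed

text \<open>Near the zero set the growth condition gives the bound, and the factor 8 stems from the
  distance \<open>s / 8\<close>. On the rest of the bidisc compactness provides a constant lower
  bound, which exceeds the exponential once \<open>s\<close> is small.\<close>

lemma lower_bound_away_from_zero_set:
  fixes f :: "complex \<times> complex \<Rightarrow> complex"
  assumes cont: "continuous_on closed_bidisc f"
    and zero: "zero_set f = ({1} \<times> cball 0 1) \<union> (cball 0 1 \<times> {1})"
    and growth: "\<eta> > 0" "\<forall>z\<in>ball 0 1. \<forall>w\<in>ball 0 1.
             min (norm (1 - z)) (norm (1 - w)) < \<eta> \<longrightarrow>
             \<bar>ln (norm (f (z, w)))\<bar> \<le> \<epsilon> / min (norm (1 - z)) (norm (1 - w))"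
    and "\<epsilon> > 0"
  shows "\<exists>s0>0. \<forall>s x y. 0 < s \<longrightarrow> s < s0 \<longrightarrow> norm x < 1 \<longrightarrow> norm y < 1 \<longrightarrow>
    s / 8 \<le> norm (1 - x) \<longrightarrow> s / 8 \<le> norm (1 - y) \<longrightarrow> exp (- (8 * \<epsilon> / s)) \<le> norm (f (x, y))"
proof -
  define K where "K = closed_bidisc \<inter> {p. \<eta> \<le> norm (1 - fst p)} \<inter> {p. \<eta> \<le> norm (1 - snd p)}"
  have "closed {p::complex \<times> complex. \<eta> \<le> norm (1 - fst p)}" "closed {p::complex \<times> complex. \<eta> \<le> norm (1 - snd p)}"
    by (intro closed_Collect_le continuous_intros)+
  hence "compact K" unfolding K_def
    by (intro compact_Int_closed compact_Times) auto
  moreover have "continuous_on K f" by (rule continuous_on_subset[OF cont]) (auto simp: K_def)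
  ultimately have "compact (f ` K)" by (rule compact_continuous_image[rotated])
  moreover have "0 \<notin> f ` K"
  proof
    assume "0 \<in> f ` K"
    then obtain p where "p \<in> K" "f p = 0" by auto
    hence "p \<in> zero_set f" by (auto simp: zero_set_def K_def)
    thus False using \<open>p \<in> K\<close> \<open>\<eta> > 0\<close> unfolding zero by (auto simp: K_def)
  qed
  ultimately have "\<exists>c>0. \<forall>u\<in>f ` K. c \<le> dist 0 u"
    by (intro separate_point_closed compact_imp_closed)
  then obtain c where c: "c > 0" "\<And>p. p \<in> K \<Longrightarrow> c \<le> norm (f p)"
    by auto
  obtain s0 where s0: "0 < s0" "exp (- (8 * \<epsilon> / s0)) \<le> c"
  proof
    \<comment> \<open>The witness solves \<open>8 * \<epsilon> / s0 = t\<close>, and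
      \<open>t\<close> is positive with \<open>exp (- t) \<le> c\<close>.\<close>
    define t where "t = \<bar>ln c\<bar> + 1"
    show "0 < 8 * \<epsilon> / t" using \<open>\<epsilon> > 0\<close> by (simp add: t_def)
    have "exp (- t) \<le> exp (ln c)" by (simp add: t_def)
    thus "exp (- (8 * \<epsilon> / (8 * \<epsilon> / t))) \<le> c" using c(1) \<open>\<epsilon> > 0\<close> by simp
  qed
  have "exp (- (8 * \<epsilon> / s)) \<le> norm (f (x, y))"
    if s: "0 < s" "s < s0" and xy: "norm x < 1" "norm y < 1" "s / 8 \<le> norm (1 - x)" "s / 8 \<le> norm (1 - y)" for s x y
  proof (cases "min (norm (1 - x)) (norm (1 - y)) < \<eta>")
    case True
    \<comment> \<open>Undoing the logarithm by \<open>exp (ln u) = u\<close> requires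
      \<open>u > 0\<close>, so zeros of \<open>f\<close> are excluded beforehand through the zero
      set.\<close>
    have "(x, y) \<notin> zero_set f" unfolding zero using xy by auto
    hence "f (x, y) \<noteq> 0" using xy by (auto simp: zero_set_def)
    have "\<bar>ln (norm (f (x, y)))\<bar> \<le> \<epsilon> / min (norm (1 - x)) (norm (1 - y))"
      using growth(2) xy True by auto
    also have "\<dots> \<le> \<epsilon> / (s / 8)"
    proof (intro divide_left_mono mult_pos_pos)
      show "0 < min (norm (1 - x)) (norm (1 - y))" using xy s by linarith
    qed (use xy s \<open>\<epsilon> > 0\<close> in auto)
    finally have "- (8 * \<epsilon> / s) \<le> ln (norm (f (x, y)))" by (simp add: mult.commute)
    hence "exp (- (8 * \<epsilon> / s)) \<le> exp (ln (norm (f (x, y))))" by simp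
    thus ?thesis using \<open>f (x, y) \<noteq> 0\<close> by simp
  next
    case False
    hence "(x, y) \<in> K" using xy by (auto simp: K_def)
    moreover have "8 * \<epsilon> / s0 \<le> 8 * \<epsilon> / s" using s \<open>\<epsilon> > 0\<close> by (intro divide_left_mono) auto
    hence "exp (- (8 * \<epsilon> / s)) \<le> exp (- (8 * \<epsilon> / s0))" by simp
    ultimately show ?thesis using c(2) s0(2) by (meson order.trans)
  qed
  thus ?thesis using s0(1) by blast
qed

lemma powr_neg_small:
  fixes c e :: real
  assumes "0 < c" "0 < e"
  shows "\<forall>\<^sub>F N in sequentially. real N powr (-c) < e"
proof -
  have "((\<lambda>x::real. x powr (-c)) \<longlongrightarrow> 0) at_top"
    using assms by (intro tendsto_neg_powr filterlim_ident) auto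
  hence "(\<lambda>N. real N powr (-c)) \<longlonglongrightarrow> 0"
    by (rule filterlim_compose) (rule filterlim_real_sequentially)
  thus ?thesis using assms by (simp add: order_tendstoD)
qed

section \<open>The choice of the parameters\<close>

text \<open>Every quantity becomes a power of \<open>N\<close>: the remainder has size
  \<open>A * N powr (- \<gamma>)\<close>, the truncation is at least
  \<open>N powr (- \<gamma> / 4) / 2\<close>, damping near 1 gives \<open>N powr (- D)\<close>, and
  the geometric norm factor is at most \<open>16 * N ^ 8\<close>. The numbers \<open>j\<close> and
  \<open>D\<close> make each of the three errors at most a constant times \<open>1 / N\<close>. Then
  \<open>\<epsilon>\<close> is fixed by \<open>\<kappa>\<close>, and \<open>N\<close> is taken large
  last of all.\<close>

lemma damp_approximation:
  fixes f :: "complex \<times> complex \<Rightarrow> complex"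
  assumes f: "f \<in> wiener_class \<alpha> \<beta>" and ab: "0 < \<alpha>" "\<alpha> \<le> 1" "0 < \<beta>" "\<beta> \<le> 1" and "\<kappa> > 0"
    and low: "\<And>\<epsilon>. \<epsilon> > 0 \<Longrightarrow> \<exists>s0>0. \<forall>s x y. 0 < s \<longrightarrow> s < s0 \<longrightarrow> norm x < 1 \<longrightarrow> norm y < 1 \<longrightarrow>
      s / 8 \<le> norm (1 - x) \<longrightarrow> s / 8 \<le> norm (1 - y) \<longrightarrow> exp (- (8 * \<epsilon> / s)) \<le> norm (f (x, y))"
    and "e > 0"
  shows "\<exists>s. 0 < s \<and> s \<le> 1/4 \<and> (\<exists>y\<in>wiener_class \<alpha> \<beta>.
    wiener_norm \<alpha> \<beta> (\<lambda>p. damp \<kappa> s (fst p) * damp \<kappa> s (snd p) - f p * y p) < e)"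
proof -
  define \<gamma> where "\<gamma> = min \<alpha> \<beta>"
  have g: "0 < \<gamma>" "\<gamma> \<le> 1" "\<gamma> \<le> \<alpha>" "\<gamma> \<le> \<beta>" using ab by (auto simp: \<gamma>_def)
  define A where "A = wiener_norm \<alpha> \<beta> f + 1"
  have A: "wiener_norm \<alpha> \<beta> f \<le> A" "1 \<le> A" by (auto simp: A_def)
  \<comment> \<open>The estimate \<open>p2\<close> dictates 13: with
    \<open>\<gamma> \<le> 1\<close>, the exponent \<open>8 + \<gamma> / 2 - 3 / 4 * 13\<close> is
    below -1.\<close>
  obtain j :: nat where j: "13 / \<gamma> \<le> real j" using real_arch_simple by blast
  \<comment> \<open>Damping has to beat both \<open>N ^ 8\<close> and the factor
    \<open>N powr (\<gamma> / 4 * (j + 2))\<close> from the inverse powers of the truncation: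
    \<open>8 - (j + 12) + (j + 2) / 4 \<le> -1\<close>.\<close>
  define D where "D = real j + 12"
  \<comment> \<open>This makes \<open>8 / L\<close> equal to \<open>\<gamma> / 4\<close>; then
    \<open>\<epsilon>\<close> solves \<open>\<kappa> / (50 * L * \<epsilon>) = D\<close>.\<close>
  define L where "L = 32 / \<gamma>"
  define \<epsilon> where "\<epsilon> = \<kappa> / (50 * L * D)"
  have pos: "0 < D" "0 < L" "0 < \<epsilon>" using g \<open>\<kappa> > 0\<close> by (auto simp: D_def L_def \<epsilon>_def)
  obtain s0 where s0: "s0 > 0" and low': "\<And>s x y. 0 < s \<Longrightarrow> s < s0 \<Longrightarrow> norm x < 1 \<Longrightarrow> norm y < 1 \<Longrightarrow>
      s / 8 \<le> norm (1 - x) \<Longrightarrow> s / 8 \<le> norm (1 - y) \<Longrightarrow> exp (- (8 * \<epsilon> / s)) \<le> norm (f (x, y))"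
    using low[OF pos(3)] by blast
  define C where "C = 16 * (221 + real (j + 2) ^ 2 * A ^ 2 * A ^ j * (419904 * 2 ^ (j + 2)) +
    real (j + 2) * A ^ (j + 3) * (5184 * 8 * 2 ^ (j + 2)))"
  \<comment> \<open>With \<open>s = t N\<close>, \<open>exp (- 8 \<epsilon> / s)\<close> is \<open>N powr (- \<gamma> / 4)\<close> and the bound of \<open>damp\<close> near 1 is
    \<open>N powr (- D)\<close>.\<close>
  define t where "t = (\<lambda>N. L * \<epsilon> / ln (real N))"
  have ln_top: "filterlim (\<lambda>N. ln (real N)) at_top sequentially"
    by (rule filterlim_compose[OF ln_at_top filterlim_real_sequentially])
  have "t \<longlonglongrightarrow> 0"
    unfolding t_def by (rule tendsto_divide_0[OF tendsto_const])
      (rule filterlim_at_top_imp_at_infinity[OF ln_top])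
  hence ev1: "\<forall>\<^sub>F N in sequentially. t N < min s0 (1/4)"
    using s0 by (intro order_tendstoD) auto
  have "(\<lambda>N. ln (real N) / real N) \<longlonglongrightarrow> 0"
    by (rule lim_ln_over_n)
  hence ev2: "\<forall>\<^sub>F N in sequentially. ln (real N) / real N < L * \<epsilon> / 16"
    using pos by (intro order_tendstoD) auto
  \<comment> \<open>Half of \<open>Z\<close> must absorb \<open>A * X\<close> from the remainder and
    at most \<open>8 * A * X\<close> from the change of radius; hence 18 = 2 * 9.\<close>
  have ev3: "\<forall>\<^sub>F N in sequentially. real N powr (- (3 * \<gamma> / 4)) < 1 / (18 * A)"
    using g A by (intro powr_neg_small) auto
  have ev4: "\<forall>\<^sub>F N in sequentially. real N powr (-1) < e / C"
  proof (rule powr_neg_small)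
    have "0 < C" unfolding C_def using A by (intro mult_pos_pos add_pos_nonneg) auto
    thus "0 < e / C" using \<open>e > 0\<close> by simp
  qed simp
  have ev5: "\<forall>\<^sub>F N in sequentially. N \<ge> (4::nat)" by (rule eventually_ge_at_top)
  have "\<forall>\<^sub>F N in sequentially. t N < min s0 (1/4) \<and> ln (real N) / real N < L * \<epsilon> / 16 \<and>
      real N powr (- (3 * \<gamma> / 4)) < 1 / (18 * A) \<and> real N powr (-1) < e / C \<and> N \<ge> 4"
    by (intro eventually_conj ev1 ev2 ev3 ev4 ev5)
  then obtain N where N: "t N < min s0 (1/4)" "ln (real N) / real N < L * \<epsilon> / 16"
      "real N powr (- (3 * \<gamma> / 4)) < 1 / (18 * A)" "real N powr (-1) < e / C" "N \<ge> 4"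
    by (auto simp: eventually_sequentially)
  define s where "s = t N"
  define \<delta> where "\<delta> = 1 / (real N)\<^sup>2"
  define x where "x = real N"
  have x: "4 \<le> x" using N by (simp add: x_def)
  have lnx: "0 < ln x" using x by simp
  have s: "0 < s" "s < s0" "s < 1/4" using N(1) pos lnx by (auto simp: s_def t_def x_def)
  have s_eq: "c / s = c / (L * \<epsilon>) * ln x" for c by (simp add: s_def t_def x_def)
  have d: "\<delta> \<le> s / 16"
  proof -
    have "ln x / x \<le> L * \<epsilon> / 16" using N(2) by (simp add: x_def)
    hence "16 * ln x \<le> L * \<epsilon> * x" using x by (simp add: field_simps)
    also have "\<dots> \<le> L * \<epsilon> * x\<^sup>2"
      using x pos by (intro mult_left_mono) (auto simp: power2_eq_square)
    finally show ?thesis using x lnx pos by (simp add: \<delta>_def s_def t_def x_def[symmetric] field_simps)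
  qed
  have d0: "0 < \<delta>" using x by (simp add: \<delta>_def x_def)
  interpret keyhole s \<delta>
    by unfold_locales (use s d d0 in auto)
  define X where "X = x powr (-\<gamma>)"
  define Z where "Z = x powr (- (\<gamma> / 4))"
  have Z: "0 < Z" "Z \<le> 1" using x g powr_mono[of "- (\<gamma> / 4)" 0 x] by (auto simp: Z_def)
  have T_eq: "exp (- (\<kappa> / (50 * s))) = x powr (- D)"
  proof -
    have "\<kappa> / (50 * s) = (\<kappa> / 50) / s" by simp
    also have "\<dots> = D * ln x"
      unfolding s_eq using pos \<open>\<kappa> > 0\<close> by (simp add: \<epsilon>_def field_simps)
    finally show ?thesis using x by (simp add: powr_def)
  qed
  have Z_eq: "exp (- (8 * \<epsilon> / s)) = Z"
    unfolding s_eq using x pos g by (simp add: Z_def powr_def L_def field_simps)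
  have q: "wiener_norm 0 0 (\<lambda>p. f p - truncation N f p) \<le> A * X"
  proof -
    have "wiener_norm 0 0 (\<lambda>p. f p - truncation N f p) \<le> x powr (-\<gamma>) * wiener_norm \<alpha> \<beta> f"
      unfolding x_def by (rule wiener_norm_tail_le[OF f]) (use g N in auto)
    also have "\<dots> \<le> x powr (-\<gamma>) * A" using A by (intro mult_left_mono) auto
    finally show ?thesis by (simp add: X_def mult.commute)
  qed
  have X1: "X \<le> 1" using x g powr_mono[of "- \<gamma>" 0 x] by (auto simp: X_def)
  have qA: "A * X \<le> A" using X1 A by (simp add: mult_left_le)
  have xinv: "x powr (-1) \<le> X" unfolding X_def using x g by (intro powr_mono) auto
  have "4 * \<delta> * x \<le> 1" using x by (simp add: \<delta>_def x_def[symmetric] power2_eq_square)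
  have nu: "Z / 2 \<le> norm (truncation N f (z, w))" if "z \<in> domain" "w \<in> domain" for z w
  proof -
    have "Z - A * X - 8 * \<delta> * real N * A \<le> norm (truncation N f (z, w))"
      by (rule truncation_lower_bound[OF f _ _ A(1) _ q d _ that])
        (use ab low'[OF s(1,2)] \<open>4 * \<delta> * x \<le> 1\<close> in \<open>auto simp: Z_eq x_def\<close>)
    moreover have "8 * \<delta> * real N * A = 8 * A * x powr (-1)"
      using x by (simp add: \<delta>_def x_def[symmetric] power2_eq_square powr_minus field_simps)
    moreover have "8 * A * x powr (-1) \<le> 8 * A * X" using xinv A by (intro mult_left_mono) auto
    moreover have "9 * A * X \<le> Z / 2"
    proof -
      have "X = Z * x powr (- (3 * \<gamma> / 4))"
        by (simp add: X_def Z_def powr_add[symmetric])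
      also have "\<dots> \<le> Z * (1 / (18 * A))"
        using N(3) Z by (intro mult_left_mono) (auto simp: x_def)
      finally show ?thesis using A by (simp add: field_simps)
    qed
    ultimately show ?thesis by linarith
  qed
  obtain y where y: "y \<in> wiener_class \<alpha> \<beta>" and le: "wiener_norm \<alpha> \<beta> (\<lambda>p. damp \<kappa> s (fst p) * damp \<kappa> s (snd p) - f p * y p) \<le>
    (1 / (1 - 1 / R)\<^sup>2)\<^sup>2 * (221 * x powr (-D) + real (j + 2) ^ 2 * A ^ 2 * (A * X) ^ j * (419904 / (Z / 2) ^ (j + 2)) +
      real (j + 2) * (A ^ (j + 3) * (5184 * R ^ (2 * N) * x powr (-D) / (Z / 2) ^ (j + 2))))"
    using approximation_bound[OF f _ ab(2) _ ab(4) _ A, of \<kappa> "Z / 2" N "A * X" j] ab \<open>\<kappa> > 0\<close> Z nu q qA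
    unfolding T_eq by auto
  define M where "M = x powr (\<gamma> / 4 * real (j + 2))"
  have M_eq: "1 / (Z / 2) ^ (j + 2) = 2 ^ (j + 2) * M"
  proof -
    have "Z ^ (j + 2) = Z powr real (j + 2)" using Z by (intro powr_realpow[symmetric]) auto
    also have "\<dots> = x powr (- (\<gamma> / 4 * real (j + 2)))" unfolding Z_def powr_powr by simp
    also have "\<dots> = 1 / M" unfolding M_def by (simp add: powr_minus inverse_eq_divide)
    finally have "Z ^ (j + 2) = 1 / M" .
    thus ?thesis by (simp only: power_divide divide_divide_eq_right)
  qed
  have X_pow: "X ^ j = x powr (- \<gamma> * real j)"
    using x by (simp add: X_def powr_power mult_ac)
  \<comment> \<open>Since \<open>1 - 1 / R = 1 / (R * x ^ 2)\<close>, the fourth power of its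
    inverse is \<open>R ^ 4 * x ^ 8\<close>.\<close>
  have CW: "(1 / (1 - 1 / R)\<^sup>2)\<^sup>2 \<le> 16 * x powr 8"
  proof -
    have "1 - 1 / R = \<delta> / R" using R_bounds by (simp add: R_def field_simps)
    also have "\<dots> = 1 / (R * x\<^sup>2)" by (simp add: \<delta>_def x_def)
    finally have "1 / (1 - 1 / R)\<^sup>2 = (R * x\<^sup>2)\<^sup>2"
      by (simp add: power_divide)
    hence "(1 / (1 - 1 / R)\<^sup>2)\<^sup>2 = R ^ 4 * x ^ 8"
      by (simp add: power_mult_distrib power_mult[symmetric])
    also have "\<dots> \<le> 2 ^ 4 * x ^ 8"
      using R_bounds x by (intro mult_right_mono power_mono) auto
    also have "x ^ 8 = x powr 8" using x powr_realpow[of x 8] by simp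
    finally show ?thesis by simp
  qed
  have RN: "R ^ (2 * N) \<le> 8"
  proof -
    have "R ^ (2 * N) \<le> exp \<delta> ^ (2 * N)"
      using exp_ge_add_one_self[of \<delta>] R_bounds by (intro power_mono) (auto simp: R_def)
    also have "\<dots> = exp (2 * \<delta> * x)" by (simp add: exp_of_nat_mult[symmetric] mult_ac x_def)
    also have "\<dots> \<le> exp 1" using \<open>4 * \<delta> * x \<le> 1\<close> d0 x by simp
    also have "\<dots> \<le> 8" using exp_le by simp
    finally show ?thesis .
  qed
  have p1: "x powr 8 * x powr (-D) \<le> x powr (-1)"
    unfolding powr_add[symmetric] using x by (intro powr_mono) (auto simp: D_def)
  have p2: "x powr 8 * (X ^ j * M) \<le> x powr (-1)"
  proof -
    have "13 \<le> \<gamma> * real j" using j g by (simp add: field_simps)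
    moreover have "8 + (- \<gamma> * real j + \<gamma> / 4 * real (j + 2)) = 8 + \<gamma> / 2 - 3 / 4 * (\<gamma> * real j)"
      by (simp add: field_simps)
    ultimately have "8 + (- \<gamma> * real j + \<gamma> / 4 * real (j + 2)) \<le> -1"
      using g by linarith
    thus ?thesis
      unfolding X_pow M_def powr_add[symmetric] using x by (intro powr_mono) auto
  qed
  have p3: "x powr 8 * (x powr (-D) * M) \<le> x powr (-1)"
  proof -
    have le: "\<gamma> / 4 * real (j + 2) \<le> 1 / 4 * real (j + 2)" using g by (intro mult_right_mono) auto
    have "8 + (- D + t) \<le> -1" if "t \<le> 1 / 4 * real (j + 2)" for t
      using that by (simp add: D_def)
    from this[OF le] have "8 + (- D + \<gamma> / 4 * real (j + 2)) \<le> -1" .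
    thus ?thesis
      unfolding M_def powr_add[symmetric] using x by (intro powr_mono) auto
  qed
  have M0: "0 \<le> M" "0 \<le> X" by (auto simp: M_def X_def)
  have "wiener_norm \<alpha> \<beta> (\<lambda>p. damp \<kappa> s (fst p) * damp \<kappa> s (snd p) - f p * y p) \<le>
    (1 / (1 - 1 / R)\<^sup>2)\<^sup>2 * (221 * x powr (-D) + real (j + 2) ^ 2 * A ^ 2 * (A ^ j * X ^ j) * (419904 * (1 / (Z / 2) ^ (j + 2))) +
      real (j + 2) * (A ^ (j + 3) * (5184 * R ^ (2 * N) * x powr (-D) * (1 / (Z / 2) ^ (j + 2)))))"
    using le by (simp add: power_mult_distrib)
  also have "\<dots> \<le> 16 * x powr 8 * (221 * x powr (-D) + real (j + 2) ^ 2 * A ^ 2 * (A ^ j * X ^ j) * (419904 * (1 / (Z / 2) ^ (j + 2))) +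
      real (j + 2) * (A ^ (j + 3) * (5184 * 8 * x powr (-D) * (1 / (Z / 2) ^ (j + 2)))))"
    using A Z M0 R_bounds
    by (intro mult_mono CW add_mono mult_left_mono mult_right_mono RN) auto
  also have "\<dots> = 16 * (221 * (x powr 8 * x powr (-D)) +
      real (j + 2) ^ 2 * A ^ 2 * A ^ j * (419904 * 2 ^ (j + 2)) * (x powr 8 * (X ^ j * M)) +
      real (j + 2) * A ^ (j + 3) * (5184 * 8 * 2 ^ (j + 2)) * (x powr 8 * (x powr (-D) * M)))"
    unfolding M_eq by (simp only: distrib_left mult_ac)
  also have "\<dots> \<le> 16 * (221 * x powr (-1) +
      real (j + 2) ^ 2 * A ^ 2 * A ^ j * (419904 * 2 ^ (j + 2)) * x powr (-1) +
      real (j + 2) * A ^ (j + 3) * (5184 * 8 * 2 ^ (j + 2)) * x powr (-1))"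
    using A by (intro mult_left_mono add_mono p1 p2 p3) auto
  also have "\<dots> = C * x powr (-1)" by (simp add: C_def algebra_simps)
  also have "\<dots> < e"
  proof -
    have "0 < C" unfolding C_def using A by (intro mult_pos_pos add_pos_nonneg) auto
    thus ?thesis using N(4) by (simp add: x_def field_simps)
  qed
  finally show ?thesis using y s by (intro exI[of _ s]) auto
qed

section \<open>Convergence of the damped functions in the weighted norm\<close>

text \<open>Two of the derivatives are taken on \<open>q\<close> itself and the remaining
  \<open>n - 2\<close> by Cauchy's inequality on the unit circle, which leaves
  \<open>1 / (n * (n - 1))\<close>. The factor 6 pays for the comparison with
  \<open>(1 + n) ^ 2\<close> and also covers \<open>n = 0\<close> and \<open>n = 1\<close>.\<close>

lemma taylor_coeff_decay:
  assumes q: "q holomorphic_on U" "open U" "cball 0 1 \<subseteq> U"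
    and B: "\<And>z. norm z = 1 \<Longrightarrow> norm (q z) \<le> B" "\<And>z. norm z = 1 \<Longrightarrow> norm ((deriv ^^ 2) q z) \<le> B"
  shows "norm ((deriv ^^ n) q 0 / fact n) \<le> 6 * B / (1 + real n)\<^sup>2"
proof -
  have B0: "0 \<le> B" using order.trans[OF norm_ge_zero B(1)[of 1]] by simp
  have cauchy: "norm ((deriv ^^ m) h 0) \<le> fact m * B / 1 ^ m"
    if "h holomorphic_on U" "\<And>z. norm z = 1 \<Longrightarrow> norm (h z) \<le> B" for m h
  proof (rule Cauchy_inequality)
    show "h holomorphic_on ball 0 1"
      by (rule holomorphic_on_subset[OF that(1)]) (use q(3) in auto)
    show "continuous_on (cball 0 1) h"
      by (rule continuous_on_subset[OF holomorphic_on_imp_continuous_on[OF that(1)] q(3)])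
  qed (use that(2) in auto)
  consider "n = 0" | "n = 1" | m where "n = m + 2"
    by (metis One_nat_def add_2_eq_Suc' not0_implies_Suc)
  thus ?thesis
  proof cases
    case 3
    have "(deriv ^^ n) q = (deriv ^^ m) ((deriv ^^ 2) q)"
      by (simp only: 3 funpow_add o_apply)
    hence "norm ((deriv ^^ n) q 0) \<le> fact m * B"
      using cauchy[OF holomorphic_higher_deriv[OF q(1,2)] B(2), of m] by simp
    hence "norm ((deriv ^^ n) q 0) / fact n \<le> fact m * B / fact n"
      by (rule divide_right_mono) simp
    also have "fact m * B / fact n = B * (1 / ((real m + 2) * (real m + 1)))"
    proof -
      have "fact n = (real m + 2) * (real m + 1) * fact m"
        unfolding 3 by (simp add: algebra_simps)
      thus ?thesis by simp
    qed
    also have "\<dots> \<le> B * (6 / (1 + real n)\<^sup>2)"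
    proof (rule mult_left_mono[OF _ B0])
      have "(1 + real n)\<^sup>2 \<le> 6 * ((real m + 2) * (real m + 1))"
        unfolding 3 by (simp add: power2_eq_square algebra_simps)
      thus "1 / ((real m + 2) * (real m + 1)) \<le> 6 / (1 + real n)\<^sup>2"
        by (simp add: divide_simps add_pos_pos)
    qed
    finally show ?thesis by (simp add: norm_divide mult.commute)
  qed (use cauchy[OF q(1) B(1), of n] B0 in \<open>auto simp: norm_divide\<close>)
qed

text \<open>Mean value inequality on the left half-plane, which is convex and where the derivative
  \<open>exp\<close> has modulus at most 1.\<close>

lemma norm_exp_minus_1_le:
  assumes "Re w \<le> 0"
  shows "norm (exp w - 1) \<le> norm w"
proof -
  have "norm (exp w - exp 0) \<le> 1 * norm (w - 0)"
  proof (rule field_differentiable_bound[where S = "{z. Re z \<le> 0}" and f' = exp])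
    show "convex {z. Re z \<le> 0}" by (rule convex_halfspace_Re_le)
  qed (use assms in \<open>auto intro!: derivative_eq_intros\<close>)
  thus ?thesis by simp
qed

definition quartic_coeff :: "nat \<Rightarrow> complex"
  where "quartic_coeff n = (deriv ^^ n) (\<lambda>z. (1 - z) ^ 4) 0 / fact n"

lemma norm_quartic_coeff_le: "norm (quartic_coeff n) \<le> 288 / (1 + real n)\<^sup>2"
proof -
  have d1: "deriv (\<lambda>z. (1 - z) ^ 4) = (\<lambda>z::complex. - 4 * (1 - z) ^ 3)"
    by (rule ext, rule DERIV_imp_deriv) (auto intro!: derivative_eq_intros)
  have d2: "deriv (\<lambda>z. - 4 * (1 - z) ^ 3) = (\<lambda>z::complex. 12 * (1 - z)\<^sup>2)"
    by (rule ext, rule DERIV_imp_deriv) (auto intro!: derivative_eq_intros)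
  have dd: "(deriv ^^ 2) (\<lambda>z. (1 - z) ^ 4) = (\<lambda>z::complex. 12 * (1 - z)\<^sup>2)"
  proof -
    have "(deriv ^^ 2) h = deriv (deriv h)" for h :: "complex \<Rightarrow> complex"
      by (simp add: numeral_2_eq_2)
    thus ?thesis by (simp only: d1 d2)
  qed
  have le: "norm (1 - z) \<le> 2" if "norm z = 1" for z :: complex
    using norm_triangle_ineq4[of 1 z] that by simp
  have "norm (quartic_coeff n) \<le> 6 * 48 / (1 + real n)\<^sup>2"
    unfolding quartic_coeff_def
  proof (rule taylor_coeff_decay[where U = UNIV])
    fix z :: complex assume z: "norm z = 1"
    show "norm ((1 - z) ^ 4) \<le> 48"
      using power_mono[OF le[OF z], of 4] by (simp add: norm_power)
    show "norm ((deriv ^^ 2) (\<lambda>z. (1 - z) ^ 4) z) \<le> 48"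
      unfolding dd using power_mono[OF le[OF z], of 2] by (simp add: norm_power norm_mult)
  qed (auto intro!: holomorphic_intros)
  thus ?thesis by simp
qed

text \<open>The bound must be uniform in \<open>s\<close>, although two derivatives of the
  exponential produce powers of \<open>1 / v\<close> up to the fourth. On the unit circle
  \<open>norm (1 - z) \<le> norm (v z)\<close>, so the powers of \<open>1 - z\<close> absorb those
  denominators, and every term retains a factor \<open>\<kappa>\<close>. The terms of the second
  derivative give 24 + 16 + 4 + 1 = 45, and 6 * 45 = 270.\<close>

lemma damp_coeff_close:
  assumes s: "0 < s" and k: "0 \<le> \<kappa>" "\<kappa> \<le> 1"
  shows "norm (damp_coeff \<kappa> s n - quartic_coeff n) \<le> 270 * \<kappa> / (1 + real n)\<^sup>2"
proof -
  define U where "U = {z. Re z < 1 + s}"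
  have oU: "open U" unfolding U_def by (rule open_halfspace_Re_lt)
  have cU: "cball 0 1 \<subseteq> U"
  proof
    fix z :: complex assume "z \<in> cball 0 1"
    thus "z \<in> U" using complex_Re_le_cmod[of z] s by (auto simp: U_def)
  qed
  define v :: "complex \<Rightarrow> complex" where "v = (\<lambda>z. 1 - z + of_real s)"
  define \<Psi> where "\<Psi> = (\<lambda>z. exp (- of_real \<kappa> / v z))"
  define q where "q = (\<lambda>z. (1 - z) ^ 4 * (\<Psi> z - 1))"
  \<comment> \<open>\<open>q1\<close> and \<open>q2\<close> are the first and the second derivative
    of \<open>q\<close>. Each term of \<open>q2\<close> has at least as many factors
    \<open>1 - z\<close> as factors \<open>v z\<close> in the denominator, counting
    \<open>\<Psi> z - 1\<close> as \<open>\<kappa> / v z\<close>.\<close>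
  define q1 where "q1 = (\<lambda>z. - 4 * (1 - z) ^ 3 * (\<Psi> z - 1) - of_real \<kappa> * (1 - z) ^ 4 * \<Psi> z / v z ^ 2)"
  define q2 where "q2 = (\<lambda>z. 12 * (1 - z) ^ 2 * (\<Psi> z - 1) + 8 * of_real \<kappa> * (1 - z) ^ 3 * \<Psi> z / v z ^ 2
      - 2 * of_real \<kappa> * (1 - z) ^ 4 * \<Psi> z / v z ^ 3 + of_real \<kappa> ^ 2 * (1 - z) ^ 4 * \<Psi> z / v z ^ 4)"
  have v0: "v z \<noteq> 0" if "z \<in> U" for z
    using that by (auto simp: complex_eq_iff U_def v_def)
  have dv: "(v has_field_derivative -1) (at z)" for z
    unfolding v_def by (auto intro!: derivative_eq_intros)
  have d\<Psi>: "(\<Psi> has_field_derivative - of_real \<kappa> * \<Psi> z / v z ^ 2) (at z)" if "z \<in> U" for z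
    unfolding \<Psi>_def using v0[OF that]
    by (auto intro!: derivative_eq_intros dv simp: power2_eq_square field_simps)
  have dq: "(q has_field_derivative q1 z) (at z)" if "z \<in> U" for z
    unfolding q_def q1_def using v0[OF that]
    by (auto intro!: derivative_eq_intros d\<Psi>[OF that] simp: field_simps)
  have dq1: "(q1 has_field_derivative q2 z) (at z)" if "z \<in> U" for z
  proof -
    have "(q1 has_field_derivative (12 * (1 - z) ^ 2 * (\<Psi> z - 1) +
        - 4 * (1 - z) ^ 3 * (- of_real \<kappa> * \<Psi> z / v z ^ 2) -
        ((of_real \<kappa> * (- 4 * (1 - z) ^ 3) * \<Psi> z + of_real \<kappa> * (1 - z) ^ 4 * (- of_real \<kappa> * \<Psi> z / v z ^ 2)) * v z ^ 2
          - of_real \<kappa> * (1 - z) ^ 4 * \<Psi> z * (- 2 * v z)) / (v z ^ 2 * v z ^ 2))) (at z)"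
      unfolding q1_def using v0[OF that]
      by (auto intro!: derivative_eq_intros dv d\<Psi>[OF that] simp: algebra_simps)
    also have "(12 * (1 - z) ^ 2 * (\<Psi> z - 1) +
        - 4 * (1 - z) ^ 3 * (- of_real \<kappa> * \<Psi> z / v z ^ 2) -
        ((of_real \<kappa> * (- 4 * (1 - z) ^ 3) * \<Psi> z + of_real \<kappa> * (1 - z) ^ 4 * (- of_real \<kappa> * \<Psi> z / v z ^ 2)) * v z ^ 2
          - of_real \<kappa> * (1 - z) ^ 4 * \<Psi> z * (- 2 * v z)) / (v z ^ 2 * v z ^ 2)) = q2 z"
      unfolding q2_def using v0[OF that] by (simp add: divide_simps) (simp add: power_numeral_reduce algebra_simps)
    finally show ?thesis .
  qed
  have hol: "q holomorphic_on U"
    using dq by (auto simp: holomorphic_on_open[OF oU])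
  have deriv2: "(deriv ^^ 2) q z = q2 z" if "z \<in> U" for z
  proof -
    have "(deriv q has_field_derivative q2 z) (at z)"
      by (rule has_field_derivative_transform_within_open[OF dq1[OF that] oU that])
        (rule DERIV_imp_deriv[OF dq, symmetric])
    thus ?thesis by (simp add: numeral_2_eq_2 DERIV_imp_deriv)
  qed
  have "norm ((deriv ^^ n) q 0 / fact n) \<le> 6 * (45 * \<kappa>) / (1 + real n)\<^sup>2"
  proof (rule taylor_coeff_decay[OF hol oU cU])
    fix z :: complex assume z: "norm z = 1"
    hence zU: "z \<in> U" using cU by auto
    define u where "u = norm (1 - z)"
    have Re: "0 \<le> Re (1 - z)" using complex_Re_le_cmod[of z] z by simp
    have u2: "u \<le> 2" using norm_triangle_ineq4[of 1 z] z by (simp add: u_def)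
    have u0: "0 \<le> u" by (simp add: u_def)
    have uv: "u \<le> norm (v z)"
    proof -
      have "(Re (1 - z))\<^sup>2 \<le> (Re (v z))\<^sup>2"
        using Re s by (intro power_mono) (auto simp: v_def)
      thus ?thesis by (simp add: u_def cmod_def v_def)
    qed
    have vp: "0 < norm (v z)" using v0[OF zU] by simp
    have "0 \<le> Re (of_real \<kappa> / v z)"
      unfolding Re_inverse_eq using Re s k by (intro divide_nonneg_nonneg mult_nonneg_nonneg) (auto simp: v_def)
    hence Rew: "Re (- of_real \<kappa> / v z) \<le> 0" by simp
    hence P1: "norm (\<Psi> z) \<le> 1" by (simp add: \<Psi>_def)
    have P2: "norm (\<Psi> z - 1) \<le> \<kappa> / norm (v z)"
      using norm_exp_minus_1_le[OF Rew] k by (simp add: \<Psi>_def norm_divide)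
    have uk: "u * (\<kappa> / norm (v z)) \<le> \<kappa>"
      using mult_right_mono[OF uv k(1)] vp by (simp add: field_simps)
    \<comment> \<open>One factor \<open>u\<close> cancels the denominator in the estimate
      \<open>P2\<close> of \<open>\<Psi> z - 1\<close>; the other \<open>a - 1\<close> factors are
      at most 2 each.\<close>
    have q0: "norm (u ^ a * (\<Psi> z - 1)) \<le> 2 ^ (a - 1) * \<kappa>" if "a \<ge> 1" for a
    proof -
      have "norm (u ^ a * (\<Psi> z - 1)) = u ^ (a - 1) * (u * norm (\<Psi> z - 1))"
        using u0 that by (cases a) (auto simp: norm_mult norm_power)
      also have "\<dots> \<le> 2 ^ (a - 1) * (u * (\<kappa> / norm (v z)))"
        by (intro mult_mono power_mono P2 u0 u2) (use u0 in auto)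
      also have "\<dots> \<le> 2 ^ (a - 1) * \<kappa>" using uk by (intro mult_left_mono) auto
      finally show ?thesis .
    qed
    \<comment> \<open>Here \<open>b\<close> factors \<open>u\<close> cancel the denominator and the
      remaining \<open>a\<close> are at most 2 each.\<close>
    have r: "u ^ c * norm (\<Psi> z) / norm (v z) ^ b \<le> 2 ^ a" if "c = a + b" for a b c
    proof -
      have "u ^ b \<le> norm (v z) ^ b" by (intro power_mono uv u0)
      hence "u ^ b / norm (v z) ^ b \<le> 1" using vp by simp
      hence "u ^ a * (u ^ b / norm (v z) ^ b) * norm (\<Psi> z) \<le> 2 ^ a * 1 * 1"
        using u0 by (intro mult_mono power_mono u2 P1) auto
      thus ?thesis by (simp add: that power_add mult_ac)
    qed
    have "norm (q z) \<le> 8 * \<kappa>"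
      using q0[of 4] by (simp add: q_def u_def norm_mult norm_power mult_ac)
    thus "norm (q z) \<le> 45 * \<kappa>" using k by simp
    have "norm (q2 z) \<le> norm (12 * (1 - z) ^ 2 * (\<Psi> z - 1)) + norm (8 * of_real \<kappa> * (1 - z) ^ 3 * \<Psi> z / v z ^ 2)
      + norm (2 * of_real \<kappa> * (1 - z) ^ 4 * \<Psi> z / v z ^ 3) + norm (of_real \<kappa> ^ 2 * (1 - z) ^ 4 * \<Psi> z / v z ^ 4)"
      unfolding q2_def by (intro order.trans[OF norm_triangle_ineq] order.trans[OF norm_triangle_ineq4] add_mono) auto
    also have "\<dots> \<le> 24 * \<kappa> + 16 * \<kappa> + 4 * \<kappa> + \<kappa>"
    proof (intro add_mono)
      show "norm (12 * (1 - z) ^ 2 * (\<Psi> z - 1)) \<le> 24 * \<kappa>"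
        using q0[of 2] by (simp add: u_def norm_mult norm_power mult_ac)
      have "norm (8 * of_real \<kappa> * (1 - z) ^ 3 * \<Psi> z / v z ^ 2) = 8 * (\<kappa> * (u ^ 3 * norm (\<Psi> z) / norm (v z) ^ 2))"
        using k by (simp add: u_def norm_mult norm_power norm_divide)
      also have "\<dots> \<le> 8 * (\<kappa> * 2 ^ 1)" by (intro mult_left_mono r) (use k in auto)
      finally show "norm (8 * of_real \<kappa> * (1 - z) ^ 3 * \<Psi> z / v z ^ 2) \<le> 16 * \<kappa>" by simp
      have "norm (2 * of_real \<kappa> * (1 - z) ^ 4 * \<Psi> z / v z ^ 3) = 2 * (\<kappa> * (u ^ 4 * norm (\<Psi> z) / norm (v z) ^ 3))"
        using k by (simp add: u_def norm_mult norm_power norm_divide)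
      also have "\<dots> \<le> 2 * (\<kappa> * 2 ^ 1)" by (intro mult_left_mono r) (use k in auto)
      finally show "norm (2 * of_real \<kappa> * (1 - z) ^ 4 * \<Psi> z / v z ^ 3) \<le> 4 * \<kappa>" by simp
      have "norm (of_real \<kappa> ^ 2 * (1 - z) ^ 4 * \<Psi> z / v z ^ 4) = \<kappa> ^ 2 * (u ^ 4 * norm (\<Psi> z) / norm (v z) ^ 4)"
        using k by (simp add: u_def norm_mult norm_power norm_divide)
      also have "\<dots> \<le> \<kappa> ^ 2 * 2 ^ 0" by (intro mult_left_mono r) auto
      also have "\<dots> \<le> \<kappa>" using k by (simp add: power2_eq_square mult_left_le)
      finally show "norm (of_real \<kappa> ^ 2 * (1 - z) ^ 4 * \<Psi> z / v z ^ 4) \<le> \<kappa>" .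
    qed
    finally show "norm ((deriv ^^ 2) q z) \<le> 45 * \<kappa>" unfolding deriv2[OF zU] by simp
  qed
  moreover have "(deriv ^^ n) q 0 = (deriv ^^ n) (damp \<kappa> s) 0 - (deriv ^^ n) (\<lambda>z. (1 - z) ^ 4) 0"
  proof -
    have "q = (\<lambda>z. damp \<kappa> s z - (1 - z) ^ 4)"
      by (rule ext) (simp add: q_def damp_def \<Psi>_def v_def right_diff_distrib)
    moreover have "(deriv ^^ n) (\<lambda>z. damp \<kappa> s z - (1 - z) ^ 4) 0 =
        (deriv ^^ n) (damp \<kappa> s) 0 - (deriv ^^ n) (\<lambda>z. (1 - z) ^ 4) 0"
      by (rule higher_deriv_diff[OF _ _ oU]) (use damp_holomorphic s in \<open>auto simp: U_def intro!: holomorphic_intros\<close>)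
    ultimately show ?thesis by simp
  qed
  ultimately show ?thesis
    by (simp add: damp_coeff_def quartic_coeff_def diff_divide_distrib)
qed

text \<open>Coefficients bounded by \<open>1 / (1 + n) ^ 2\<close> in each variable are summable
  against \<open>(1 + n) powr \<alpha>\<close> because \<open>\<alpha> < 1\<close>. The constant is
  independent of \<open>s\<close>, which matters since \<open>s\<close> is known only after
  \<open>\<kappa>\<close> has been fixed.\<close>

lemma damp_norm_close:
  assumes ab: "\<alpha> < 1" "\<beta> < 1"
  shows "\<exists>C. \<forall>\<kappa> s. 0 \<le> \<kappa> \<longrightarrow> \<kappa> \<le> 1 \<longrightarrow> 0 < s \<longrightarrow>
    (\<lambda>p. damp \<kappa> s (fst p) * damp \<kappa> s (snd p)) \<in> wiener_class \<alpha> \<beta> \<and>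
    wiener_norm \<alpha> \<beta> (\<lambda>p. (1 - fst p) ^ 4 * (1 - snd p) ^ 4 - damp \<kappa> s (fst p) * damp \<kappa> s (snd p)) \<le> C * \<kappa>"
proof -
  have sm: "(\<lambda>n. (1 + real n) powr \<alpha> / (1 + real n)\<^sup>2) summable_on UNIV" if "\<alpha> < 1" for \<alpha>
  proof -
    have "summable (\<lambda>n. real (Suc n) powr (\<alpha> - 2))"
      using summable_real_powr_iff[of "\<alpha> - 2"] that by (subst summable_Suc_iff) simp
    hence "summable (\<lambda>n. (1 + real n) powr \<alpha> / (1 + real n)\<^sup>2)"
      by (rule summable_cong[THEN iffD1, rotated]) (auto simp: powr_diff add.commute)
    thus ?thesis by (intro summable_nonneg_imp_summable_on) auto
  qed
  obtain SA SB where S: "((\<lambda>n. (1 + real n) powr \<alpha> / (1 + real n)\<^sup>2) has_sum SA) UNIV"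
    "((\<lambda>n. (1 + real n) powr \<beta> / (1 + real n)\<^sup>2) has_sum SB) UNIV"
    using sm[OF ab(1)] sm[OF ab(2)] by (auto simp: summable_on_def)
  note SS = has_sum_tensor_nonneg[OF S]
  have main: "f \<in> wiener_class \<alpha> \<beta>" "wiener_norm \<alpha> \<beta> f \<le> b * (SA * SB)"
    if "expands2 f a" "\<And>n m. norm (a (n, m)) \<le> b / ((1 + real n)\<^sup>2 * (1 + real m)\<^sup>2)" for f a b
  proof -
    have le: "norm (a p) * wiener_weight \<alpha> \<beta> p \<le>
        b * (case p of (n, m) \<Rightarrow> (1 + real n) powr \<alpha> / (1 + real n)\<^sup>2 * ((1 + real m) powr \<beta> / (1 + real m)\<^sup>2))" for p
    proof -
      obtain n m where p: "p = (n, m)" by (cases p)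
      have "norm (a p) * wiener_weight \<alpha> \<beta> p \<le> b / ((1 + real n)\<^sup>2 * (1 + real m)\<^sup>2) * wiener_weight \<alpha> \<beta> p"
        unfolding p by (intro mult_right_mono that) auto
      thus ?thesis by (simp add: p wiener_weight_def mult_ac)
    qed
    show "f \<in> wiener_class \<alpha> \<beta>" "wiener_norm \<alpha> \<beta> f \<le> b * (SA * SB)"
      by (rule wiener_norm_le[OF that(1) le has_sum_cmult_right[OF SS]]; simp)+
  qed
  have q: "expands2 (\<lambda>p. (1 - fst p) ^ 4 * (1 - snd p) ^ 4) (\<lambda>(n, m). quartic_coeff n * quartic_coeff m)"
  proof -
    have h: "(\<lambda>z::complex. (1 - z) ^ 4) holomorphic_on ball 0 1" by (intro holomorphic_intros)
    from expands2_tensor[OF taylor_has_sum[OF h] taylor_has_sum[OF h]]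
    show ?thesis by (simp add: quartic_coeff_def case_prod_unfold)
  qed
  have "(\<lambda>p. damp \<kappa> s (fst p) * damp \<kappa> s (snd p)) \<in> wiener_class \<alpha> \<beta> \<and>
    wiener_norm \<alpha> \<beta> (\<lambda>p. (1 - fst p) ^ 4 * (1 - snd p) ^ 4 - damp \<kappa> s (fst p) * damp \<kappa> s (snd p)) \<le> (228420 * (SA * SB)) * \<kappa>"
    if k: "0 \<le> \<kappa>" "\<kappa> \<le> 1" and s: "0 < s" for \<kappa> s
  proof
    let ?G = "damp_coeff \<kappa> s" and ?Q = quartic_coeff
    have d: "norm (?G n - ?Q n) \<le> 270 * \<kappa> / (1 + real n)\<^sup>2" for n
      by (rule damp_coeff_close[OF s k])
    \<comment> \<open>The quartic adds 288 to 270. Telescoping the difference of products then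
      yields \<open>270 * 558 + 288 * 270 = 228420\<close>.\<close>
    have G: "norm (?G n) \<le> 558 / (1 + real n)\<^sup>2" for n
    proof -
      have "norm (?G n) \<le> 270 * \<kappa> / (1 + real n)\<^sup>2 + 288 / (1 + real n)\<^sup>2"
        using norm_triangle_sub[of "?G n" "?Q n"] d[of n] norm_quartic_coeff_le[of n] by linarith
      also have "\<dots> \<le> 270 * 1 / (1 + real n)\<^sup>2 + 288 / (1 + real n)\<^sup>2"
        using k by (intro add_mono divide_right_mono mult_left_mono) auto
      finally show ?thesis by (simp add: add_divide_distrib[symmetric])
    qed
    show "(\<lambda>p. damp \<kappa> s (fst p) * damp \<kappa> s (snd p)) \<in> wiener_class \<alpha> \<beta>"
    proof (rule main(1)[OF expands2_damp[OF s]])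
      fix n m
      have "norm (?G n) * norm (?G m) \<le> 558 / (1 + real n)\<^sup>2 * (558 / (1 + real m)\<^sup>2)"
        by (intro mult_mono G) auto
      thus "norm (case (n, m) of (n, m) \<Rightarrow> ?G n * ?G m) \<le> (558 * 558) / ((1 + real n)\<^sup>2 * (1 + real m)\<^sup>2)"
        by (simp add: norm_mult)
    qed
    have "wiener_norm \<alpha> \<beta> (\<lambda>p. (1 - fst p) ^ 4 * (1 - snd p) ^ 4 - damp \<kappa> s (fst p) * damp \<kappa> s (snd p)) \<le>
        (228420 * \<kappa>) * (SA * SB)"
    proof (rule main(2)[OF expands2_diff[OF q expands2_damp[OF s]]])
      fix n m
      have "?Q n * ?Q m - ?G n * ?G m = - ((?G n - ?Q n) * ?G m + ?Q n * (?G m - ?Q m))"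
        by (simp add: algebra_simps)
      hence "norm (?Q n * ?Q m - ?G n * ?G m) \<le> norm (?G n - ?Q n) * norm (?G m) + norm (?Q n) * norm (?G m - ?Q m)"
        by (metis norm_minus_cancel norm_mult norm_triangle_ineq)
      also have "\<dots> \<le> 270 * \<kappa> / (1 + real n)\<^sup>2 * (558 / (1 + real m)\<^sup>2) +
          288 / (1 + real n)\<^sup>2 * (270 * \<kappa> / (1 + real m)\<^sup>2)"
        by (intro add_mono mult_mono d G norm_quartic_coeff_le) (use k in auto)
      also have "\<dots> = 228420 * \<kappa> / ((1 + real n)\<^sup>2 * (1 + real m)\<^sup>2)"
        by (simp add: add_divide_distrib[symmetric])
      finally show "norm ((case (n, m) of (n, m) \<Rightarrow> ?Q n * ?Q m) - (case (n, m) of (n, m) \<Rightarrow> ?G n * ?G m)) \<le>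
          228420 * \<kappa> / ((1 + real n)\<^sup>2 * (1 + real m)\<^sup>2)" by simp
    qed
    thus "wiener_norm \<alpha> \<beta> (\<lambda>p. (1 - fst p) ^ 4 * (1 - snd p) ^ 4 - damp \<kappa> s (fst p) * damp \<kappa> s (snd p)) \<le>
        (228420 * (SA * SB)) * \<kappa>" by (simp add: mult_ac)
  qed
  thus ?thesis by blast
qed

section \<open>The closed ideal generated by f\<close>

text \<open>The closed ideal formed inside \<open>wiener_class\<close>: multipliers need summable
  coefficients but no boundary values, so Cauchy integrals and resolvents qualify directly.\<close>

definition principal_closure ::
    "real \<Rightarrow> real \<Rightarrow> (complex \<times> complex \<Rightarrow> complex) \<Rightarrow> (complex \<times> complex \<Rightarrow> complex) set"
  where "principal_closure \<alpha> \<beta> f =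
    {g \<in> wiener_class \<alpha> \<beta>. \<forall>e>0. \<exists>y\<in>wiener_class \<alpha> \<beta>. wiener_norm \<alpha> \<beta> (\<lambda>p. g p - f p * y p) < e}"

lemma principal_closureD:
  assumes "g \<in> principal_closure \<alpha> \<beta> f" "e > 0"
  obtains y where "y \<in> wiener_class \<alpha> \<beta>" "wiener_norm \<alpha> \<beta> (\<lambda>p. g p - f p * y p) < e"
  using assms unfolding principal_closure_def by blast

lemma principal_closure_closed:
  assumes f: "f \<in> wiener_class \<alpha> \<beta>" and g: "g \<in> wiener_class \<alpha> \<beta>" and ab: "0 \<le> \<alpha>" "0 \<le> \<beta>"
    and "\<And>e. e > 0 \<Longrightarrow> \<exists>h\<in>principal_closure \<alpha> \<beta> f. wiener_norm \<alpha> \<beta> (\<lambda>p. g p - h p) < e"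
  shows "g \<in> principal_closure \<alpha> \<beta> f"
  unfolding principal_closure_def
proof (intro CollectI conjI g allI impI)
  fix e :: real assume "e > 0"
  then obtain h where h: "h \<in> principal_closure \<alpha> \<beta> f" "wiener_norm \<alpha> \<beta> (\<lambda>p. g p - h p) < e / 2"
    using assms(5)[of "e / 2"] by auto
  obtain y where y: "y \<in> wiener_class \<alpha> \<beta>" "wiener_norm \<alpha> \<beta> (\<lambda>p. h p - f p * y p) < e / 2"
    using principal_closureD[OF h(1), of "e / 2"] \<open>e > 0\<close> by auto
  have hc: "h \<in> wiener_class \<alpha> \<beta>" using h by (simp add: principal_closure_def)
  have "wiener_norm \<alpha> \<beta> (\<lambda>p. (g p - h p) + (h p - f p * y p)) \<le>
      wiener_norm \<alpha> \<beta> (\<lambda>p. g p - h p) + wiener_norm \<alpha> \<beta> (\<lambda>p. h p - f p * y p)"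
    by (rule wiener_class_add(2)) (intro wiener_class_diff wiener_class_mult g hc f y(1) ab)+
  hence "wiener_norm \<alpha> \<beta> (\<lambda>p. g p - f p * y p) < e" using h y by simp
  thus "\<exists>y\<in>wiener_class \<alpha> \<beta>. wiener_norm \<alpha> \<beta> (\<lambda>p. g p - f p * y p) < e" using y by blast
qed

lemma principal_closure_mult:
  assumes f: "f \<in> wiener_class \<alpha> \<beta>" and h: "h \<in> wiener_class \<alpha> \<beta>" and ab: "0 \<le> \<alpha>" "0 \<le> \<beta>"
    and g: "g \<in> principal_closure \<alpha> \<beta> f"
  shows "(\<lambda>p. g p * h p) \<in> principal_closure \<alpha> \<beta> f"
  unfolding principal_closure_def
proof (intro CollectI conjI allI impI)
  have gc: "g \<in> wiener_class \<alpha> \<beta>" using g by (simp add: principal_closure_def)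
  show "(\<lambda>p. g p * h p) \<in> wiener_class \<alpha> \<beta>" by (rule wiener_class_mult[OF gc h ab])
  fix e :: real assume "e > 0"
  define K where "K = wiener_norm \<alpha> \<beta> h + 1"
  have K: "0 < K" "wiener_norm \<alpha> \<beta> h \<le> K"
    by (simp_all add: K_def add_nonneg_pos)
  obtain y where y: "y \<in> wiener_class \<alpha> \<beta>" "wiener_norm \<alpha> \<beta> (\<lambda>p. g p - f p * y p) < e / K"
    using principal_closureD[OF g, of "e / K"] \<open>e > 0\<close> K by auto
  have "wiener_norm \<alpha> \<beta> (\<lambda>p. (g p - f p * y p) * h p) \<le> wiener_norm \<alpha> \<beta> (\<lambda>p. g p - f p * y p) * wiener_norm \<alpha> \<beta> h"
    by (rule wiener_class_mult(2)[OF wiener_class_diff(1)[OF gc wiener_class_mult(1)[OF f y(1) ab]] h ab])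
  also have "\<dots> \<le> wiener_norm \<alpha> \<beta> (\<lambda>p. g p - f p * y p) * K"
    using K by (intro mult_left_mono) auto
  also have "\<dots> < e" using y K by (simp add: field_simps)
  finally have "wiener_norm \<alpha> \<beta> (\<lambda>p. g p * h p - f p * (y p * h p)) < e"
    by (simp add: algebra_simps)
  show "\<exists>y\<in>wiener_class \<alpha> \<beta>. wiener_norm \<alpha> \<beta> (\<lambda>p. g p * h p - f p * y p) < e"
  proof (rule bexI)
    show "wiener_norm \<alpha> \<beta> (\<lambda>p. g p * h p - f p * (y p * h p)) < e" by fact
    show "(\<lambda>p. y p * h p) \<in> wiener_class \<alpha> \<beta>" by (rule wiener_class_mult(1)[OF y(1) h ab])
  qed
qed

lemma principal_closure_add:
  assumes f: "f \<in> wiener_class \<alpha> \<beta>" and ab: "0 \<le> \<alpha>" "0 \<le> \<beta>"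
    and g: "g \<in> principal_closure \<alpha> \<beta> f" and h: "h \<in> principal_closure \<alpha> \<beta> f"
  shows "(\<lambda>p. g p + h p) \<in> principal_closure \<alpha> \<beta> f"
  unfolding principal_closure_def
proof (intro CollectI conjI allI impI)
  have gc: "g \<in> wiener_class \<alpha> \<beta>" and hc: "h \<in> wiener_class \<alpha> \<beta>" using g h by (auto simp: principal_closure_def)
  show "(\<lambda>p. g p + h p) \<in> wiener_class \<alpha> \<beta>" by (rule wiener_class_add[OF gc hc])
  fix e :: real assume "e > 0"
  hence e2: "e / 2 > 0" by simp
  obtain y where y: "y \<in> wiener_class \<alpha> \<beta>" "wiener_norm \<alpha> \<beta> (\<lambda>p. g p - f p * y p) < e / 2"
    by (rule principal_closureD[OF g e2])
  obtain x where x: "x \<in> wiener_class \<alpha> \<beta>" "wiener_norm \<alpha> \<beta> (\<lambda>p. h p - f p * x p) < e / 2"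
    by (rule principal_closureD[OF h e2])
  have "wiener_norm \<alpha> \<beta> (\<lambda>p. (g p - f p * y p) + (h p - f p * x p)) \<le>
      wiener_norm \<alpha> \<beta> (\<lambda>p. g p - f p * y p) + wiener_norm \<alpha> \<beta> (\<lambda>p. h p - f p * x p)"
    by (rule wiener_class_add(2)) (intro wiener_class_diff wiener_class_mult gc hc f y(1) x(1) ab)+
  hence "wiener_norm \<alpha> \<beta> (\<lambda>p. g p + h p - f p * (y p + x p)) < e"
    using x y by (simp add: algebra_simps)
  show "\<exists>y\<in>wiener_class \<alpha> \<beta>. wiener_norm \<alpha> \<beta> (\<lambda>p. g p + h p - f p * y p) < e"
  proof (rule bexI)
    show "wiener_norm \<alpha> \<beta> (\<lambda>p. g p + h p - f p * (y p + x p)) < e" by fact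
    show "(\<lambda>p. y p + x p) \<in> wiener_class \<alpha> \<beta>" by (rule wiener_class_add(1)[OF y(1) x(1)])
  qed
qed

lemma principal_closure_sum:
  assumes f: "f \<in> wiener_class \<alpha> \<beta>" and ab: "0 \<le> \<alpha>" "0 \<le> \<beta>"
    and "\<And>i. i \<in> I \<Longrightarrow> g i \<in> principal_closure \<alpha> \<beta> f"
  shows "(\<lambda>p. \<Sum>i\<in>I. g i p) \<in> principal_closure \<alpha> \<beta> f"
proof -
  have z: "(\<lambda>_. 0) \<in> principal_closure \<alpha> \<beta> f"
    unfolding principal_closure_def
  proof (intro CollectI conjI allI impI)
    fix e :: real assume "e > 0"
    moreover have "wiener_norm \<alpha> \<beta> (\<lambda>p. 0) = 0"
      using wiener_class_sum[of "{}" "\<lambda>_ _. 0" \<alpha> \<beta>] by (simp add: order.antisym)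
    ultimately show "\<exists>y\<in>wiener_class \<alpha> \<beta>. wiener_norm \<alpha> \<beta> (\<lambda>p. 0 - f p * y p) < e"
      by (intro bexI[of _ "\<lambda>_. 0"]) auto
  qed auto
  show ?thesis using assms(4)
    by (induction I rule: infinite_finite_induct) (auto intro: z principal_closure_add[OF f ab])
qed

section \<open>Lowering the powers of 1 - z and 1 - w\<close>

text \<open>Beyond \<open>K\<close> the ratio \<open>(1 + n) powr (1 - \<alpha>)\<close> is at least
  \<open>1 / \<eta>\<close>, which gives the linear term alone. Below \<open>K\<close> the left-hand
  side is at most \<open>1 + n\<close>, hence less than \<open>K\<close>.\<close>

lemma powr_le_linear:
  assumes "0 \<le> \<alpha>" "\<alpha> < 1" "\<eta> > 0"
  shows "\<exists>K\<ge>0. \<forall>n. (1 + real n) powr \<alpha> \<le> \<eta> * (1 + real n) + K"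
proof -
  define K where "K = (1 / \<eta>) powr (1 / (1 - \<alpha>))"
  have "(1 + real n) powr \<alpha> \<le> \<eta> * (1 + real n) + K" for n
  proof (cases "K \<le> 1 + real n")
    case True
    have "K powr (1 - \<alpha>) \<le> (1 + real n) powr (1 - \<alpha>)"
      using True assms by (intro powr_mono2) (auto simp: K_def)
    hence "1 / \<eta> \<le> (1 + real n) powr (1 - \<alpha>)"
      using assms by (simp add: K_def powr_powr)
    hence "1 / \<eta> * (1 + real n) powr \<alpha> \<le> (1 + real n) powr (1 - \<alpha>) * (1 + real n) powr \<alpha>"
      by (intro mult_right_mono) auto
    hence "(1 + real n) powr \<alpha> \<le> \<eta> * (1 + real n)"
      using assms by (simp add: powr_add[symmetric] field_simps)
    thus ?thesis by (simp add: K_def add_increasing2)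
  next
    case False
    have "(1 + real n) powr \<alpha> \<le> 1 + real n" using assms by (intro one_plus_powr_le) auto
    moreover have "0 \<le> \<eta> * (1 + real n)" using assms by simp
    ultimately show ?thesis using False by linarith
  qed
  thus ?thesis by (intro exI[of _ K]) (auto simp: K_def)
qed

text \<open>Here \<open>S\<close> is the norm of \<open>1 / (1 + e - z)\<close>.\<close>

lemma weighted_geometric_small:
  assumes "0 \<le> \<alpha>" "\<alpha> < 1" "\<eta> > 0"
  shows "\<exists>e S. 0 < e \<and> ((\<lambda>n. (1 + real n) powr \<alpha> * (1 / (1 + e)) ^ Suc n) has_sum S) UNIV \<and> e + e\<^sup>2 * S < \<eta>"
proof -
  obtain K where K: "K \<ge> 0" "\<And>n. (1 + real n) powr \<alpha> \<le> \<eta> / 4 * (1 + real n) + K"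
    using powr_le_linear[OF assms(1,2), of "\<eta> / 4"] assms by auto
  \<comment> \<open>This gives \<open>e \<le> 1\<close> and
    \<open>(1 + K) * e \<le> \<eta> / 4\<close>. The weighted geometric series contributes at most
    \<open>\<eta> / 2\<close> besides, so the total stays below \<open>\<eta>\<close>.\<close>
  define e where "e = min 1 (\<eta> / (4 * (1 + K)))"
  have e: "0 < e" "e \<le> 1" using K assms by (auto simp: e_def)
  define r where "r = 1 / (1 + e)"
  have r: "0 < r" "r < 1" "1 - r = e / (1 + e)" using e by (auto simp: r_def field_simps)
  have "(\<lambda>n. of_nat (Suc n) * r ^ n) sums (1 / (1 - r)^2)"
    using r by (intro geometric_deriv_sums) auto
  hence 1: "((\<lambda>n. (1 + real n) * r ^ n) has_sum (1 / (1 - r)^2)) UNIV"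
    using r by (intro sums_nonneg_imp_has_sum) (auto simp: add.commute)
  have "(\<lambda>n. r ^ n) sums (1 / (1 - r))"
    using r by (intro geometric_sums) auto
  hence 2: "((\<lambda>n. r ^ n) has_sum (1 / (1 - r))) UNIV"
    using r by (intro sums_nonneg_imp_has_sum) auto
  have 3: "((\<lambda>n. r * (\<eta> / 4) * ((1 + real n) * r ^ n) + r * K * r ^ n) has_sum
      (r * (\<eta> / 4) * (1 / (1 - r)^2) + r * K * (1 / (1 - r)))) UNIV"
    by (intro has_sum_add has_sum_cmult_right 1 2)
  have le: "(1 + real n) powr \<alpha> * r ^ Suc n \<le> r * (\<eta> / 4) * ((1 + real n) * r ^ n) + r * K * r ^ n" for n
    using mult_right_mono[OF K(2)[of n], of "r ^ Suc n"] r by (simp add: algebra_simps add_divide_distrib)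
  have s: "(\<lambda>n. (1 + real n) powr \<alpha> * r ^ Suc n) summable_on UNIV"
    by (rule summable_on_comparison_test[OF has_sum_imp_summable[OF 3] le]) (use r in auto)
  define S where "S = (\<Sum>\<^sub>\<infinity>n. (1 + real n) powr \<alpha> * r ^ Suc n)"
  have S: "((\<lambda>n. (1 + real n) powr \<alpha> * r ^ Suc n) has_sum S) UNIV"
    unfolding S_def by (rule has_sum_infsum[OF s])
  have "S \<le> r * (\<eta> / 4) * (1 / (1 - r)^2) + r * K * (1 / (1 - r))"
    by (rule has_sum_mono[OF S 3]) (rule le)
  hence "e\<^sup>2 * S \<le> e\<^sup>2 * (r * (\<eta> / 4) * (1 / (1 - r)^2) + r * K * (1 / (1 - r)))"
    by (intro mult_left_mono) auto
  also have "\<dots> = (1 + e) * (\<eta> / 4) + K * e"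
  proof -
    have a: "r * (1 / (1 - r)^2) = (1 + e) / e\<^sup>2"
      using e by (simp only: r(3)) (simp add: r_def power_divide power2_eq_square)
    have b: "r * (1 / (1 - r)) = 1 / e"
      using e by (simp only: r(3)) (simp add: r_def)
    have "e\<^sup>2 * (r * (\<eta> / 4) * (1 / (1 - r)^2) + r * K * (1 / (1 - r))) =
        e\<^sup>2 * (\<eta> / 4 * (r * (1 / (1 - r)^2)) + K * (r * (1 / (1 - r))))"
      by (simp only: mult_ac)
    also have "\<dots> = (1 + e) * (\<eta> / 4) + K * e"
      unfolding a b using e by (simp add: field_simps power2_eq_square)
    finally show ?thesis .
  qed
  also have "\<dots> \<le> 2 * (\<eta> / 4) + K * e"
    using e assms by (intro add_mono mult_right_mono) auto
  finally have "e + e\<^sup>2 * S \<le> \<eta> / 2 + (1 + K) * e" by (simp add: algebra_simps)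
  also have "(1 + K) * e \<le> (1 + K) * (\<eta> / (4 * (1 + K)))"
    using K by (intro mult_left_mono) (auto simp: e_def)
  also have "\<dots> = \<eta> / 4" using K(1) by (auto simp: divide_simps)
  finally have "e + e\<^sup>2 * S < \<eta>" using assms by simp
  thus ?thesis using e S by (auto simp: r_def)
qed

lemma one_plus_minus_nonzero: "0 < e \<Longrightarrow> norm z < 1 \<Longrightarrow> 1 + complex_of_real e - z \<noteq> 0"
proof
  assume "0 < e" "norm z < 1" "1 + complex_of_real e - z = 0"
  hence "z = of_real (1 + e)" by simp
  hence "norm z = \<bar>1 + e\<bar>" by (simp only: norm_of_real)
  thus False using \<open>0 < e\<close> \<open>norm z < 1\<close> by simp
qed

lemma geometric_has_sum_inverse:
  fixes z :: complex
  assumes "0 < e" "norm z < 1"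
  shows "((\<lambda>n. of_real ((1 / (1 + e)) ^ Suc n) * z ^ n) has_sum 1 / (1 + of_real e - z)) UNIV"
proof -
  define r where "r = 1 / (1 + e)"
  have r: "0 < r" "r < 1" using assms by (auto simp: r_def)
  have n: "norm (of_real r * z) < 1"
    using mult_strict_mono[of r 1 "norm z" 1] r assms by (simp add: norm_mult)
  have "summable (\<lambda>n. norm ((of_real r * z) ^ n))"
    unfolding norm_power by (rule summable_geometric) (use n in simp)
  hence "((\<lambda>n. (of_real r * z) ^ n) has_sum 1 / (1 - of_real r * z)) UNIV"
    by (rule norm_summable_imp_has_sum) (rule geometric_sums[OF n])
  hence "((\<lambda>n. of_real r * (of_real r * z) ^ n) has_sum of_real r * (1 / (1 - of_real r * z))) UNIV"
    by (rule has_sum_cmult_right)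
  moreover have "of_real r * (1 / (1 - of_real r * z)) = 1 / (1 + of_real e - z)"
  proof -
    have "of_real (1 + e) * of_real r = (1::complex)"
      unfolding of_real_mult[symmetric] r_def using assms by simp
    hence "(1 + of_real e) * of_real r = (1::complex)" by simp
    moreover note one_plus_minus_nonzero[OF assms]
    moreover have "1 - of_real r * z \<noteq> 0"
      using n by auto
    ultimately show ?thesis by (simp add: field_simps)
  qed
  moreover have "(\<lambda>n. of_real r * (of_real r * z) ^ n) = (\<lambda>n. of_real (r ^ Suc n) * z ^ n)"
    by (simp add: power_mult_distrib mult_ac)
  ultimately show ?thesis by (simp add: r_def)
qed

text \<open>Here \<open>v\<close> inverts \<open>1 + e - x\<close>. Replacing \<open>1 - x\<close>
  by \<open>(1 - x) ^ 2 * v\<close> makes the error \<open>e * (1 - x) * v = e - e ^ 2 * v\<close>,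
  and the quantity required to be small is the resulting bound for its norm.\<close>

definition resolvent_bounded :: "real \<Rightarrow> real \<Rightarrow> (complex \<times> complex \<Rightarrow> complex) \<Rightarrow> bool"
  where "resolvent_bounded \<alpha> \<beta> x \<longleftrightarrow> (\<forall>\<eta>>0. \<exists>e>0. \<exists>v\<in>wiener_class \<alpha> \<beta>.
    (\<forall>p\<in>open_bidisc. v p * (1 + of_real e - x p) = 1) \<and> e + e\<^sup>2 * wiener_norm \<alpha> \<beta> v < \<eta>)"

lemma one_has_sum: "((\<lambda>n. (if n = 0 then 1 else 0) * z ^ n) has_sum (1::complex)) UNIV"
  by (rule has_sum_finite_neutralI[of "{0}"]) auto

text \<open>The inverse is a geometric series in the first variable alone, so its norm is a
  one-dimensional weighted sum, whatever \<open>\<beta>\<close> is.\<close>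

lemma resolvent_bounded_fst:
  assumes "0 \<le> \<alpha>" "\<alpha> < 1"
  shows "resolvent_bounded \<alpha> \<beta> fst"
  unfolding resolvent_bounded_def
proof (intro allI impI)
  fix \<eta> :: real assume "\<eta> > 0"
  from weighted_geometric_small[OF assms this] obtain e S where e: "0 < e"
    and S': "((\<lambda>n. (1 + real n) powr \<alpha> * (1 / (1 + e)) ^ Suc n) has_sum S) UNIV" and le: "e + e\<^sup>2 * S < \<eta>"
    by blast
  define \<rho> where "\<rho> = 1 / (1 + e)"
  have rho: "0 \<le> \<rho>" using e by (simp add: \<rho>_def)
  note S = S'[folded \<rho>_def]
  have geo: "((\<lambda>n. of_real (\<rho> ^ Suc n) * z ^ n) has_sum 1 / (1 + of_real e - z)) UNIV"
    if "z \<in> ball 0 1" for z :: complex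
    using geometric_has_sum_inverse[OF e, folded \<rho>_def] that by auto
  have ex: "expands2 (\<lambda>(z, w). 1 / (1 + of_real e - z) * 1) (\<lambda>(n, m). of_real (\<rho> ^ Suc n) * (if m = 0 then 1 else 0))"
    by (rule expands2_tensor[OF geo one_has_sum])
  have ms: "((\<lambda>m::nat. if m = 0 then 1 else 0::real) has_sum 1) UNIV"
    by (rule has_sum_finite_neutralI[of "{0}"]) auto
  have hs: "((\<lambda>(n, m::nat). ((1 + real n) powr \<alpha> * \<rho> ^ Suc n) * (if m = 0 then 1 else 0)) has_sum S * 1) UNIV"
    by (rule has_sum_tensor_nonneg[OF S ms]) (use rho in auto)
  have bd: "norm ((\<lambda>(n, m). of_real (\<rho> ^ Suc n) * (if m = 0 then 1 else 0)) p :: complex) * wiener_weight \<alpha> \<beta> p \<le> (\<lambda>(n, m::nat). ((1 + real n) powr \<alpha> * \<rho> ^ Suc n) * (if m = 0 then 1 else 0)) p" for p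
    using rho by (cases p) (simp add: wiener_weight_def norm_mult norm_power abs_mult)
  note v = wiener_norm_le[OF ex bd hs]
  have "e + e\<^sup>2 * wiener_norm \<alpha> \<beta> (\<lambda>(z, w). 1 / (1 + of_real e - z) * 1) < \<eta>"
    using mult_left_mono[OF v(2), of "e\<^sup>2"] le by simp
  moreover have "(\<lambda>(z, w). 1 / (1 + of_real e - z) * 1) p * (1 + of_real e - fst p) = 1" if "p \<in> open_bidisc" for p
    using one_plus_minus_nonzero[OF e] that by (cases p) simp
  ultimately show "\<exists>e>0. \<exists>v\<in>wiener_class \<alpha> \<beta>. (\<forall>p\<in>open_bidisc. v p * (1 + of_real e - fst p) = 1) \<and>
      e + e\<^sup>2 * wiener_norm \<alpha> \<beta> v < \<eta>"
    using e v(1) by (intro exI[of _ e] conjI bexI[of _ "(\<lambda>(z, w). 1 / (1 + of_real e - z) * 1)"]) auto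
qed

lemma resolvent_bounded_snd:
  assumes "0 \<le> \<beta>" "\<beta> < 1"
  shows "resolvent_bounded \<alpha> \<beta> snd"
  unfolding resolvent_bounded_def
proof (intro allI impI)
  fix \<eta> :: real assume "\<eta> > 0"
  from weighted_geometric_small[OF assms this] obtain e S where e: "0 < e"
    and S': "((\<lambda>n. (1 + real n) powr \<beta> * (1 / (1 + e)) ^ Suc n) has_sum S) UNIV" and le: "e + e\<^sup>2 * S < \<eta>"
    by blast
  define \<rho> where "\<rho> = 1 / (1 + e)"
  have rho: "0 \<le> \<rho>" using e by (simp add: \<rho>_def)
  note S = S'[folded \<rho>_def]
  have geo: "((\<lambda>n. of_real (\<rho> ^ Suc n) * z ^ n) has_sum 1 / (1 + of_real e - z)) UNIV"
    if "z \<in> ball 0 1" for z :: complex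
    using geometric_has_sum_inverse[OF e, folded \<rho>_def] that by auto
  have ex: "expands2 (\<lambda>(z, w). 1 * (1 / (1 + of_real e - w))) (\<lambda>(n, m). (if n = 0 then 1 else 0) * of_real (\<rho> ^ Suc m))"
    by (rule expands2_tensor[OF one_has_sum geo])
  have ms: "((\<lambda>m::nat. if m = 0 then 1 else 0::real) has_sum 1) UNIV"
    by (rule has_sum_finite_neutralI[of "{0}"]) auto
  have hs: "((\<lambda>(n::nat, m). (if n = 0 then 1 else 0) * ((1 + real m) powr \<beta> * \<rho> ^ Suc m)) has_sum 1 * S) UNIV"
    by (rule has_sum_tensor_nonneg[OF ms S]) (use rho in auto)
  have bd: "norm ((\<lambda>(n, m). (if n = 0 then 1 else 0) * of_real (\<rho> ^ Suc m)) p :: complex) * wiener_weight \<alpha> \<beta> p \<le> (\<lambda>(n::nat, m). (if n = 0 then 1 else 0) * ((1 + real m) powr \<beta> * \<rho> ^ Suc m)) p" for p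
    using rho by (cases p) (simp add: wiener_weight_def norm_mult norm_power abs_mult)
  note v = wiener_norm_le[OF ex bd hs]
  have "e + e\<^sup>2 * wiener_norm \<alpha> \<beta> (\<lambda>(z, w). 1 * (1 / (1 + of_real e - w))) < \<eta>"
    using mult_left_mono[OF v(2), of "e\<^sup>2"] le by simp
  moreover have "(\<lambda>(z, w). 1 * (1 / (1 + of_real e - w))) p * (1 + of_real e - snd p) = 1" if "p \<in> open_bidisc" for p
    using one_plus_minus_nonzero[OF e] that by (cases p) simp
  ultimately show "\<exists>e>0. \<exists>v\<in>wiener_class \<alpha> \<beta>. (\<forall>p\<in>open_bidisc. v p * (1 + of_real e - snd p) = 1) \<and>
      e + e\<^sup>2 * wiener_norm \<alpha> \<beta> v < \<eta>"
    using e v(1) by (intro exI[of _ e] conjI bexI[of _ "(\<lambda>(z, w). 1 * (1 / (1 + of_real e - w)))"]) auto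
qed

text \<open>Multiplying the given element by the resolvent \<open>v\<close> keeps it in the closed
  ideal. Its distance from the desired element is the norm of
  \<open>(1 - x) ^ k * h * (e - e ^ 2 * v)\<close>, which the resolvent bound makes arbitrarily
  small.\<close>

lemma principal_closure_reduce_power:
  assumes f: "f \<in> wiener_class \<alpha> \<beta>" and x: "x \<in> wiener_class \<alpha> \<beta>" and h: "h \<in> wiener_class \<alpha> \<beta>"
    and ab: "0 \<le> \<alpha>" "0 \<le> \<beta>" and res: "resolvent_bounded \<alpha> \<beta> x"
    and mem: "(\<lambda>p. (1 - x p) ^ Suc (Suc k) * h p) \<in> principal_closure \<alpha> \<beta> f"
  shows "(\<lambda>p. (1 - x p) ^ Suc k * h p) \<in> principal_closure \<alpha> \<beta> f"
proof (rule principal_closure_closed[OF f _ ab])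
  have xc: "(\<lambda>p. (1 - x p) ^ n * h p) \<in> wiener_class \<alpha> \<beta>" for n
    by (intro wiener_class_mult wiener_class_power wiener_class_diff wiener_class_const x h ab)
  show "(\<lambda>p. (1 - x p) ^ Suc k * h p) \<in> wiener_class \<alpha> \<beta>" by (rule xc)
  fix d :: real assume "d > 0"
  define K where "K = wiener_norm \<alpha> \<beta> (\<lambda>p. (1 - x p) ^ k * h p) + 1"
  have K: "0 < K" "wiener_norm \<alpha> \<beta> (\<lambda>p. (1 - x p) ^ k * h p) \<le> K"
    by (simp_all add: K_def add_nonneg_pos)
  have one: "wiener_norm \<alpha> \<beta> (\<lambda>_. 1) = 1"
    using wiener_norm_monomial[of \<alpha> \<beta> 1 0 0] by (simp add: wiener_weight_def)
  obtain e v where e: "e > 0" and v: "v \<in> wiener_class \<alpha> \<beta>" "\<And>p. p \<in> open_bidisc \<Longrightarrow> v p * (1 + of_real e - x p) = 1"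
    and le: "e + e\<^sup>2 * wiener_norm \<alpha> \<beta> v < d / K"
    using res[unfolded resolvent_bounded_def, rule_format, of "d / K"] \<open>d > 0\<close> K(1) by auto
  define g where "g = (\<lambda>p. (1 - x p) ^ Suc (Suc k) * h p * v p)"
  have g: "g \<in> principal_closure \<alpha> \<beta> f"
    unfolding g_def by (rule principal_closure_mult[OF f v(1) ab mem])
  define u where "u = (\<lambda>p. of_real e * 1 - of_real (e\<^sup>2) * v p)"
  have uc: "u \<in> wiener_class \<alpha> \<beta>"
    unfolding u_def by (intro wiener_class_diff wiener_class_cmult wiener_class_const v)
  have un: "wiener_norm \<alpha> \<beta> u \<le> e + e\<^sup>2 * wiener_norm \<alpha> \<beta> v"
  proof -
    have "wiener_norm \<alpha> \<beta> u \<le> wiener_norm \<alpha> \<beta> (\<lambda>p. of_real e * 1) + wiener_norm \<alpha> \<beta> (\<lambda>p. of_real (e\<^sup>2) * v p)"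
      unfolding u_def by (intro wiener_class_diff wiener_class_cmult wiener_class_const v)
    thus ?thesis
      using wiener_class_cmult(2)[OF wiener_class_const, of \<alpha> \<beta> "of_real e" 1]
        wiener_class_cmult(2)[OF v(1), of "of_real (e\<^sup>2)"] e one by (simp add: norm_power)
  qed
  have "wiener_norm \<alpha> \<beta> (\<lambda>p. (1 - x p) ^ Suc k * h p - g p) = wiener_norm \<alpha> \<beta> (\<lambda>p. ((1 - x p) ^ k * h p) * u p)"
  proof (rule wiener_norm_cong)
    fix p :: "complex \<times> complex" assume "p \<in> open_bidisc"
    hence A: "(1 - x p) * v p = 1 - of_real e * v p" using v(2)[of p] by (simp add: algebra_simps)
    have "(1 - x p) - (1 - x p) * ((1 - x p) * v p) = (1 - x p) - (1 - x p) * (1 - of_real e * v p)"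
      by (simp only: A)
    also have "\<dots> = of_real e * ((1 - x p) * v p)" by (simp add: algebra_simps)
    also have "\<dots> = of_real e * 1 - of_real (e\<^sup>2) * v p"
      unfolding A by (simp add: algebra_simps power2_eq_square)
    finally have "(1 - x p) ^ k * h p * ((1 - x p) - (1 - x p) * ((1 - x p) * v p)) = (1 - x p) ^ k * h p * u p"
      by (simp add: u_def)
    thus "(1 - x p) ^ Suc k * h p - g p = (1 - x p) ^ k * h p * u p"
      by (simp add: g_def algebra_simps)
  qed
  also have "\<dots> \<le> wiener_norm \<alpha> \<beta> (\<lambda>p. (1 - x p) ^ k * h p) * wiener_norm \<alpha> \<beta> u"
    by (rule wiener_class_mult(2)[OF xc uc ab])
  also have "\<dots> \<le> K * (e + e\<^sup>2 * wiener_norm \<alpha> \<beta> v)"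
    using K un by (intro mult_mono) auto
  also have "\<dots> < d" using le K by (simp add: field_simps)
  finally show "\<exists>g\<in>principal_closure \<alpha> \<beta> f. wiener_norm \<alpha> \<beta> (\<lambda>p. (1 - x p) ^ Suc k * h p - g p) < d"
    using g by blast
qed

text \<open>Half of the error is spent on replacing the quartic by its damped form, which fixes
  \<open>\<kappa>\<close> for all \<open>s\<close> at once; the other half on dividing the damped
  form by \<open>f\<close>, at an \<open>s\<close> that depends on \<open>\<kappa>\<close>.\<close>

lemma quartic_in_principal_closure:
  fixes f :: "complex \<times> complex \<Rightarrow> complex"
  assumes f: "f \<in> wiener_class \<alpha> \<beta>" and ab: "0 < \<alpha>" "\<alpha> < 1" "0 < \<beta>" "\<beta> < 1"
    and low: "\<And>\<epsilon>. \<epsilon> > 0 \<Longrightarrow> \<exists>s0>0. \<forall>s x y. 0 < s \<longrightarrow> s < s0 \<longrightarrow> norm x < 1 \<longrightarrow> norm y < 1 \<longrightarrow>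
      s / 8 \<le> norm (1 - x) \<longrightarrow> s / 8 \<le> norm (1 - y) \<longrightarrow> exp (- (8 * \<epsilon> / s)) \<le> norm (f (x, y))"
  shows "(\<lambda>p. (1 - fst p) ^ 4 * (1 - snd p) ^ 4) \<in> principal_closure \<alpha> \<beta> f"
  unfolding principal_closure_def
proof (intro CollectI conjI allI impI)
  let ?X = "\<lambda>p::complex \<times> complex. (1 - fst p) ^ 4 * (1 - snd p) ^ 4"
  have X: "?X \<in> wiener_class \<alpha> \<beta>"
    by (intro wiener_class_mult wiener_class_power wiener_class_diff wiener_class_const) (use ab in auto)
  thus "?X \<in> wiener_class \<alpha> \<beta>" .
  fix e :: real assume "e > 0"
  obtain C where C: "\<And>\<kappa> s. 0 \<le> \<kappa> \<Longrightarrow> \<kappa> \<le> 1 \<Longrightarrow> 0 < s \<Longrightarrow>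
    (\<lambda>p. damp \<kappa> s (fst p) * damp \<kappa> s (snd p)) \<in> wiener_class \<alpha> \<beta> \<and>
    wiener_norm \<alpha> \<beta> (\<lambda>p. ?X p - damp \<kappa> s (fst p) * damp \<kappa> s (snd p)) \<le> C * \<kappa>"
    using damp_norm_close[OF ab(2,4)] by blast
  define \<kappa> where "\<kappa> = min 1 (e / (2 * (1 + \<bar>C\<bar>)))"
  have k: "0 < \<kappa>" "\<kappa> \<le> 1" using \<open>e > 0\<close> by (auto simp: \<kappa>_def)
  have "C * \<kappa> \<le> (1 + \<bar>C\<bar>) * (e / (2 * (1 + \<bar>C\<bar>)))"
    using k by (intro mult_mono) (auto simp: \<kappa>_def)
  also have "\<dots> = e / 2"
  proof -
    have "1 + \<bar>C\<bar> \<noteq> 0" using abs_ge_zero[of C] by linarith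
    thus ?thesis by (auto simp: divide_simps)
  qed
  finally have Ck: "C * \<kappa> \<le> e / 2" .
  obtain s y where s: "0 < s" and y: "y \<in> wiener_class \<alpha> \<beta>"
    "wiener_norm \<alpha> \<beta> (\<lambda>p. damp \<kappa> s (fst p) * damp \<kappa> s (snd p) - f p * y p) < e / 2"
    using damp_approximation[OF f ab(1) less_imp_le[OF ab(2)] ab(3) less_imp_le[OF ab(4)] k(1) low, of "e / 2"] \<open>e > 0\<close>
    by auto
  let ?E = "\<lambda>p. damp \<kappa> s (fst p) * damp \<kappa> s (snd p)"
  have E: "?E \<in> wiener_class \<alpha> \<beta>" "wiener_norm \<alpha> \<beta> (\<lambda>p. ?X p - ?E p) \<le> e / 2"
    using C[of \<kappa> s] k s Ck by auto
  have "wiener_norm \<alpha> \<beta> (\<lambda>p. (?X p - ?E p) + (?E p - f p * y p)) \<le>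
      wiener_norm \<alpha> \<beta> (\<lambda>p. ?X p - ?E p) + wiener_norm \<alpha> \<beta> (\<lambda>p. ?E p - f p * y p)"
    by (rule wiener_class_add(2))
      (rule wiener_class_diff X E wiener_class_mult f y(1) less_imp_le[OF ab(1)] less_imp_le[OF ab(3)])+
  hence "wiener_norm \<alpha> \<beta> (\<lambda>p. ?X p - f p * y p) < e" using E(2) y(2) by simp
  thus "\<exists>y\<in>wiener_class \<alpha> \<beta>. wiener_norm \<alpha> \<beta> (\<lambda>p. ?X p - f p * y p) < e" using y(1) by blast
qed

lemma linear_in_principal_closure:
  assumes f: "f \<in> wiener_class \<alpha> \<beta>" and ab: "0 \<le> \<alpha>" "\<alpha> < 1" "0 \<le> \<beta>" "\<beta> < 1"
    and mem: "(\<lambda>p. (1 - fst p) ^ 4 * (1 - snd p) ^ 4) \<in> principal_closure \<alpha> \<beta> f"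
  shows "(\<lambda>p. (1 - fst p) * (1 - snd p)) \<in> principal_closure \<alpha> \<beta> f"
proof -
  have c: "(\<lambda>p. (1 - x p) ^ k) \<in> wiener_class \<alpha> \<beta>" if "x \<in> wiener_class \<alpha> \<beta>" for x k
    by (rule wiener_class_power[OF wiener_class_diff(1)[OF wiener_class_const that] ab(1,3)])
  have red: "(\<lambda>p. (1 - x p) ^ 1 * h p) \<in> principal_closure \<alpha> \<beta> f"
    if x: "x \<in> wiener_class \<alpha> \<beta>" "resolvent_bounded \<alpha> \<beta> x" and h: "h \<in> wiener_class \<alpha> \<beta>"
      and m: "(\<lambda>p. (1 - x p) ^ 4 * h p) \<in> principal_closure \<alpha> \<beta> f" for x h
  proof -
    note r = principal_closure_reduce_power[OF f x(1) h ab(1,3) x(2)]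
    have "(\<lambda>p. (1 - x p) ^ Suc (Suc (Suc (Suc 0))) * h p) \<in> principal_closure \<alpha> \<beta> f"
      using m by (simp add: numeral_eq_Suc)
    from r[OF r[OF r[OF this]]] show ?thesis by simp
  qed
  have "(\<lambda>p. (1 - fst p) ^ 1 * (1 - snd p) ^ 4) \<in> principal_closure \<alpha> \<beta> f"
    by (rule red[OF wiener_class_fst resolvent_bounded_fst[OF ab(1,2)] c[OF wiener_class_snd] mem])
  hence "(\<lambda>p. (1 - snd p) ^ 4 * (1 - fst p) ^ 1) \<in> principal_closure \<alpha> \<beta> f"
    by (simp only: mult.commute)
  from red[OF wiener_class_snd resolvent_bounded_snd[OF ab(3,4)] c[OF wiener_class_fst] this]
  show ?thesis by (simp add: mult.commute)
qed

section \<open>Functions that vanish on the zero set\<close>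

text \<open>Absolute convergence on the closed bidisc is clear, as the weight is at least 1. That
  the sum is the boundary value of \<open>g\<close> follows from the truncations, which approximate
  both within the norm of the remainder.\<close>

lemma expands2_closed_bidisc:
  assumes g: "g \<in> wiener_class \<alpha> \<beta>" and cont: "continuous_on closed_bidisc g" and ab: "0 \<le> \<alpha>" "0 \<le> \<beta>"
    and zw: "norm z \<le> 1" "norm w \<le> 1"
  shows "((\<lambda>(n, m). coeff2 g (n, m) * z ^ n * w ^ m) has_sum g (z, w)) UNIV"
proof -
  define a where "a = coeff2 g"
  define F where "F = (\<lambda>(n, m). a (n, m) * z ^ n * w ^ m)"
  have a_le: "norm (a p) \<le> norm (a p) * wiener_weight \<alpha> \<beta> p" for p
    using mult_left_mono[OF wiener_weight_ge_1[OF ab, of p], of "norm (a p)"] by simp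
  have F_le: "norm (F p) \<le> norm (a p)" for p
    unfolding F_def using zw by (cases p) (simp add: norm_monomial_le)
  have aw: "(\<lambda>p. norm (a p) * wiener_weight \<alpha> \<beta> p) summable_on UNIV"
    unfolding a_def by (rule wiener_classD(2)[OF g])
  have "(\<lambda>p. norm (F p)) summable_on UNIV"
    by (rule summable_on_comparison_test[OF aw]) (use F_le a_le order.trans in \<open>auto, blast\<close>)
  hence hs: "(F has_sum infsum F UNIV) UNIV"
    by (rule has_sum_infsum[OF abs_summable_summable])
  have "norm (infsum F UNIV - g (z, w)) < e" if "e > 0" for e
  proof -
    obtain N where N: "wiener_norm \<alpha> \<beta> (\<lambda>p. g p - truncation N g p) < e / 2"
      using truncation_tendsto[OF g, of "e / 2"] \<open>e > 0\<close> by auto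
    let ?B = "{..<N} \<times> {..<N}"
    have t: "(\<lambda>p. g p - truncation N g p) \<in> wiener_class \<alpha> \<beta>"
      by (rule wiener_class_diff(1)[OF g wiener_class_truncation])
    have tc: "continuous_on closed_bidisc (\<lambda>p. g p - truncation N g p)"
      using truncation_in_bidisc_algebra[of N g] cont
      by (intro continuous_on_diff) (auto simp: bidisc_algebra_def)
    have 1: "norm (g (z, w) - truncation N g (z, w)) < e / 2"
      using norm_le_wiener_norm_closed[OF t tc _ ab, of "(z, w)"] zw N by auto
    have "((\<lambda>p. if p \<in> ?B then F p else 0) has_sum sum F ?B) UNIV"
      by (rule has_sum_finite_neutralI[of ?B]) (auto intro!: sum.cong)
    from has_sum_add[OF hs has_sum_uminusI[OF this]]
    have "((\<lambda>p. F p + - (if p \<in> ?B then F p else 0)) has_sum (infsum F UNIV - sum F ?B)) UNIV" by simp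
    moreover have "((\<lambda>p. norm (coeff2 (\<lambda>p. g p - truncation N g p) p) * wiener_weight \<alpha> \<beta> p) has_sum
        wiener_norm \<alpha> \<beta> (\<lambda>p. g p - truncation N g p)) UNIV"
      unfolding wiener_norm_def by (rule has_sum_infsum[OF wiener_classD(2)[OF t]])
    ultimately have "norm (infsum F UNIV - sum F ?B) \<le> wiener_norm \<alpha> \<beta> (\<lambda>p. g p - truncation N g p)"
    proof (rule norm_infsum_le)
      fix p :: "nat \<times> nat"
      show "norm (F p + - (if p \<in> ?B then F p else 0)) \<le>
          norm (coeff2 (\<lambda>p. g p - truncation N g p) p) * wiener_weight \<alpha> \<beta> p"
        unfolding coeff2_eq[OF expands2_tail[OF g]]
        using order.trans[OF F_le[of p] a_le[of p]] by (auto simp: a_def)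
    qed
    moreover have "sum F ?B = truncation N g (z, w)"
      by (simp add: truncation_def F_def a_def)
    ultimately show ?thesis
      using 1 N norm_triangle_ineq4[of "infsum F UNIV - sum F ?B" "g (z, w) - truncation N g (z, w)"] by simp
  qed
  hence "infsum F UNIV = g (z, w)"
    by (metis dense_ge less_irrefl norm_le_zero_iff right_minus_eq less_imp_le)
  thus ?thesis using hs by (simp add: F_def a_def)
qed

text \<open>Summed over \<open>n\<close> first, the double series is a power series in
  \<open>w\<close> whose coefficients are the column sums; it vanishes identically, so they are all
  0.\<close>

lemma column_sums_zero:
  fixes a :: "nat \<times> nat \<Rightarrow> complex"
  assumes a: "(\<lambda>p. norm (a p)) summable_on UNIV"
    and "\<And>w. norm w < 1 \<Longrightarrow> ((\<lambda>(n, m). a (n, m) * w ^ m) has_sum 0) UNIV"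
  shows "((\<lambda>n. a (n, m)) has_sum 0) UNIV"
proof -
  have "(\<lambda>p. norm (a p)) summable_on (UNIV \<times> UNIV)" using a by simp
  hence "(\<lambda>(n, m). norm (a (n, m))) summable_on (UNIV \<times> UNIV)" by (simp add: case_prod_unfold)
  hence "(\<lambda>(m, n). norm (a (n, m))) summable_on (UNIV \<times> UNIV)"
    by (subst (asm) summable_on_swap) simp
  hence "(\<lambda>n. norm (a (n, m))) summable_on UNIV" for m
    using summable_on_SigmaD1[of "\<lambda>m n. norm (a (n, m))" UNIV "\<lambda>_. UNIV" m] by simp
  hence col: "((\<lambda>n. a (n, m)) has_sum infsum (\<lambda>n. a (n, m)) UNIV) UNIV" for m
    by (rule has_sum_infsum[OF abs_summable_summable])
  have "infsum (\<lambda>n. a (n, m)) UNIV = 0" for m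
  proof (rule powser_coeff_unique0)
    fix w :: complex assume w: "w \<in> ball 0 1"
    have "((\<lambda>(n, m). a (n, m) * w ^ m) has_sum 0) (UNIV \<times> UNIV)" using assms(2)[of w] w by simp
    hence "((\<lambda>(m, n). a (n, m) * w ^ m) has_sum 0) (UNIV \<times> UNIV)"
      by (subst (asm) has_sum_swap) simp
    thus "((\<lambda>m. infsum (\<lambda>n. a (n, m)) UNIV * w ^ m) has_sum 0) UNIV"
      by (rule has_sum_SigmaD) (auto intro!: has_sum_cmult_left col)
  qed
  thus ?thesis using col[of m] by simp
qed

text \<open>As the full column sums vanish, a partial sum is minus the rest of its column. That rest
  lies outside the square, so all columns together are controlled by the norm \<open>\<tau>\<close>
  of the remainder.\<close>

lemma column_sums_bound:
  fixes a :: "nat \<times> nat \<Rightarrow> complex"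
  assumes d: "((\<lambda>p. if p \<in> {..<N} \<times> {..<N} then 0 else norm (a p) * wiener_weight \<alpha> \<beta> p) has_sum \<tau>) UNIV"
    and col: "\<And>m. ((\<lambda>n. a (n, m)) has_sum 0) UNIV" and "0 \<le> \<alpha>"
  shows "(\<Sum>m<N. norm (\<Sum>n<N. a (n, m)) * (1 + real m) powr \<beta>) \<le> \<tau>"
proof -
  define h where "h = (\<lambda>n m. if (n, m) \<in> {..<N} \<times> {..<N} then 0 else norm (a (n, m)) * wiener_weight \<alpha> \<beta> (n, m))"
  have h0: "0 \<le> h n m" for n m by (simp add: h_def)
  have "(\<lambda>(n, m). h n m) = (\<lambda>p. if p \<in> {..<N} \<times> {..<N} then 0 else norm (a p) * wiener_weight \<alpha> \<beta> p)"
    by (auto simp: fun_eq_iff h_def)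
  hence "((\<lambda>(n, m). h n m) has_sum \<tau>) (UNIV \<times> UNIV)"
    using d by simp
  hence hs: "((\<lambda>(m, n). h n m) has_sum \<tau>) (UNIV \<times> UNIV)"
    by (subst (asm) has_sum_swap) simp
  have s: "(\<lambda>n. h n m) summable_on UNIV" for m
    using summable_on_SigmaD1[of "\<lambda>m n. h n m" UNIV "\<lambda>_. UNIV" m] has_sum_imp_summable[OF hs] by simp
  have S: "((\<lambda>m. infsum (\<lambda>n. h n m) UNIV) has_sum \<tau>) UNIV"
    by (rule has_sum_SigmaD[OF hs]) (simp add: has_sum_infsum[OF s])
  have "norm (\<Sum>n<N. a (n, m)) * (1 + real m) powr \<beta> \<le> infsum (\<lambda>n. h n m) UNIV" if m: "m < N" for m
  proof -
    have "((\<lambda>n. if n < N then a (n, m) else 0) has_sum (\<Sum>n<N. a (n, m))) UNIV"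
      by (rule has_sum_finite_neutralI[of "{..<N}"]) auto
    from has_sum_add[OF col[of m] has_sum_uminusI[OF this]]
    have "((\<lambda>n. a (n, m) + - (if n < N then a (n, m) else 0)) has_sum - (\<Sum>n<N. a (n, m))) UNIV" by simp
    from has_sum_cmult_right[OF this, of "of_real ((1 + real m) powr \<beta>)"]
    have "norm (of_real ((1 + real m) powr \<beta>) * - (\<Sum>n<N. a (n, m))) \<le> infsum (\<lambda>n. h n m) UNIV"
    proof (rule norm_infsum_le[OF _ has_sum_infsum[OF s]])
      fix n
      have "(1 + real m) powr \<beta> * norm (a (n, m)) \<le> norm (a (n, m)) * wiener_weight \<alpha> \<beta> (n, m)"
      proof -
        have "1 \<le> (1 + real n) powr \<alpha>" using \<open>0 \<le> \<alpha>\<close> by (intro ge_one_powr_ge_zero) auto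
        hence "1 * (1 + real m) powr \<beta> \<le> wiener_weight \<alpha> \<beta> (n, m)"
          unfolding wiener_weight_def prod.case by (intro mult_right_mono) auto
        hence "norm (a (n, m)) * (1 * (1 + real m) powr \<beta>) \<le> norm (a (n, m)) * wiener_weight \<alpha> \<beta> (n, m)"
          by (rule mult_left_mono) simp
        thus ?thesis by (simp add: mult.commute)
      qed
      thus "norm (of_real ((1 + real m) powr \<beta>) * (a (n, m) + - (if n < N then a (n, m) else 0))) \<le> h n m"
        using m by (auto simp: h_def norm_mult)
    qed
    thus ?thesis by (simp add: norm_mult mult.commute)
  qed
  hence "(\<Sum>m<N. norm (\<Sum>n<N. a (n, m)) * (1 + real m) powr \<beta>) \<le> (\<Sum>m<N. infsum (\<lambda>n. h n m) UNIV)"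
    by (intro sum_mono) auto
  also have "\<dots> \<le> \<tau>"
    by (rule finite_sum_le_has_sum[OF S]) (auto intro: infsum_nonneg h0)
  finally show ?thesis .
qed

lemma power_minus_one_product:
  fixes u v c :: "'a::comm_ring_1"
  shows "(1 - u) * (1 - v) * (\<Sum>i<n. \<Sum>j<m. c * u ^ i * v ^ j) = c * (u ^ n - 1) * (v ^ m - 1)"
proof -
  have "(\<Sum>i<n. \<Sum>j<m. c * u ^ i * v ^ j) = (\<Sum>i<n. c * u ^ i) * (\<Sum>j<m. v ^ j)"
    by (rule sum_product[symmetric])
  also have "(\<Sum>i<n. c * u ^ i) = c * (\<Sum>i<n. u ^ i)"
    by (rule sum_distrib_left[symmetric])
  finally have e: "(\<Sum>i<n. \<Sum>j<m. c * u ^ i * v ^ j) = c * (\<Sum>i<n. u ^ i) * (\<Sum>j<m. v ^ j)" .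
  have "(1 - u) * (1 - v) * (\<Sum>i<n. \<Sum>j<m. c * u ^ i * v ^ j) =
      c * ((1 - u) * (\<Sum>i<n. u ^ i)) * ((1 - v) * (\<Sum>j<m. v ^ j))"
    unfolding e by (simp only: mult_ac)
  also have "\<dots> = c * (1 - u ^ n) * (1 - v ^ m)"
    by (simp only: one_diff_power_eq)
  finally show ?thesis by (simp add: algebra_simps)
qed

text \<open>Replacing each monomial of a truncation by the corresponding
  \<open>(z ^ n - 1) * (w ^ m - 1)\<close> yields a multiple of \<open>(1 - z) * (1 - w)\<close>.
  The correction consists of partial row and column sums, which are as small as the remainder
  because the full sums vanish.\<close>

lemma vanishing_in_principal_closure:
  assumes f: "f \<in> wiener_class \<alpha> \<beta>" and ab: "0 \<le> \<alpha>" "0 \<le> \<beta>"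
    and lin: "(\<lambda>p. (1 - fst p) * (1 - snd p)) \<in> principal_closure \<alpha> \<beta> f"
    and g: "g \<in> wiener_class \<alpha> \<beta>" and cont: "continuous_on closed_bidisc g"
    and zero: "\<And>z. norm z \<le> 1 \<Longrightarrow> g (1, z) = 0" "\<And>z. norm z \<le> 1 \<Longrightarrow> g (z, 1) = 0"
  shows "g \<in> principal_closure \<alpha> \<beta> f"
proof (rule principal_closure_closed[OF f g ab])
  fix e :: real assume "e > 0"
  define a where "a = coeff2 g"
  have exp_closed: "((\<lambda>(n, m). a (n, m) * z ^ n * w ^ m) has_sum g (z, w)) UNIV"
    if "norm z \<le> 1" "norm w \<le> 1" for z w
    unfolding a_def by (rule expands2_closed_bidisc[OF g cont ab that])
  have aw: "(\<lambda>p. norm (a p) * wiener_weight \<alpha> \<beta> p) summable_on UNIV"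
    unfolding a_def by (rule wiener_classD(2)[OF g])
  have a_le: "norm (a p) \<le> norm (a p) * wiener_weight \<alpha> \<beta> p" for p
    using mult_left_mono[OF wiener_weight_ge_1[OF ab, of p], of "norm (a p)"] by simp
  have as: "(\<lambda>p. norm (a p)) summable_on UNIV"
    by (rule summable_on_comparison_test[OF aw a_le]) auto
  have col: "((\<lambda>n. a (n, m)) has_sum 0) UNIV" for m
    by (rule column_sums_zero[OF as]) (use exp_closed[of 1] zero(1) in auto)
  \<comment> \<open>Transposing the coefficients lets the statements about columns serve for
    rows.\<close>
  define a' where "a' = (\<lambda>(m, n). a (n, m))"
  have "(\<lambda>(n, m). norm (a (n, m))) summable_on (UNIV \<times> UNIV)" using as by (simp add: case_prod_unfold)
  hence "(\<lambda>(m, n). norm (a (n, m))) summable_on (UNIV \<times> UNIV)"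
    by (subst (asm) summable_on_swap) simp
  hence as': "(\<lambda>p. norm (a' p)) summable_on UNIV" by (simp add: a'_def case_prod_unfold)
  have row: "((\<lambda>m. a (n, m)) has_sum 0) UNIV" for n
  proof -
    have "((\<lambda>m. a' (m, n)) has_sum 0) UNIV"
    proof (rule column_sums_zero[OF as'])
      fix z :: complex assume z: "norm z < 1"
      have "((\<lambda>(n, m). a (n, m) * z ^ n) has_sum 0) (UNIV \<times> UNIV)"
        using exp_closed[of z 1] zero(2)[of z] z by simp
      hence "((\<lambda>(m, n). a (n, m) * z ^ n) has_sum 0) (UNIV \<times> UNIV)"
        by (subst (asm) has_sum_swap) simp
      thus "((\<lambda>(m, n). a' (m, n) * z ^ n) has_sum 0) UNIV" by (simp add: a'_def)
    qed
    thus ?thesis by (simp add: a'_def)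
  qed
  obtain N where N: "wiener_norm \<alpha> \<beta> (\<lambda>p. g p - truncation N g p) < e / 4"
    using truncation_tendsto[OF g, of "e / 4"] \<open>e > 0\<close> by auto
  let ?B = "{..<N} \<times> {..<N}"
  define \<tau> where "\<tau> = wiener_norm \<alpha> \<beta> (\<lambda>p. g p - truncation N g p)"
  define t where "t = (\<lambda>p. g p - truncation N g p)"
  have tc: "t \<in> wiener_class \<alpha> \<beta>"
    unfolding t_def by (rule wiener_class_diff(1)[OF g wiener_class_truncation])
  have "((\<lambda>p. norm (coeff2 t p) * wiener_weight \<alpha> \<beta> p) has_sum \<tau>) UNIV"
    unfolding \<tau>_def t_def[symmetric] wiener_norm_def by (rule has_sum_infsum[OF wiener_classD(2)[OF tc]])
  moreover have "(\<lambda>p. norm (coeff2 t p) * wiener_weight \<alpha> \<beta> p) =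
      (\<lambda>p. if p \<in> ?B then 0 else norm (a p) * wiener_weight \<alpha> \<beta> p)"
    unfolding t_def coeff2_eq[OF expands2_tail[OF g]] a_def by auto
  ultimately have d: "((\<lambda>p. if p \<in> ?B then 0 else norm (a p) * wiener_weight \<alpha> \<beta> p) has_sum \<tau>) UNIV"
    by simp
  moreover have "(\<lambda>(n, m). if (n, m) \<in> ?B then 0 else norm (a (n, m)) * wiener_weight \<alpha> \<beta> (n, m)) =
      (\<lambda>p. if p \<in> ?B then 0 else norm (a p) * wiener_weight \<alpha> \<beta> p)"
    by (auto simp: fun_eq_iff)
  ultimately have "((\<lambda>(n, m). if (n, m) \<in> ?B then 0 else norm (a (n, m)) * wiener_weight \<alpha> \<beta> (n, m)) has_sum \<tau>) (UNIV \<times> UNIV)"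
    by simp
  hence "((\<lambda>(m, n). if (n, m) \<in> ?B then 0 else norm (a (n, m)) * wiener_weight \<alpha> \<beta> (n, m)) has_sum \<tau>) (UNIV \<times> UNIV)"
    by (subst (asm) has_sum_swap) simp
  moreover have "(\<lambda>(m, n). if (n, m) \<in> ?B then 0 else norm (a (n, m)) * wiener_weight \<alpha> \<beta> (n, m)) =
      (\<lambda>p. if p \<in> ?B then 0 else norm (a' p) * wiener_weight \<beta> \<alpha> p)"
    by (auto simp: fun_eq_iff a'_def wiener_weight_def mult_ac)
  ultimately have d': "((\<lambda>p. if p \<in> ?B then 0 else norm (a' p) * wiener_weight \<beta> \<alpha> p) has_sum \<tau>) UNIV"
    by simp
  define b where "b = (\<lambda>m. \<Sum>n<N. a (n, m))"
  define b' where "b' = (\<lambda>n. \<Sum>m<N. a (n, m))"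
  have bb: "(\<Sum>m<N. norm (b m) * (1 + real m) powr \<beta>) \<le> \<tau>"
    unfolding b_def by (rule column_sums_bound[OF d col ab(1)])
  have bb': "(\<Sum>n<N. norm (b' n) * (1 + real n) powr \<alpha>) \<le> \<tau>"
    using column_sums_bound[OF d' _ ab(2)] row by (simp add: a'_def b'_def)
  \<comment> \<open>Expanding the products in \<open>G\<close> gives the truncation minus
    \<open>P1\<close> minus \<open>P2\<close> plus \<open>P3\<close>. Each of the three has norm at
    most \<open>\<tau>\<close>, so with the remainder there are four errors, each less than
    \<open>e / 4\<close>.\<close>
  define P1 where "P1 = (\<lambda>p::complex \<times> complex. \<Sum>m<N. b m * fst p ^ 0 * snd p ^ m)"
  define P2 where "P2 = (\<lambda>p::complex \<times> complex. \<Sum>n<N. b' n * fst p ^ n * snd p ^ 0)"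
  define P3 where "P3 = (\<lambda>p::complex \<times> complex. (\<Sum>m<N. b m) * fst p ^ 0 * snd p ^ 0)"
  have P1: "P1 \<in> wiener_class \<alpha> \<beta>" "wiener_norm \<alpha> \<beta> P1 \<le> \<tau>"
    using wiener_class_sum[of "{..<N}" "\<lambda>m p. b m * fst p ^ 0 * snd p ^ m" \<alpha> \<beta>, OF wiener_class_monomial] bb
    unfolding P1_def wiener_norm_monomial by (auto simp: wiener_weight_def)
  have P2: "P2 \<in> wiener_class \<alpha> \<beta>" "wiener_norm \<alpha> \<beta> P2 \<le> \<tau>"
    using wiener_class_sum[of "{..<N}" "\<lambda>n p. b' n * fst p ^ n * snd p ^ 0" \<alpha> \<beta>, OF wiener_class_monomial] bb'
    unfolding P2_def wiener_norm_monomial by (auto simp: wiener_weight_def)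
  have P3: "P3 \<in> wiener_class \<alpha> \<beta>" "wiener_norm \<alpha> \<beta> P3 \<le> \<tau>"
  proof -
    show "P3 \<in> wiener_class \<alpha> \<beta>" unfolding P3_def by (rule wiener_class_monomial)
    have "norm (\<Sum>m<N. b m) \<le> (\<Sum>m<N. norm (b m) * (1 + real m) powr \<beta>)"
    proof (rule sum_norm_le)
      fix m
      have "1 \<le> (1 + real m) powr \<beta>" using ab by (intro ge_one_powr_ge_zero) auto
      thus "norm (b m) \<le> norm (b m) * (1 + real m) powr \<beta>"
        using mult_left_mono[of 1 "(1 + real m) powr \<beta>" "norm (b m)"] by simp
    qed
    thus "wiener_norm \<alpha> \<beta> P3 \<le> \<tau>"
      unfolding P3_def wiener_norm_monomial using bb by (simp add: wiener_weight_def)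
  qed
  define G where "G = (\<lambda>p::complex \<times> complex. \<Sum>q\<in>?B. a q * (fst p ^ fst q - 1) * (snd p ^ snd q - 1))"
  have G: "G \<in> principal_closure \<alpha> \<beta> f"
    unfolding G_def
  proof (rule principal_closure_sum[OF f ab])
    fix q :: "nat \<times> nat"
    have mem: "(\<lambda>p. (1 - fst p) * (1 - snd p) * (\<Sum>i<fst q. \<Sum>j<snd q. a q * fst p ^ i * snd p ^ j)) \<in> principal_closure \<alpha> \<beta> f"
      by (rule principal_closure_mult[OF f _ ab lin])
        (intro conjunct1[OF wiener_class_sum] wiener_class_monomial)
    have fac: "(1 - fst p) * (1 - snd p) * (\<Sum>i<fst q. \<Sum>j<snd q. a q * fst p ^ i * snd p ^ j) =
        a q * (fst p ^ fst q - 1) * (snd p ^ snd q - 1)" for p :: "complex \<times> complex"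
      by (rule power_minus_one_product)
    show "(\<lambda>p. a q * (fst p ^ fst q - 1) * (snd p ^ snd q - 1)) \<in> principal_closure \<alpha> \<beta> f"
      using mem unfolding fac .
  qed
  have eq: "g p - G p = t p + (P1 p + P2 p - P3 p)" for p
  proof -
    have "P1 p = (\<Sum>m<N. \<Sum>n<N. a (n, m) * snd p ^ m)"
      by (simp add: P1_def b_def sum_distrib_right)
    also have "\<dots> = (\<Sum>n<N. \<Sum>m<N. a (n, m) * snd p ^ m)" by (rule sum.swap)
    finally have 1: "P1 p = (\<Sum>q\<in>?B. a q * snd p ^ snd q)"
      by (simp add: sum.cartesian_product case_prod_unfold)
    have 2: "P2 p = (\<Sum>q\<in>?B. a q * fst p ^ fst q)"
      unfolding P2_def b'_def by (simp add: sum_distrib_right sum.cartesian_product case_prod_unfold)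
    have 3: "P3 p = (\<Sum>q\<in>?B. a q)"
      unfolding P3_def b_def by (subst sum.swap) (simp add: sum.cartesian_product)
    have 4: "truncation N g p = (\<Sum>q\<in>?B. a q * fst p ^ fst q * snd p ^ snd q)"
      by (simp add: truncation_def a_def case_prod_unfold)
    have "G p = truncation N g p - P1 p - P2 p + P3 p"
      unfolding G_def 1 2 3 4 sum_subtractf[symmetric] sum.distrib[symmetric]
      by (intro sum.cong refl) (simp add: algebra_simps)
    thus ?thesis by (simp add: t_def)
  qed
  have "wiener_norm \<alpha> \<beta> (\<lambda>p. g p - G p) \<le> \<tau> + (\<tau> + \<tau> + \<tau>)"
    unfolding eq
    using wiener_class_add(2)[OF tc wiener_class_diff(1)[OF wiener_class_add(1)[OF P1(1) P2(1)] P3(1)]]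
      wiener_class_diff(2)[OF wiener_class_add(1)[OF P1(1) P2(1)] P3(1)]
      wiener_class_add(2)[OF P1(1) P2(1)] P1(2) P2(2) P3(2)
    unfolding \<tau>_def t_def[symmetric] by linarith
  also have "\<dots> < e" using N by (simp add: \<tau>_def)
  finally show "\<exists>h\<in>principal_closure \<alpha> \<beta> f. wiener_norm \<alpha> \<beta> (\<lambda>p. g p - h p) < e"
    using G by blast
qed

section \<open>The two ideals coincide\<close>

theorem mainTheorem3:
  fixes \<alpha> \<beta> :: real and f :: "complex \<times> complex \<Rightarrow> complex"
  assumes "0 < \<alpha>" "\<alpha> < 1" "0 < \<beta>" "\<beta> < 1"
    and "f \<in> wiener_algebra \<alpha> \<beta>"
    and "zero_set f = ({1} \<times> cball 0 1) \<union> (cball 0 1 \<times> {1})"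
    and "\<And>\<epsilon>. \<epsilon> > 0 \<Longrightarrow>
           \<exists>\<eta>>0. \<forall>z\<in>ball 0 1. \<forall>w\<in>ball 0 1.
             min (norm (1 - z)) (norm (1 - w)) < \<eta> \<longrightarrow>
             \<bar>ln (norm (f (z, w)))\<bar> \<le> \<epsilon> / min (norm (1 - z)) (norm (1 - w))"
  shows "closed_ideal_gen (wiener_algebra \<alpha> \<beta>) (wiener_norm \<alpha> \<beta>) f =
         vanishing_ideal (wiener_algebra \<alpha> \<beta>) (({1} \<times> cball 0 1) \<union> (cball 0 1 \<times> {1}))"
proof -
  define E :: "(complex \<times> complex) set" where "E = ({1} \<times> cball 0 1) \<union> (cball 0 1 \<times> {1})"
  note ab = less_imp_le[OF assms(1)] less_imp_le[OF assms(3)]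
  have f: "f \<in> wiener_class \<alpha> \<beta>" "f \<in> bidisc_algebra"
    using assms(5) by (auto simp: wiener_algebra_eq)
  have fcont: "continuous_on closed_bidisc f" using f(2) by (simp add: bidisc_algebra_def)
  have f0: "f p = 0" if "p \<in> E" for p
    using that assms(6) unfolding E_def zero_set_def by blast
  have E_sub: "E \<subseteq> closed_bidisc" by (auto simp: E_def)
  have "g p = 0" if g: "g \<in> closed_ideal_gen (wiener_algebra \<alpha> \<beta>) (wiener_norm \<alpha> \<beta>) f" and p: "p \<in> E" for g p
  proof -
    \<comment> \<open>The norm dominates the modulus on the closed bidisc, and at \<open>p\<close>
      every multiple of \<open>f\<close> vanishes.\<close>
    have "norm (g p) < e" if "e > 0" for e
    proof -
      obtain h where h: "h \<in> wiener_algebra \<alpha> \<beta>" "wiener_norm \<alpha> \<beta> (\<lambda>p. g p - f p * h p) < e"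
        using g \<open>e > 0\<close> unfolding closed_ideal_gen_def norm_closure_def by auto
      have gc: "g \<in> wiener_algebra \<alpha> \<beta>" using g by (simp add: closed_ideal_gen_def norm_closure_def)
      have "(\<lambda>p. g p - f p * h p) \<in> wiener_class \<alpha> \<beta>"
        using gc h(1) by (intro wiener_class_diff wiener_class_mult f ab) (auto simp: wiener_algebra_eq)
      moreover have "continuous_on closed_bidisc (\<lambda>p. g p - f p * h p)"
        using gc h(1) by (intro continuous_on_diff continuous_on_mult fcont) (auto simp: wiener_algebra_eq bidisc_algebra_def)
      ultimately have "norm (g p - f p * h p) \<le> wiener_norm \<alpha> \<beta> (\<lambda>p. g p - f p * h p)"
        using p E_sub ab by (intro norm_le_wiener_norm_closed) auto
      thus ?thesis using h(2) f0[OF p] by simp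
    qed
    from this[of "norm (g p)"] show ?thesis by (cases "g p = 0") auto
  qed
  hence sub: "closed_ideal_gen (wiener_algebra \<alpha> \<beta>) (wiener_norm \<alpha> \<beta>) f \<subseteq> vanishing_ideal (wiener_algebra \<alpha> \<beta>) E"
    by (auto simp: vanishing_ideal_def closed_ideal_gen_def norm_closure_def)
  have low: "\<exists>s0>0. \<forall>s x y. 0 < s \<longrightarrow> s < s0 \<longrightarrow> norm x < 1 \<longrightarrow> norm y < 1 \<longrightarrow>
      s / 8 \<le> norm (1 - x) \<longrightarrow> s / 8 \<le> norm (1 - y) \<longrightarrow> exp (- (8 * \<epsilon> / s)) \<le> norm (f (x, y))" if "\<epsilon> > 0" for \<epsilon>
  proof -
    obtain \<eta> where "\<eta> > 0" "\<forall>z\<in>ball 0 1. \<forall>w\<in>ball 0 1.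
             min (norm (1 - z)) (norm (1 - w)) < \<eta> \<longrightarrow>
             \<bar>ln (norm (f (z, w)))\<bar> \<le> \<epsilon> / min (norm (1 - z)) (norm (1 - w))"
      using assms(7)[OF \<open>\<epsilon> > 0\<close>] by blast
    from lower_bound_away_from_zero_set[OF fcont assms(6) this \<open>\<epsilon> > 0\<close>] show ?thesis .
  qed
  have lin: "(\<lambda>p. (1 - fst p) * (1 - snd p)) \<in> principal_closure \<alpha> \<beta> f"
    by (rule linear_in_principal_closure[OF f(1) ab(1) assms(2) ab(2) assms(4)
        quartic_in_principal_closure[OF f(1) assms(1-4) low]])
  have "g \<in> closed_ideal_gen (wiener_algebra \<alpha> \<beta>) (wiener_norm \<alpha> \<beta>) f"
    if g: "g \<in> vanishing_ideal (wiener_algebra \<alpha> \<beta>) E" for g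
  proof -
    have ga: "g \<in> wiener_algebra \<alpha> \<beta>" and g0: "\<And>p. p \<in> E \<Longrightarrow> g p = 0"
      using g by (auto simp: vanishing_ideal_def)
    have gc: "g \<in> wiener_class \<alpha> \<beta>" "continuous_on closed_bidisc g"
      using ga by (auto simp: wiener_algebra_eq bidisc_algebra_def)
    have cl: "g \<in> principal_closure \<alpha> \<beta> f"
      by (rule vanishing_in_principal_closure[OF f(1) ab lin gc]) (use g0 in \<open>auto simp: E_def\<close>)
    have "\<exists>h\<in>wiener_algebra \<alpha> \<beta>. wiener_norm \<alpha> \<beta> (\<lambda>p. g p - f p * h p) < e" if "e > 0" for e
    proof -
      define K where "K = wiener_norm \<alpha> \<beta> f + 1"
      have K: "0 < K" "wiener_norm \<alpha> \<beta> f \<le> K" by (simp_all add: K_def add_nonneg_pos)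
      obtain y where y: "y \<in> wiener_class \<alpha> \<beta>" "wiener_norm \<alpha> \<beta> (\<lambda>p. g p - f p * y p) < e / 2"
        using principal_closureD[OF cl, of "e / 2"] \<open>e > 0\<close> by auto
      \<comment> \<open>The multiplier has to lie in \<open>wiener_algebra\<close>, while
        \<open>y\<close> is only known to lie in \<open>wiener_class\<close>. A polynomial close to
        \<open>y\<close> takes its place, at the cost of the norm of \<open>f\<close> times the
        distance.\<close>
      obtain M where M: "wiener_norm \<alpha> \<beta> (\<lambda>p. y p - truncation M y p) < e / (2 * K)"
        using truncation_tendsto[OF y(1), of "e / (2 * K)"] \<open>e > 0\<close> K by auto
      let ?h = "truncation M y"
      have d: "(\<lambda>p. y p - ?h p) \<in> wiener_class \<alpha> \<beta>"
        by (rule wiener_class_diff(1)[OF y(1) wiener_class_truncation])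
      have "wiener_norm \<alpha> \<beta> (\<lambda>p. f p * (y p - ?h p)) \<le> wiener_norm \<alpha> \<beta> f * wiener_norm \<alpha> \<beta> (\<lambda>p. y p - ?h p)"
        by (rule wiener_class_mult(2)[OF f(1) d ab])
      also have "\<dots> \<le> K * wiener_norm \<alpha> \<beta> (\<lambda>p. y p - ?h p)" using K by (intro mult_right_mono) auto
      also have "\<dots> < e / 2" using M K by (simp add: field_simps)
      finally have 1: "wiener_norm \<alpha> \<beta> (\<lambda>p. f p * (y p - ?h p)) < e / 2" .
      have "wiener_norm \<alpha> \<beta> (\<lambda>p. (g p - f p * y p) + f p * (y p - ?h p)) \<le>
          wiener_norm \<alpha> \<beta> (\<lambda>p. g p - f p * y p) + wiener_norm \<alpha> \<beta> (\<lambda>p. f p * (y p - ?h p))"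
        by (rule wiener_class_add(2)[OF wiener_class_diff(1)[OF gc(1) wiener_class_mult(1)[OF f(1) y(1) ab]]
            wiener_class_mult(1)[OF f(1) d ab]])
      hence "wiener_norm \<alpha> \<beta> (\<lambda>p. g p - f p * ?h p) < e"
        using y(2) 1 by (simp add: algebra_simps)
      moreover have "?h \<in> wiener_algebra \<alpha> \<beta>"
        by (simp add: wiener_algebra_eq truncation_in_bidisc_algebra)
      ultimately show ?thesis by blast
    qed
    thus ?thesis using ga unfolding closed_ideal_gen_def norm_closure_def by auto
  qed
  thus ?thesis using sub unfolding E_def[symmetric] by blast
qed

end
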